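(* Let $\ell\ge 2$ be an integer, $c\in D(\ell,1)$, and let $F=F_{\ell,c}:Q\to Q$ be the map induced on the cylinder $Q=\mathbb{C}/2\pi i\mathbb{Z}$ by $f_{\ell,c}(z)=c-(\ell-1)\log c+\ell z-e^z$. For every $t>1$ there exist a number $\alpha_t>0$ and a $(t,\alpha_t)$-conformal measure $m_t$ for the map $F:\mathcal{J}(F)\to\mathcal{J}(F)$ with $m_t(\mathcal{J}(F))=1$.
   Context: $D(\ell,1)=\{c\in\mathbb{C}:|c-\ell|<1\}$ and $\log$ is the principal branch. Since $f_{\ell,c}(z+2\pi i k)=f_{\ell,c}(z)+2\pi i\ell k$ for $k\in\mathbb{Z}$, $f=f_{\ell,c}$ induces a unique holomorphic map $F:Q\to Q$ with $F\circ\Pi=\Pi\circ f$, where $\Pi:\mathbb{C}\to Q=\mathbb{C}/2\pi i\mathbb{Z}$ is the quotient map. $|F'|$ is defined by $|F'(\Pi(z))|=|f'(z)|=|\ell-e^z|$. The Julia set $\mathcal{J}(f)$ is the complement in $\mathbb{C}$ of the set where the iterates of $f$ form a normal family, and $\mathcal{J}(F)=\Pi(\mathcal{J}(f))\subset Q$. For $t,\alpha\in\mathbb{R}$, a Borel measure $\nu$ on $\mathcal{J}(F)$ is called $(t,\alpha)$-conformal (for $F$) if for every Borel set $A\subset\mathcal{J}(F)$ such that $F|_A$ is injective, $\nu(F(A))=\int_A\alpha|F'|^t\,d\nu$. *)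

theory Defs
  imports "HOL-Complex_Analysis.Complex_Analysis"
begin

definition cyl_rel :: "complex \<Rightarrow> complex \<Rightarrow> bool" where
  "cyl_rel z w \<longleftrightarrow> (\<exists>k::int. w = z + 2 * of_real pi * \<i> * of_int k)"

lemma equivp_cyl_rel: "equivp cyl_rel"
proof (rule equivpI)
  show "reflp cyl_rel"
    unfolding reflp_def cyl_rel_def by (metis add.right_neutral mult_zero_right of_int_0)
  show "symp cyl_rel"
  proof (rule sympI)
    fix z w assume "cyl_rel z w"
    then obtain k :: int where "w = z + 2 * of_real pi * \<i> * of_int k"
      unfolding cyl_rel_def by blast
    then have "z = w + 2 * of_real pi * \<i> * of_int (- k)" by simp
    then show "cyl_rel w z" unfolding cyl_rel_def by blast
  qed
  show "transp cyl_rel"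
  proof (rule transpI)
    fix x y z assume "cyl_rel x y" "cyl_rel y z"
    then obtain j k :: int where "y = x + 2 * of_real pi * \<i> * of_int j"
      "z = y + 2 * of_real pi * \<i> * of_int k"
      unfolding cyl_rel_def by blast
    then have "z = x + 2 * of_real pi * \<i> * of_int (j + k)" by (simp add: algebra_simps)
    then show "cyl_rel x z" unfolding cyl_rel_def by blast
  qed
qed

quotient_type cyl = complex / cyl_rel
  by (rule equivp_cyl_rel)

lift_definition cyl_proj :: "complex \<Rightarrow> cyl" is "\<lambda>z. z" .

instantiation cyl :: topological_space
begin

definition open_cyl :: "cyl set \<Rightarrow> bool" where
  "open_cyl U \<longleftrightarrow> open (cyl_proj -` U)"

instance
  by standard (auto simp: open_cyl_def vimage_Union)

end

definition f_map :: "int \<Rightarrow> complex \<Rightarrow> complex \<Rightarrow> complex" where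
  "f_map l c z = c - (of_int l - 1) * Ln c + of_int l * z - exp z"

lemma exp_cyl_shift: "exp (z + 2 * of_real pi * \<i> * of_int k) = exp z"
  by (metis exp_plus_2pin mult.assoc mult.commute)

lemma f_map_shift:
  "f_map l c (z + 2 * of_real pi * \<i> * of_int k)
     = f_map l c z + 2 * of_real pi * \<i> * of_int (l * k)"
  by (simp add: f_map_def exp_cyl_shift algebra_simps)

lemma deriv_f_map: "deriv (f_map l c) z = of_int l - exp z"
  unfolding f_map_def by (rule DERIV_imp_deriv) (auto intro!: derivative_eq_intros)

lift_definition F_map :: "int \<Rightarrow> complex \<Rightarrow> cyl \<Rightarrow> cyl" is f_map
  unfolding cyl_rel_def using f_map_shift by blast

lemma F_map_proj: "F_map l c \<circ> cyl_proj = cyl_proj \<circ> f_map l c"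
  by (rule ext, simp, transfer, simp add: equivp_reflp[OF equivp_cyl_rel])

lift_definition F_deriv_abs :: "int \<Rightarrow> complex \<Rightarrow> cyl \<Rightarrow> real"
  is "\<lambda>l c z. cmod (deriv (f_map l c) z)"
  unfolding cyl_rel_def by (auto simp: deriv_f_map exp_cyl_shift)

lemma F_deriv_abs_proj: "F_deriv_abs l c (cyl_proj z) = cmod (of_int l - exp z)"
  by transfer (simp add: deriv_f_map)

text \<open>Normality is with respect to the spherical metric. For holomorphic functions on a connected
  open set, a locally uniform spherical limit is either finite everywhere or identically
  \<open>\<infinity>\<close>; these are the two alternatives below.\<close>

definition normal_family_on :: "complex set \<Rightarrow> (complex \<Rightarrow> complex) set \<Rightarrow> bool" where
  "normal_family_on S \<F> \<longleftrightarrow>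
     (\<forall>h :: nat \<Rightarrow> complex \<Rightarrow> complex. range h \<subseteq> \<F> \<longrightarrow>
       (\<exists>r :: nat \<Rightarrow> nat. strict_mono r \<and>
         ((\<exists>g. \<forall>K. compact K \<and> K \<subseteq> S \<longrightarrow> uniform_limit K (h \<circ> r) g sequentially) \<or>
          (\<forall>K. compact K \<and> K \<subseteq> S \<longrightarrow>
             (\<forall>B. eventually (\<lambda>n. \<forall>z\<in>K. B < cmod (h (r n) z)) sequentially)))))"

definition fatou_set :: "(complex \<Rightarrow> complex) \<Rightarrow> complex set" where
  "fatou_set f = {z. \<exists>S. open S \<and> connected S \<and> z \<in> S \<and> normal_family_on S (range (\<lambda>n. f ^^ n))}"

definition julia_set :: "(complex \<Rightarrow> complex) \<Rightarrow> complex set" where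
  "julia_set f = - fatou_set f"

definition julia_cyl :: "int \<Rightarrow> complex \<Rightarrow> cyl set" where
  "julia_cyl l c = cyl_proj ` julia_set (f_map l c)"

text \<open>Used for \<open>\<alpha> > 0\<close> and \<open>t > 0\<close>, where \<^const>\<open>ennreal\<close> does not truncate
  and \<^term>\<open>0 powr t = 0\<close> is the usual value.\<close>

definition conformal_measure ::
    "int \<Rightarrow> complex \<Rightarrow> real \<Rightarrow> real \<Rightarrow> cyl measure \<Rightarrow> bool" where
  "conformal_measure l c t \<alpha> \<nu> \<longleftrightarrow>
     space \<nu> = julia_cyl l c \<and>
     sets \<nu> = sets (restrict_space borel (julia_cyl l c)) \<and>
     (\<forall>A \<in> sets \<nu>. inj_on (F_map l c) A \<longrightarrow>
        emeasure \<nu> (F_map l c ` A) = (\<integral>\<^sup>+x\<in>A. ennreal (\<alpha> * F_deriv_abs l c x powr t) \<partial>\<nu>))"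

end

theory Submission
  imports Defs "HOL-Probability.Probability" "HOL-Real_Asymp.Real_Asymp"
begin

text \<open>In the coordinate \<open>w = exp z\<close> the map becomes the entire function
  \<open>g w = K * w ^ l * exp (- w)\<close> with a superattracting fixed point \<open>0\<close> and the attracting fixed point
  \<open>c\<close>. The measure lives on the boundary \<open>X\<close> of the basin of \<open>c\<close>: this set is closed, bounded away from
  \<open>0\<close>, completely invariant, does not contain the critical point \<open>l\<close> by Fatou's theorem, and all
  logarithms of its points lie in the Julia set of \<open>f\<close> by Montel's theorem. Complete invariance makes a
  conformal measure on \<open>X\<close> conformal on the whole Julia set.

  For \<open>t > 1\<close> the sum of \<open>|l - v| powr (- t)\<close> over the preimages \<open>v\<close> of a point is bounded, and its part
  over \<open>|v| \<ge> D\<close> is uniformly small for large \<open>D\<close>. As the parameter tends to the spectral radius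
  \<open>\<alpha>\<close> of this transfer operator, its resolvent blows up, so the normalised resolvent evaluated at suitable
  points gives probability measures that are almost eigenmeasures of the dual operator. They are tight by
  the tail estimate, and every weak limit is an eigenmeasure with eigenvalue \<open>\<alpha>\<close>, that is, a
  \<open>(t, \<alpha>)\<close>-conformal measure. Compactness for measures on the plane is reduced to Helly's selection
  theorem on the line by means of a space-filling curve.\<close>

section \<open>Weak compactness of tight measures on the plane\<close>

text \<open>The obstacle is that \<open>X\<close> is unbounded and \<open>g\<close> is
  infinite-to-one, so neither compactness of measures nor continuity of transferred functions is
  automatic. Working on \<open>X\<close> settles three things at once: the distance to the critical
  point \<open>l\<close> is bounded below, so the weight \<open>|l - v| powr (- t)\<close> is
  bounded and \<open>g\<close> has a local inverse branch at every point; closedness and complete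
  invariance are elementary; and of the Julia set only closedness, forward invariance and the
  inclusion of the lifts of \<open>X\<close> have to be known. The number \<open>|l - v|\<close> is
  the logarithmic derivative \<open>|v g'(v) / g v|\<close>, that is, \<open>|F'|\<close> in the
  coordinate \<open>v = exp z\<close>. The condition \<open>t > 1\<close> comes from solving
  \<open>g v = w\<close> by logarithms: \<open>v - l * log v = log (K / w) + 2 pi i k\<close>, so
  the far preimages have norm about \<open>2 pi |k|\<close> and their weights sum like
  \<open>|k| powr (- t)\<close>. The eigenmeasure equation is tested only on functions whose
  transform is continuous on the plane; bumps divided by the weight and supported where
  \<open>g\<close> is injective have this property, and they determine the measure of all Borel
  sets.\<close>

lemma binary_expansion:
  fixes x :: real assumes "0 \<le> x" "x < 1"
  obtains b :: "nat \<Rightarrow> real" where "range b \<subseteq> {0,1}" "(\<lambda>n. b n / 2 ^ Suc n) sums x"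
proof -
  \<comment> \<open>The digits are scaled increments of the dyadic truncations \<open>F\<close> of
    \<open>x\<close>, so the series telescopes; \<open>x < 1\<close> makes its start
    \<open>F 0\<close> vanish.\<close>
  define b where "b n = real_of_int (\<lfloor>2 ^ Suc n * x\<rfloor> - 2 * \<lfloor>2 ^ n * x\<rfloor>)" for n
  have "b n \<in> {0,1}" for n
  proof -
    have "\<lfloor>2 ^ Suc n * x\<rfloor> - 2 * \<lfloor>2 ^ n * x\<rfloor> = 0 \<or> \<lfloor>2 ^ Suc n * x\<rfloor> - 2 * \<lfloor>2 ^ n * x\<rfloor> = 1"
      by (simp add: mult.assoc) linarith
    then show ?thesis unfolding b_def by auto
  qed
  moreover have "(\<lambda>n. b n / 2 ^ Suc n) sums x"
  proof -
    define F where "F n = real_of_int \<lfloor>2 ^ n * x\<rfloor> / 2 ^ n" for n :: nat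
    have "F \<longlonglongrightarrow> x"
    proof (rule LIMSEQ_I)
      fix e :: real assume "e > 0"
      obtain N where N: "(1/2::real) ^ N < e" using \<open>e > 0\<close> real_arch_pow_inv[of e "1/2"] by auto
      have "norm (F n - x) < e" if "n \<ge> N" for n
      proof -
        have "\<bar>F n - x\<bar> * 2 ^ n = \<bar>real_of_int \<lfloor>2 ^ n * x\<rfloor> - 2 ^ n * x\<bar>"
          unfolding F_def by (simp add: abs_mult_pos field_simps)
        also have "\<dots> \<le> 1" by linarith
        finally have "\<bar>F n - x\<bar> \<le> (1/2) ^ n" by (simp add: field_simps)
        also have "\<dots> \<le> (1/2) ^ N" using that by (intro power_decreasing) auto
        finally show ?thesis using N by simp
      qed
      then show "\<exists>N. \<forall>n\<ge>N. norm (F n - x) < e" by blast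
    qed
    from telescope_sums[OF this] have "(\<lambda>n. F (Suc n) - F n) sums (x - F 0)" .
    moreover have "F 0 = 0" using assms unfolding F_def by (simp add: floor_eq_iff)
    moreover have "F (Suc n) - F n = b n / 2 ^ Suc n" for n
      unfolding F_def b_def by (simp add: field_simps)
    ultimately show ?thesis by simp
  qed
  ultimately show ?thesis using that by blast
qed

text \<open>Schoenberg's space-filling curve, stretched so that the interval \<open>[2m, 2m+1]\<close> sweeps out the
  square of side \<open>4m\<close>.\<close>

definition triangle_wave :: "real \<Rightarrow> real" where
  "triangle_wave t = arccos (cos (pi * t)) / pi"

text \<open>Equal to 0 where the wave is at most 1/3 and to 1 where it is at least 2/3: on ternary
  expansions with digits 0 and 2 it reads off the leading digit.\<close>

definition schoenberg_bump :: "real \<Rightarrow> real" where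
  "schoenberg_bump t = max 0 (min 1 (3 * triangle_wave t - 1))"

text \<open>On \<open>[2m, 2m+1]\<close> the wave is \<open>t - 2m\<close>, so the real factor is
  the constant \<open>2m\<close>. Even powers of 3 read the ternary digits for the real part, odd
  powers those for the imaginary part, so the two coordinates can be prescribed
  independently.\<close>

definition plane_curve :: "real \<Rightarrow> complex" where
  "plane_curve t = of_real (t - triangle_wave t) *
     Complex (2 * (\<Sum>n. schoenberg_bump (3 ^ (2 * n) * t) / 2 ^ Suc n) - 1)
             (2 * (\<Sum>n. schoenberg_bump (3 ^ (2 * n + 1) * t) / 2 ^ Suc n) - 1)"

lemma triangle_wave_eq:
  assumes "0 \<le> \<theta>" "\<theta> \<le> 1" shows "triangle_wave (2 * of_int k + \<theta>) = \<theta>"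
proof -
  have "cos (pi * (2 * of_int k + \<theta>)) = cos (pi * \<theta> + (2 * pi) * of_int k)"
    by (simp add: algebra_simps)
  also have "\<dots> = cos (pi * \<theta>)"
    unfolding cos_add by simp
  finally have "triangle_wave (2 * of_int k + \<theta>) = arccos (cos (pi * \<theta>)) / pi"
    unfolding triangle_wave_def by simp
  also have "\<dots> = \<theta>" using assms by (subst arccos_cos) auto
  finally show ?thesis .
qed

lemma continuous_on_triangle_wave: "continuous_on A triangle_wave"
  unfolding triangle_wave_def by (intro continuous_intros continuous_on_arccos') auto

lemma continuous_on_binary_series:
  fixes f :: "nat \<Rightarrow> real \<Rightarrow> real"
  assumes "\<And>n. continuous_on UNIV (f n)" "\<And>n t. \<bar>f n t\<bar> \<le> 1"
  shows "continuous_on UNIV (\<lambda>t. \<Sum>n. f n t / 2 ^ Suc n)"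
proof -
  have "uniform_limit UNIV (\<lambda>n t. \<Sum>i<n. f i t / 2 ^ Suc i) (\<lambda>t. \<Sum>n. f n t / 2 ^ Suc n) sequentially"
  proof (rule Weierstrass_m_test)
    show "norm (f n t / 2 ^ Suc n) \<le> (1/2) ^ Suc n" for n t
      using assms(2)[of n t] by (simp add: field_simps abs_mult)
    show "summable (\<lambda>n. (1/2::real) ^ Suc n)"
      by (subst summable_Suc_iff) (auto intro: summable_geometric)
  qed
  then show ?thesis
    by (rule uniform_limit_theorem[rotated])
       (auto intro!: always_eventually continuous_intros assms(1))
qed

lemma continuous_on_plane_curve: "continuous_on UNIV plane_curve"
proof -
  have b: "continuous_on UNIV (\<lambda>t. schoenberg_bump (r * t))" for r
    unfolding schoenberg_bump_def
    by (intro continuous_intros continuous_on_compose2[OF continuous_on_triangle_wave[of UNIV]]) auto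
  have "continuous_on UNIV (\<lambda>t. \<Sum>n. schoenberg_bump (3 ^ (k n) * t) / 2 ^ Suc n)" for k :: "nat \<Rightarrow> nat"
    by (rule continuous_on_binary_series[OF b]) (auto simp: schoenberg_bump_def)
  from this[of "\<lambda>n. 2 * n"] this[of "\<lambda>n. 2 * n + 1"] show ?thesis
    unfolding plane_curve_def Complex_eq by (intro continuous_intros continuous_on_triangle_wave)
qed

text \<open>Multiplication by 3 shifts the expansion by one place and splits off
  \<open>2 * e k\<close>. This is an even integer, as is every multiple of \<open>2 * m\<close>, and
  the wave has period 2, so only the shifted tail \<open>T k\<close> matters; it lies in
  \<open>[0,1/3]\<close> or \<open>[2/3,1]\<close> according to its first digit.\<close>

lemma schoenberg_bump_ternary:
  fixes e :: "nat \<Rightarrow> real" and m :: int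
  assumes "range e \<subseteq> {0,1}"
  defines "\<tau> \<equiv> (\<Sum>n. 2 * e n / 3 ^ Suc n)"
  shows "\<tau> \<in> {0..1}" "schoenberg_bump (3 ^ k * (2 * of_int m + \<tau>)) = e k"
proof -
  define T where "T k = (\<Sum>n. 2 * e (n + k) / 3 ^ Suc n)" for k
  have e01: "e n = 0 \<or> e n = 1" for n using assms(1) by (auto simp: image_subset_iff)
  have geo: "(\<lambda>n. 2 / 3 ^ Suc n) sums (1::real)"
    using sums_mult[OF geometric_sums[of "1/3::real"], of "2/3"] by (simp add: power_divide)
  have summ: "summable (\<lambda>n. 2 * e (n + k) / 3 ^ Suc n)" for k
  proof (rule summable_comparison_test)
    show "summable (\<lambda>n. 2 / 3 ^ Suc n :: real)" using geo by (rule sums_summable)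
    show "\<exists>N. \<forall>n\<ge>N. norm (2 * e (n + k) / 3 ^ Suc n) \<le> 2 / 3 ^ Suc n"
    proof (intro exI[of _ 0] allI impI)
      fix n show "norm (2 * e (n + k) / 3 ^ Suc n) \<le> 2 / 3 ^ Suc n" using e01[of "n + k"] by auto
    qed
  qed
  have T01: "0 \<le> T k" "T k \<le> 1" for k
  proof -
    show "0 \<le> T k" unfolding T_def by (rule suminf_nonneg[OF summ]) (use e01 in \<open>metis divide_nonneg_nonneg mult_nonneg_nonneg order_refl zero_le_numeral zero_le_one zero_le_power\<close>)
    have "T k \<le> (\<Sum>n. 2 / 3 ^ Suc n)" unfolding T_def
    proof (rule suminf_le[OF _ summ sums_summable[OF geo]])
      fix n show "2 * e (n + k) / 3 ^ Suc n \<le> 2 / 3 ^ Suc n" 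
        using e01[of "n+k"] by auto
    qed
    also have "\<dots> = 1" using geo by (rule sums_unique[symmetric])
    finally show "T k \<le> 1" .
  qed
  have Tstep: "3 * T k = 2 * e k + T (Suc k)" for k
  proof -
    have "T k = (\<Sum>n. 2 * e (Suc n + k) / 3 ^ Suc (Suc n)) + 2 * e (0 + k) / 3 ^ Suc 0"
      using suminf_split_head[OF summ[of k]] unfolding T_def by simp
    also have "(\<Sum>n. 2 * e (Suc n + k) / 3 ^ Suc (Suc n)) = (\<Sum>n. (2 * e (n + Suc k) / 3 ^ Suc n) / 3)"
      by (simp add: mult.commute)
    also have "\<dots> = T (Suc k) / 3" unfolding T_def by (rule suminf_divide[OF summ])
    finally show ?thesis by simp
  qed
  have "\<tau> = T 0" unfolding \<tau>_def T_def by simp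
  then show "\<tau> \<in> {0..1}" using T01[of 0] by auto
  have "\<exists>j::int. 3 ^ k * (2 * of_int m + \<tau>) = 2 * of_int j + T k"
  proof (induction k)
    case 0 then show ?case using \<open>\<tau> = T 0\<close> by auto
  next
    case (Suc k)
    then obtain j :: int where "3 ^ k * (2 * of_int m + \<tau>) = 2 * of_int j + T k" by blast
    then have "3 ^ Suc k * (2 * of_int m + \<tau>) = 2 * (3 * of_int j) + 3 * T k" by simp
    also have "\<dots> = 2 * (3 * of_int j + e k) + T (Suc k)" using Tstep[of k] by simp
    also have "\<exists>i::int. \<dots> = 2 * of_int i + T (Suc k)"
    proof (cases "e k = 0")
      case True then show ?thesis by (intro exI[of _ "3 * j"]) simp
    next
      case False then show ?thesis using e01[of k] by (intro exI[of _ "3 * j + 1"]) simp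
    qed
    finally show ?case .
  qed
  then obtain j :: int where j: "3 ^ k * (2 * of_int m + \<tau>) = 2 * of_int j + T k" by blast
  have "schoenberg_bump (3 ^ k * (2 * of_int m + \<tau>)) = max 0 (min 1 (3 * T k - 1))"
    unfolding j schoenberg_bump_def using T01[of k] by (simp add: triangle_wave_eq)
  also have "\<dots> = e k"
    using T01[of "Suc k"] Tstep[of k] e01[of k] by auto
  finally show "schoenberg_bump (3 ^ k * (2 * of_int m + \<tau>)) = e k" .
qed

text \<open>The coordinates of \<open>v\<close>, rescaled to \<open>[0,1)\<close> by the side
  \<open>4 * m\<close>, are expanded in binary; interleaving the two digit sequences gives the
  ternary digits of a time \<open>t\<close> in \<open>[2m, 2m+1]\<close>.\<close>

lemma plane_curve_onto:
  fixes v :: complex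
  assumes "norm v < 2 * of_int m"
  shows "\<exists>t\<in>{0..2 * of_int m + 1}. plane_curve t = v"
proof -
  have m: "of_int m > (0::real)" using assms norm_ge_zero[of v] by linarith
  define x where "x = (Re v / (2 * of_int m) + 1) / 2"
  define y where "y = (Im v / (2 * of_int m) + 1) / 2"
  have "\<bar>Re v\<bar> < 2 * of_int m" "\<bar>Im v\<bar> < 2 * of_int m"
    using assms abs_Re_le_cmod[of v] abs_Im_le_cmod[of v] by linarith+
  then have xy: "0 \<le> x" "x < 1" "0 \<le> y" "y < 1"
    using m unfolding x_def y_def by (auto simp: field_simps abs_less_iff)
  obtain a where a: "range a \<subseteq> {0,1}" "(\<lambda>n. a n / 2 ^ Suc n) sums x"
    using binary_expansion[OF xy(1,2)] by blast
  obtain b where b: "range b \<subseteq> {0,1}" "(\<lambda>n. b n / 2 ^ Suc n) sums y"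
    using binary_expansion[OF xy(3,4)] by blast
  define e where "e n = (if even n then a (n div 2) else b (n div 2))" for n
  have e: "range e \<subseteq> {0,1}" using a(1) b(1) unfolding e_def by (auto simp: image_subset_iff)
  define \<tau> where "\<tau> = (\<Sum>n. 2 * e n / 3 ^ Suc n)"
  define t where "t = 2 * of_int m + \<tau>"
  note B = schoenberg_bump_ternary[OF e, folded \<tau>_def]
  have "triangle_wave t = \<tau>" unfolding t_def using B(1) by (simp add: triangle_wave_eq)
  moreover have "(\<Sum>n. schoenberg_bump (3 ^ (2 * n) * t) / 2 ^ Suc n) = x"
    unfolding t_def B(2) using a(2) by (simp add: e_def sums_iff)
  moreover have "(\<Sum>n. schoenberg_bump (3 ^ (2 * n + 1) * t) / 2 ^ Suc n) = y"
    unfolding t_def B(2) using b(2) by (simp add: e_def sums_iff)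
  ultimately have "plane_curve t = of_real (2 * of_int m) * Complex (2 * x - 1) (2 * y - 1)"
    unfolding plane_curve_def t_def by simp
  also have "\<dots> = v"
    using m by (simp add: complex_eq_iff x_def y_def field_simps)
  finally show ?thesis using B(1) m by (intro bexI[of _ t]) (auto simp: t_def)
qed

lemma norm_less_even_ceiling: "norm v < 2 * of_int (\<lceil>norm v\<rceil> + 1)"
proof -
  have "0 \<le> norm v" "norm v \<le> of_int \<lceil>norm v\<rceil>" by auto
  then show ?thesis unfolding of_int_add of_int_1 distrib_left by linarith
qed

text \<open>The first hitting time \<open>\<sigma>\<close> is a Borel section of the curve, in
  general discontinuous. It carries the measures to the line, where Helly's theorem gives a limit,
  and the curve carries the limit back. Only the curve has to be continuous: a test function on the
  plane is composed with it, and the curve after \<open>\<sigma>\<close> is the identity.\<close>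

theorem tight_imp_weakly_convergent_subsequence_complex:
  fixes M :: "nat \<Rightarrow> complex measure"
  assumes prob: "\<And>n. prob_space (M n)" and sets: "\<And>n. sets (M n) = sets borel"
    and tight: "\<And>\<epsilon>. \<epsilon> > 0 \<Longrightarrow> \<exists>R. \<forall>n. measure (M n) {v. R < norm v} \<le> \<epsilon>"
  obtains r \<mu> where "strict_mono (r::nat\<Rightarrow>nat)" "prob_space \<mu>" "sets \<mu> = sets borel"
    "\<And>\<phi> B. continuous_on UNIV (\<phi>::complex\<Rightarrow>real) \<Longrightarrow> (\<And>v. \<bar>\<phi> v\<bar> \<le> B) \<Longrightarrow>
       (\<lambda>n. integral\<^sup>L (M (r n)) \<phi>) \<longlonglongrightarrow> integral\<^sup>L \<mu> \<phi>"
proof -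
  let ?\<gamma> = plane_curve
  define \<sigma> where "\<sigma> v = Inf {t. 0 \<le> t \<and> ?\<gamma> t = v}" for v
  have cont: "continuous_on A ?\<gamma>" for A
    using continuous_on_plane_curve continuous_on_subset by blast
  have clos: "closed {t. 0 \<le> t \<and> ?\<gamma> t = v}" for v
  proof -
    have "closed (?\<gamma> -` {v})" 
      using continuous_on_plane_curve by (simp add: continuous_on_closed_vimage)
    moreover have "{t. 0 \<le> t \<and> ?\<gamma> t = v} = {0..} \<inter> ?\<gamma> -` {v}" by auto
    ultimately show ?thesis by auto
  qed
  have ne: "{t. 0 \<le> t \<and> ?\<gamma> t = v} \<noteq> {}" for v
  proof -
    from plane_curve_onto[OF norm_less_even_ceiling[of v]] show ?thesis by auto
  qed
  have \<sigma>: "0 \<le> \<sigma> v" "?\<gamma> (\<sigma> v) = v" for v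
  proof -
    have "bdd_below {t. 0 \<le> t \<and> ?\<gamma> t = v}" by (rule bdd_belowI[of _ 0]) auto
    from closed_contains_Inf[OF ne this clos] show "0 \<le> \<sigma> v" "?\<gamma> (\<sigma> v) = v" unfolding \<sigma>_def by auto
  qed
  have \<sigma>_le: "\<sigma> v \<le> t" if "0 \<le> t" "?\<gamma> t = v" for v t
    unfolding \<sigma>_def by (rule cInf_lower) (use that in \<open>auto intro: bdd_belowI[of _ 0]\<close>)
  have meas: "\<sigma> \<in> borel_measurable borel"
  proof (rule borel_measurableI_le)
    fix a
    \<comment> \<open>The points hit up to time \<open>a\<close> form the image of a compact
      interval; here it matters that \<open>\<sigma>\<close> is the first hitting time.\<close>
    have "{v \<in> space borel. \<sigma> v \<le> a} = ?\<gamma> ` {0..a}"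
      using \<sigma> \<sigma>_le by (auto simp: image_iff) (metis atLeastAtMost_iff order_trans)+
    also have "compact \<dots>" by (rule compact_continuous_image[OF cont]) auto
    then have "?\<gamma> ` {0..a} \<in> sets borel" by (auto intro: borel_closed compact_imp_closed)
    finally show "{v \<in> space borel. \<sigma> v \<le> a} \<in> sets borel" .
  qed
  then have measM: "\<sigma> \<in> borel_measurable (M n)" for n
    using measurable_cong_sets[OF sets refl] by blast
  define N where "N n = distr (M n) borel \<sigma>" for n
  have dist: "real_distribution (N n)" for n
    unfolding N_def by (intro prob_space.real_distribution_distr prob measM)
  have "tight N"
    unfolding tight_def
  proof (intro conjI allI impI)
    fix \<epsilon> :: real assume "\<epsilon> > 0"
    then obtain R where R: "\<And>n. measure (M n) {v. R < norm v} \<le> \<epsilon>/2"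
      using tight[of "\<epsilon>/2"] by auto
    define m where "m = \<lceil>\<bar>R\<bar>\<rceil> + 1"
    define b where "b = 2 * real_of_int m + 1"
    have m: "real_of_int m > \<bar>R\<bar>" unfolding m_def by linarith
    have b: "b > 0" using m unfolding b_def by linarith
    \<comment> \<open>By time \<open>b\<close> the curve has covered the disc of radius
      \<open>R\<close>. The left end is -1 because the half-open interval has to contain the time 0,
      at which the curve passes through the origin.\<close>
    have "measure (N n) {-1<..b} > 1 - \<epsilon>" for n
    proof -
      interpret M: prob_space "M n" by (rule prob)
      have "1 - \<epsilon> < 1 - measure (M n) {v. R < norm v}" using R[of n] \<open>\<epsilon> > 0\<close> by linarith
      also have "\<dots> = measure (M n) (space (M n) - {v. R < norm v})"
        by (subst M.prob_compl) (auto simp: sets)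
      also have "\<dots> \<le> measure (M n) (\<sigma> -` {-1<..b} \<inter> space (M n))"
      proof (rule M.finite_measure_mono)
        show "space (M n) - {v. R < norm v} \<subseteq> \<sigma> -` {-1<..b} \<inter> space (M n)"
        proof
          fix v assume v: "v \<in> space (M n) - {v. R < norm v}"
          then have "norm v < 2 * of_int m" using m by auto
          then obtain t where t: "t \<in> {0..b}" "?\<gamma> t = v"
            using plane_curve_onto unfolding b_def by blast
          then have "\<sigma> v \<le> b" using \<sigma>_le[of t v] by auto
          then show "v \<in> \<sigma> -` {-1<..b} \<inter> space (M n)" using \<sigma>(1)[of v] v by auto
        qed
        show "\<sigma> -` {-1<..b} \<inter> space (M n) \<in> M.events"
          by (rule measurable_sets[OF measM]) simp
      qed
      also have "\<dots> = measure (N n) {-1<..b}"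
        unfolding N_def by (rule measure_distr[symmetric, OF measM]) simp
      finally show ?thesis .
    qed
    then show "\<exists>a b. a < b \<and> (\<forall>n. 1 - \<epsilon> < measure (N n) {a<..b})" 
      using b by (intro exI[of _ "-1"] exI[of _ b]) auto
  qed (rule dist)
  from tight_imp_convergent_subsubsequence[OF this strict_mono_id]
  obtain r Q where r: "strict_mono (r::nat\<Rightarrow>nat)" and Q: "real_distribution Q" and wc: "weak_conv_m (N \<circ> id \<circ> r) Q"
    by blast
  interpret Q: real_distribution Q by (rule Q)
  have \<gamma>m: "?\<gamma> \<in> borel_measurable Q" "?\<gamma> \<in> borel_measurable borel"
    using borel_measurable_continuous_onI[OF continuous_on_plane_curve] by auto
  show ?thesis
  proof (rule that[OF r])
    show "prob_space (distr Q borel ?\<gamma>)" by (rule Q.prob_space_distr[OF \<gamma>m(1)])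
    show "sets (distr Q borel ?\<gamma>) = sets borel" by simp
    fix \<phi> :: "complex \<Rightarrow> real" and B assume \<phi>: "continuous_on UNIV \<phi>" "\<And>v. \<bar>\<phi> v\<bar> \<le> B"
    have \<phi>m: "\<phi> \<in> borel_measurable borel" by (rule borel_measurable_continuous_onI[OF \<phi>(1)])
    have "continuous_on UNIV (\<lambda>x. \<phi> (?\<gamma> x))"
      by (rule continuous_on_compose2[OF \<phi>(1) continuous_on_plane_curve]) auto
    then have ic: "isCont (\<lambda>x. \<phi> (?\<gamma> x)) x" for x by (simp add: continuous_on_eq_continuous_at)
    have "(\<lambda>n. integral\<^sup>L ((N \<circ> id \<circ> r) n) (\<lambda>x. \<phi> (?\<gamma> x))) \<longlonglongrightarrow> integral\<^sup>L Q (\<lambda>x. \<phi> (?\<gamma> x))"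
      by (rule weak_conv_imp_integral_bdd_continuous_conv[OF _ Q wc ic]) (use dist \<phi>(2) in auto)
    moreover have "integral\<^sup>L ((N \<circ> id \<circ> r) n) (\<lambda>x. \<phi> (?\<gamma> x)) = integral\<^sup>L (M (r n)) \<phi>" for n
    proof -
      have "(\<lambda>x. \<phi> (?\<gamma> x)) \<in> borel_measurable borel" using measurable_compose[OF \<gamma>m(2) \<phi>m] .
      then show ?thesis
        unfolding N_def comp_def id_def by (subst integral_distr[OF measM]) (auto simp: \<sigma>)
    qed
    moreover have "integral\<^sup>L Q (\<lambda>x. \<phi> (?\<gamma> x)) = integral\<^sup>L (distr Q borel ?\<gamma>) \<phi>"
      by (rule integral_distr[symmetric, OF \<gamma>m(1) \<phi>m])
    ultimately show "(\<lambda>n. integral\<^sup>L (M (r n)) \<phi>) \<longlonglongrightarrow> integral\<^sup>L (distr Q borel ?\<gamma>) \<phi>" by simp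
  qed
qed

section \<open>Transfer operators and their resolvents\<close>

text \<open>Ruelle's operator with weight \<open>\<psi>\<close>. Writing the sum over preimages as
  an integral against counting measure with values in \<open>ennreal\<close> makes countable
  additivity and monotone convergence available before any convergence is known.\<close>

definition transfer_op :: "'a set \<Rightarrow> ('a \<Rightarrow> 'a) \<Rightarrow> ('a \<Rightarrow> ennreal) \<Rightarrow> ('a \<Rightarrow> ennreal) \<Rightarrow> 'a \<Rightarrow> ennreal"
  where "transfer_op X g \<psi> \<phi> x = (\<integral>\<^sup>+v. \<psi> v * \<phi> v \<partial>count_space {v \<in> X. g v = x})"

text \<open>The Neumann series of the inverse of \<open>1 - L / s\<close>, where \<open>L\<close> is
  the transfer operator.\<close>

definition resolvent :: "'a set \<Rightarrow> ('a \<Rightarrow> 'a) \<Rightarrow> ('a \<Rightarrow> ennreal) \<Rightarrow> real \<Rightarrow> ('a \<Rightarrow> ennreal) \<Rightarrow> 'a \<Rightarrow> ennreal"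
  where "resolvent X g \<psi> s \<phi> x = (\<Sum>k. ennreal ((1/s) ^ k) * (transfer_op X g \<psi> ^^ k) \<phi> x)"

lemma transfer_op_mono:
  assumes "\<And>v. v \<in> X \<Longrightarrow> \<phi> v \<le> \<phi>' v"
  shows "transfer_op X g \<psi> \<phi> x \<le> transfer_op X g \<psi> \<phi>' x"
  unfolding transfer_op_def using assms by (intro nn_integral_mono) (auto intro: mult_left_mono)

lemma transfer_op_iter_mono:
  assumes "\<And>v. v \<in> X \<Longrightarrow> \<phi> v \<le> \<phi>' v" "x \<in> X"
  shows "(transfer_op X g \<psi> ^^ k) \<phi> x \<le> (transfer_op X g \<psi> ^^ k) \<phi>' x"
  using assms by (induction k arbitrary: x) (auto intro: transfer_op_mono)

lemma transfer_op_cmult: "transfer_op X g \<psi> (\<lambda>v. a * \<phi> v) x = a * transfer_op X g \<psi> \<phi> x"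
  unfolding transfer_op_def
  by (subst nn_integral_cmult[symmetric]) (auto simp: mult.left_commute)

lemma transfer_op_iter_cmult:
  "(transfer_op X g \<psi> ^^ k) (\<lambda>v. a * \<phi> v) = (\<lambda>x. a * (transfer_op X g \<psi> ^^ k) \<phi> x)"
proof (induction k)
  case (Suc k)
  show ?case by (rule ext) (simp add: Suc transfer_op_cmult)
qed simp

lemma transfer_op_suminf:
  "transfer_op X g \<psi> (\<lambda>v. \<Sum>i::nat. \<phi> i v) x = (\<Sum>i. transfer_op X g \<psi> (\<phi> i) x)"
  unfolding transfer_op_def by (subst nn_integral_suminf[symmetric]) auto

lemma transfer_op_iter_suminf:
  "(transfer_op X g \<psi> ^^ k) (\<lambda>v. \<Sum>i::nat. \<phi> i v) = (\<lambda>x. \<Sum>i. (transfer_op X g \<psi> ^^ k) (\<phi> i) x)"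
proof (induction k)
  case (Suc k)
  show ?case by (rule ext) (simp add: Suc transfer_op_suminf)
qed simp

lemma resolvent_mono:
  assumes "\<And>v. v \<in> X \<Longrightarrow> \<phi> v \<le> \<phi>' v" "x \<in> X"
  shows "resolvent X g \<psi> s \<phi> x \<le> resolvent X g \<psi> s \<phi>' x"
  unfolding resolvent_def
  by (intro suminf_le mult_left_mono transfer_op_iter_mono assms) auto

lemma resolvent_cong:
  assumes "\<And>v. v \<in> X \<Longrightarrow> \<phi> v = \<phi>' v" "x \<in> X"
  shows "resolvent X g \<psi> s \<phi> x = resolvent X g \<psi> s \<phi>' x"
  using resolvent_mono[of X \<phi> \<phi>' x g \<psi> s] resolvent_mono[of X \<phi>' \<phi> x g \<psi> s] assms by (auto intro: antisym)

lemma resolvent_cmult: "resolvent X g \<psi> s (\<lambda>v. a * \<phi> v) x = a * resolvent X g \<psi> s \<phi> x"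
  unfolding resolvent_def by (simp add: transfer_op_iter_cmult mult.left_commute)

lemma resolvent_suminf:
  "resolvent X g \<psi> s (\<lambda>v. \<Sum>i::nat. \<phi> i v) x = (\<Sum>i. resolvent X g \<psi> s (\<phi> i) x)"
proof -
  have "resolvent X g \<psi> s (\<lambda>v. \<Sum>i. \<phi> i v) x
      = (\<Sum>k. \<Sum>i. ennreal ((1/s) ^ k) * (transfer_op X g \<psi> ^^ k) (\<phi> i) x)"
    unfolding resolvent_def transfer_op_iter_suminf by simp
  also have "\<dots> = (\<integral>\<^sup>+k. (\<Sum>i. ennreal ((1/s) ^ k) * (transfer_op X g \<psi> ^^ k) (\<phi> i) x) \<partial>count_space UNIV)"
    by (simp add: nn_integral_count_space_nat)
  also have "\<dots> = (\<Sum>i. \<integral>\<^sup>+k. ennreal ((1/s) ^ k) * (transfer_op X g \<psi> ^^ k) (\<phi> i) x \<partial>count_space UNIV)"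
    by (rule nn_integral_suminf) auto
  finally show ?thesis unfolding resolvent_def by (simp add: nn_integral_count_space_nat)
qed

lemma transfer_op_SUP:
  assumes "incseq U"
  shows "transfer_op X g \<psi> (\<lambda>v. SUP i. U i v) x = (SUP i. transfer_op X g \<psi> (U i) x)"
  unfolding transfer_op_def SUP_mult_left_ennreal
  using assms by (intro nn_integral_monotone_convergence_SUP)
    (auto simp: incseq_def le_fun_def intro!: mult_left_mono)

lemma transfer_op_iter_SUP:
  assumes "incseq U"
  shows "incseq (\<lambda>i. (transfer_op X g \<psi> ^^ k) (U i)) \<and>
    (transfer_op X g \<psi> ^^ k) (\<lambda>v. SUP i. U i v) = (\<lambda>x. SUP i. (transfer_op X g \<psi> ^^ k) (U i) x)"
proof (induction k)
  case (Suc k)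
  then have 1: "incseq (\<lambda>i. (transfer_op X g \<psi> ^^ Suc k) (U i))"
    by (auto simp: incseq_def le_fun_def intro!: transfer_op_mono dest: monotoneD)
  show ?case using 1 Suc by (auto simp: transfer_op_SUP)
qed (use assms in auto)

lemma resolvent_SUP:
  assumes "incseq U"
  shows "resolvent X g \<psi> s (\<lambda>v. SUP i. U i v) x = (SUP i. resolvent X g \<psi> s (U i) x)"
proof -
  have "resolvent X g \<psi> s (\<lambda>v. SUP i. U i v) x
      = (\<Sum>k. SUP i. ennreal ((1/s) ^ k) * (transfer_op X g \<psi> ^^ k) (U i) x)"
    unfolding resolvent_def by (simp add: transfer_op_iter_SUP[OF assms] SUP_mult_left_ennreal)
  also have "\<dots> = (SUP i. resolvent X g \<psi> s (U i) x)"
    unfolding resolvent_def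
    by (rule ennreal_suminf_SUP_eq)
       (use transfer_op_iter_SUP[OF assms] in \<open>auto simp: incseq_def le_fun_def intro!: mult_left_mono\<close>)
  finally show ?thesis .
qed

lemma resolvent_zero: "resolvent X g \<psi> s (\<lambda>v. 0) x = 0"
  using resolvent_cmult[of X g \<psi> s 0 "\<lambda>_. 0" x] by simp

text \<open>Finite additivity is countable additivity for a sequence padded with zeros.\<close>

lemma resolvent_add:
  "resolvent X g \<psi> s (\<lambda>v. \<phi> v + \<phi>' v) x = resolvent X g \<psi> s \<phi> x + resolvent X g \<psi> s \<phi>' x"
proof -
  have 2: "(\<Sum>i. f i) = f 0 + f (1::nat)" if "\<And>i. i > 1 \<Longrightarrow> f i = 0" for f :: "nat \<Rightarrow> ennreal"
  proof -
    have "(\<Sum>i. f i) = sum f {0,1}" by (rule suminf_finite) (use that in auto)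
    then show ?thesis by simp
  qed
  let ?f = "\<lambda>i::nat. if i = 0 then \<phi> else if i = 1 then \<phi>' else (\<lambda>_. 0)"
  have "resolvent X g \<psi> s (\<lambda>v. \<Sum>i. ?f i v) x = (\<Sum>i. resolvent X g \<psi> s (?f i) x)"
    by (rule resolvent_suminf)
  then show ?thesis by (subst (asm) 2, simp, subst (asm) 2) (auto simp: resolvent_zero)
qed

lemma resolvent_split_head:
  assumes "s > 0"
  shows "resolvent X g \<psi> s \<phi> x = \<phi> x + ennreal (1/s) * resolvent X g \<psi> s (transfer_op X g \<psi> \<phi>) x"
proof -
  have "resolvent X g \<psi> s \<phi> x = \<phi> x + (\<Sum>k. ennreal ((1/s) ^ Suc k) * (transfer_op X g \<psi> ^^ Suc k) \<phi> x)"
    unfolding resolvent_def by (subst suminf_offset[where i = 1]) (auto simp: add.commute)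
  also have "(\<Sum>k. ennreal ((1/s) ^ Suc k) * (transfer_op X g \<psi> ^^ Suc k) \<phi> x)
    = (\<Sum>k. ennreal (1/s) * (ennreal ((1/s) ^ k) * (transfer_op X g \<psi> ^^ k) (transfer_op X g \<psi> \<phi>) x))"
    using assms by (intro suminf_cong) (simp add: funpow_swap1 ennreal_mult[symmetric] mult.assoc[symmetric])
  finally show ?thesis unfolding resolvent_def by simp
qed

text \<open>The companion of \<open>resolvent_split_head\<close> with \<open>L\<close> outside the
  resolvent. The version with \<open>L\<close> inside yields the dual equation for measures; this
  one shows that the resolvent of 1 is almost an eigenfunction.\<close>

lemma resolvent_unfold:
  assumes "s > 0"
  shows "resolvent X g \<psi> s \<phi> x = \<phi> x + ennreal (1/s) * transfer_op X g \<psi> (resolvent X g \<psi> s \<phi>) x"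
proof -
  have "resolvent X g \<psi> s \<phi> x = \<phi> x + (\<Sum>k. ennreal ((1/s) ^ Suc k) * (transfer_op X g \<psi> ^^ Suc k) \<phi> x)"
    unfolding resolvent_def by (subst suminf_offset[where i = 1]) (auto simp: add.commute)
  also have "(\<Sum>k. ennreal ((1/s) ^ Suc k) * (transfer_op X g \<psi> ^^ Suc k) \<phi> x)
    = (\<Sum>k. ennreal (1/s) * (ennreal ((1/s) ^ k) * (transfer_op X g \<psi> ((transfer_op X g \<psi> ^^ k) \<phi>)) x))"
    using assms by (intro suminf_cong) (simp add: ennreal_mult[symmetric] mult.assoc[symmetric])
  also have "\<dots> = ennreal (1/s) * transfer_op X g \<psi> (resolvent X g \<psi> s \<phi>) x"
    unfolding resolvent_def[abs_def] by (simp add: transfer_op_suminf transfer_op_cmult)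
  finally show ?thesis .
qed

lemma resolvent_bound_of_iterates:
  assumes "\<And>k. (transfer_op X g \<psi> ^^ k) \<phi> x \<le> ennreal (\<theta> ^ k * M)" "0 \<le> \<theta>" "\<theta> < s" "0 \<le> M"
  shows "resolvent X g \<psi> s \<phi> x \<le> ennreal (M / (1 - \<theta>/s))"
proof -
  have "resolvent X g \<psi> s \<phi> x \<le> (\<Sum>k. ennreal ((\<theta>/s) ^ k * M))"
    unfolding resolvent_def
  proof (rule suminf_le)
    fix k
    have "ennreal ((1/s) ^ k) * (transfer_op X g \<psi> ^^ k) \<phi> x \<le> ennreal ((1/s) ^ k) * ennreal (\<theta> ^ k * M)"
      by (intro mult_left_mono assms) auto
    also have "\<dots> = ennreal ((\<theta>/s) ^ k * M)"
      using assms by (subst ennreal_mult[symmetric]) (auto simp: power_divide)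
    finally show "ennreal ((1/s) ^ k) * (transfer_op X g \<psi> ^^ k) \<phi> x \<le> ennreal ((\<theta>/s) ^ k * M)" .
  qed auto
  also have "\<dots> = ennreal (\<Sum>k. (\<theta>/s) ^ k * M)"
    using assms by (intro suminf_ennreal2) (auto intro!: summable_mult2 summable_geometric)
  also have "(\<Sum>k. (\<theta>/s) ^ k * M) = M / (1 - \<theta>/s)"
    using assms by (subst suminf_mult2[symmetric]) (auto intro!: summable_geometric simp: suminf_geometric)
  finally show ?thesis .
qed

text \<open>With \<open>U\<close> the resolvent of 1 at \<open>s\<close>,
  \<open>U = 1 + L U / s\<close> gives \<open>L U = s (U - 1)\<close>. The bound
  \<open>U \<le> M\<close> means \<open>1 \<ge> U / M\<close>, hence
  \<open>L U \<le> s (1 - 1/M) U\<close>. The iterates of \<open>L\<close> thus grow at most like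
  powers of \<open>\<theta> = s (1 - 1/M)\<close>, and since \<open>U \<ge> 1\<close> this controls
  the series at every parameter above \<open>\<theta>\<close>.\<close>

lemma resolvent_bounded_open:
  assumes s: "s > 0" and M: "M \<ge> 1" and bd: "\<And>x. x \<in> X \<Longrightarrow> resolvent X g \<psi> s (\<lambda>_. 1) x \<le> ennreal M"
    and s': "s' > s * (1 - 1/M)"
  shows "\<exists>M'. \<forall>x\<in>X. resolvent X g \<psi> s' (\<lambda>_. 1) x \<le> ennreal M'"
proof -
  define \<theta> where "\<theta> = s * (1 - 1/M)"
  define U where "U = resolvent X g \<psi> s (\<lambda>_. 1)"
  let ?L = "transfer_op X g \<psi>"
  have \<theta>: "0 \<le> \<theta>" using s M unfolding \<theta>_def by (auto simp: field_simps)
  have U_eq: "U x = 1 + ennreal (1/s) * ?L U x" for x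
    unfolding U_def by (rule resolvent_unfold[OF s])
  have LU: "?L U x \<le> ennreal \<theta> * U x" if x: "x \<in> X" for x
  proof -
    have fin: "U x < top" using bd[OF x] unfolding U_def by (simp add: order_le_less_trans)
    then have "ennreal (1/s) * ?L U x < top" using U_eq[of x] by (metis ennreal_add_less_top)
    then have "?L U x < top" using s by (auto simp: ennreal_mult_less_top)
    then obtain a where a: "?L U x = ennreal a" "a \<ge> 0" by (cases "?L U x") auto
    obtain u where u: "U x = ennreal u" "u \<ge> 0" using fin by (cases "U x") auto
    have "ennreal u = ennreal (1 + 1/s * a)"
      using U_eq[of x] unfolding u(1) a(1) using a(2) s by (simp add: ennreal_mult[symmetric])
    then have ua: "u = 1 + a / s" using u a s by (subst (asm) ennreal_inj) auto
    have "u \<le> M" using bd[OF x] u M unfolding U_def by (simp add: ennreal_le_iff)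
    then have "u / M \<le> 1" using M by auto
    then have "a \<le> \<theta> * u" using ua s M unfolding \<theta>_def by (simp add: field_simps)
    then show ?thesis using a u \<theta> by (simp add: ennreal_mult[symmetric] ennreal_leI)
  qed
  have LkU: "(?L ^^ k) U x \<le> ennreal (\<theta> ^ k) * U x" if "x \<in> X" for k x
    using that
  proof (induction k arbitrary: x)
    case (Suc k)
    have "(?L ^^ Suc k) U x \<le> ?L (\<lambda>x. ennreal (\<theta> ^ k) * U x) x"
      by (simp) (rule transfer_op_mono, rule Suc.IH)
    also have "\<dots> = ennreal (\<theta> ^ k) * ?L U x" by (rule transfer_op_cmult)
    also have "\<dots> \<le> ennreal (\<theta> ^ k) * (ennreal \<theta> * U x)" by (intro mult_left_mono LU Suc.prems) auto
    also have "\<dots> = ennreal (\<theta> ^ Suc k) * U x" using \<theta> by (simp add: ennreal_mult mult_ac)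
    finally show ?case .
  qed simp
  have "resolvent X g \<psi> s' (\<lambda>_. 1) x \<le> ennreal (M / (1 - \<theta>/s'))" if x: "x \<in> X" for x
  proof (rule resolvent_bound_of_iterates)
    fix k
    have "(?L ^^ k) (\<lambda>_. 1) x \<le> (?L ^^ k) U x"
      by (rule transfer_op_iter_mono[OF _ x]) (subst U_eq, simp)
    also have "\<dots> \<le> ennreal (\<theta> ^ k) * U x" by (rule LkU[OF x])
    also have "\<dots> \<le> ennreal (\<theta> ^ k) * ennreal M" using bd[OF x] unfolding U_def by (intro mult_left_mono) auto
    also have "\<dots> = ennreal (\<theta> ^ k * M)" using \<theta> M by (simp add: ennreal_mult)
    finally show "(?L ^^ k) (\<lambda>_. 1) x \<le> ennreal (\<theta> ^ k * M)" .
  qed (use \<theta> M s' in \<open>auto simp: \<theta>_def\<close>)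
  then show ?thesis by blast
qed

text \<open>The parameter \<open>r\<close> is the spectral radius. The set of parameters with bounded resolvent is open by
  the previous lemma, so the resolvent cannot stay bounded near its infimum \<open>r\<close>.\<close>

lemma resolvent_critical_parameter:
  assumes C: "\<And>x. x \<in> X \<Longrightarrow> transfer_op X g \<psi> (\<lambda>_. 1) x \<le> ennreal C" "0 \<le> C"
    and X0: "X0 \<subseteq> X" "X0 \<noteq> {}" and \<eta>: "\<eta> > 0"
    and low: "\<And>x. x \<in> X0 \<Longrightarrow> transfer_op X g \<psi> (indicator X0) x \<ge> ennreal \<eta>"
  obtains r s x where "r > 0" "s \<longlonglongrightarrow> r" "\<And>n::nat. s n \<ge> r" "\<And>n. x n \<in> X"
    "\<And>n. resolvent X g \<psi> (s n) (\<lambda>_. 1) (x n) < top"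
    "\<And>n. resolvent X g \<psi> (s n) (\<lambda>_. 1) (x n) \<ge> of_nat n"
proof -
  let ?L = "transfer_op X g \<psi>" and ?R = "resolvent X g \<psi>"
  define G where "G = {s. s > 0 \<and> (\<exists>M. \<forall>x\<in>X. ?R s (\<lambda>_. 1) x \<le> ennreal M)}"
  have Lk: "(?L ^^ k) (\<lambda>_. 1) x \<le> ennreal (C ^ k * 1)" if "x \<in> X" for k x
    using that
  proof (induction k arbitrary: x)
    case (Suc k)
    have "(?L ^^ Suc k) (\<lambda>_. 1) x \<le> ?L (\<lambda>x. ennreal (C ^ k) * 1) x"
      by simp (rule transfer_op_mono, use Suc.IH in auto)
    also have "\<dots> = ennreal (C ^ k) * ?L (\<lambda>_. 1) x" by (rule transfer_op_cmult)
    also have "\<dots> \<le> ennreal (C ^ k) * ennreal C" by (intro mult_left_mono C Suc.prems) auto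
    also have "\<dots> = ennreal (C ^ Suc k * 1)" using C by (simp add: ennreal_mult mult_ac)
    finally show ?case .
  qed simp
  have "C + 1 \<in> G"
    unfolding G_def using resolvent_bound_of_iterates[OF Lk, of _ "C+1"] C(2) by auto
  then have Gne: "G \<noteq> {}" by blast
  have low_k: "(?L ^^ k) (indicator X0) x \<ge> ennreal (\<eta> ^ k) * indicator X0 x" for k x
  proof (induction k arbitrary: x)
    case (Suc k)
    have "ennreal (\<eta> ^ Suc k) * indicator X0 x = ennreal (\<eta> ^ k) * (ennreal \<eta> * indicator X0 x)"
      using \<eta> by (simp add: ennreal_mult mult_ac)
    also have "\<dots> \<le> ennreal (\<eta> ^ k) * ?L (indicator X0) x"
      using low by (intro mult_left_mono) (auto simp: indicator_def)
    also have "\<dots> = ?L (\<lambda>v. ennreal (\<eta> ^ k) * indicator X0 v) x" by (rule transfer_op_cmult[symmetric])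
    also have "\<dots> \<le> (?L ^^ Suc k) (indicator X0) x" by simp (rule transfer_op_mono, rule Suc.IH)
    finally show ?case .
  qed simp
  \<comment> \<open>The lower bound on \<open>X0\<close> propagates to the iterates as
    \<open>\<eta> ^ k\<close>. For \<open>s \<le> \<eta>\<close> every term of the resolvent series
    on \<open>X0\<close> is then at least 1 and the series diverges; this is what makes
    \<open>r\<close> positive.\<close>
  have G_low: "\<eta> < s" if "s \<in> G" for s
  proof (rule ccontr)
    assume "\<not> \<eta> < s"
    from that obtain M where s: "s > 0" and M: "\<And>x. x \<in> X \<Longrightarrow> ?R s (\<lambda>_. 1) x \<le> ennreal M" unfolding G_def by blast
    obtain x where x: "x \<in> X0" using X0 by blast
    have "(1::ennreal) \<le> ennreal ((1/s) ^ k) * (?L ^^ k) (\<lambda>_. 1) x" for k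
    proof -
      have "(1::real) \<le> (1/s) ^ k * \<eta> ^ k"
        using \<open>\<not> \<eta> < s\<close> s by (auto simp: power_divide intro!: power_mono)
      then have "(1::ennreal) \<le> ennreal ((1/s) ^ k * \<eta> ^ k)" using ennreal_leI by fastforce
      also have "\<dots> = ennreal ((1/s) ^ k) * (ennreal (\<eta> ^ k) * indicator X0 x)"
        using x s \<eta> by (simp add: ennreal_mult)
      also have "\<dots> \<le> ennreal ((1/s) ^ k) * (?L ^^ k) (indicator X0) x"
        by (intro mult_left_mono low_k) auto
      also have "\<dots> \<le> ennreal ((1/s) ^ k) * (?L ^^ k) (\<lambda>_. 1) x"
        by (intro mult_left_mono transfer_op_iter_mono) (use x X0 in \<open>auto simp: indicator_def\<close>)
      finally show ?thesis .
    qed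
    then have "(\<Sum>k. 1::ennreal) \<le> ?R s (\<lambda>_. 1) x" unfolding resolvent_def by (intro suminf_le) auto
    moreover have "(\<Sum>k::nat. 1::ennreal) = top"
      using nn_integral_count_space_nat[of "\<lambda>_. 1"] by simp
    ultimately show False using M[of x] x X0 by (auto simp: top_unique)
  qed
  define r where "r = Inf G"
  have bdd: "bdd_below G" using G_low by (intro bdd_belowI[of _ \<eta>]) (auto intro: less_imp_le)
  have r_eta: "r \<ge> \<eta>" unfolding r_def using Gne G_low by (intro cInf_greatest) (auto intro: less_imp_le)
  then have r0: "r > 0" using \<eta> by simp
  have r_le: "r \<le> s" if "s \<in> G" for s unfolding r_def by (rule cInf_lower[OF that bdd])
  have rG: "r \<notin> G"
  proof
    assume "r \<in> G"
    then obtain M where M: "\<And>x. x \<in> X \<Longrightarrow> ?R r (\<lambda>_. 1) x \<le> ennreal M" unfolding G_def by blast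
    define M' where "M' = max M 1"
    have M': "M' \<ge> 1" "\<And>x. x \<in> X \<Longrightarrow> ?R r (\<lambda>_. 1) x \<le> ennreal M'"
      using M unfolding M'_def by (auto intro!: order_trans[OF M ennreal_leI])
    define \<theta> where "\<theta> = r * (1 - 1/M')"
    have \<theta>: "0 \<le> \<theta>" "\<theta> < r" using r0 M'(1) unfolding \<theta>_def by (auto simp: field_simps)
    have "\<exists>M. \<forall>x\<in>X. ?R ((\<theta> + r)/2) (\<lambda>_. 1) x \<le> ennreal M"
      by (rule resolvent_bounded_open[OF r0 M']) (use \<theta> in \<open>auto simp: \<theta>_def\<close>)
    then have "(\<theta> + r)/2 \<in> G" using \<theta> r0 unfolding G_def by auto
    from r_le[OF this] \<theta> show False by auto
  qed
  \<comment> \<open>If this failed for some \<open>n\<close>, the resolvents at parameters of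
    \<open>G\<close> close to \<open>r\<close> would be bounded by \<open>n\<close> on
    \<open>X\<close>. Each finite partial sum is continuous in the parameter, so the bound would
    pass to \<open>r\<close> and put \<open>r\<close> into \<open>G\<close>.\<close>
  have "\<exists>s\<in>G. s < r + 1 / (real n + 1) \<and> (\<exists>x\<in>X. ?R s (\<lambda>_. 1) x \<ge> of_nat n)" for n
  proof (rule ccontr)
    assume neg: "\<not> (\<exists>s\<in>G. s < r + 1 / (real n + 1) \<and> (\<exists>x\<in>X. ?R s (\<lambda>_. 1) x \<ge> of_nat n))"
    have "\<exists>s\<in>G. s < r + e" if "e > 0" for e
      using cInf_lessD[OF Gne, of "r + e"] that unfolding r_def by auto
    then have "\<exists>s\<in>G. s < r + 1 / (real j + real n + 1)" for j :: nat by simp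
    then obtain S where S: "\<And>j::nat. S j \<in> G" "\<And>j. S j < r + 1 / (real j + real n + 1)" by metis
    have Sr: "S \<longlonglongrightarrow> r"
    proof (rule tendsto_sandwich[of "\<lambda>_. r" _ _ "\<lambda>j. r + 1 / (real j + real n + 1)"])
      have "(\<lambda>j. r + 1 / real (Suc (j + n))) \<longlonglongrightarrow> r + 0"
        by (intro tendsto_add tendsto_const LIMSEQ_ignore_initial_segment[OF LIMSEQ_Suc[OF lim_1_over_n]])
      then show "(\<lambda>j. r + 1 / (real j + real n + 1)) \<longlonglongrightarrow> r" by (simp add: add_ac)
    qed (use S r_le in \<open>auto intro!: always_eventually less_imp_le\<close>)
    have "?R r (\<lambda>_. 1) x \<le> of_nat n" if x: "x \<in> X" for x
    proof -
      define a where "a k = enn2real ((?L ^^ k) (\<lambda>_. 1) x)" for k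
      have a: "(?L ^^ k) (\<lambda>_. 1) x = ennreal (a k)" "a k \<ge> 0" for k
        using order_le_less_trans[OF Lk[OF x, of k] ennreal_less_top]
        unfolding a_def by (auto intro!: ennreal_enn2real[symmetric])
      have psum: "(\<Sum>k<m. ennreal ((1/s) ^ k) * (?L ^^ k) (\<lambda>_. 1) x) = ennreal (\<Sum>k<m. (1/s) ^ k * a k)"
        if "s > 0" for m s
        using that a(2) unfolding a(1) by (subst sum_ennreal[symmetric]) (auto simp: ennreal_mult)
      have part: "(\<Sum>k<m. (1/S j) ^ k * a k) \<le> real n" for m j
      proof -
        have S0: "S j > 0" using S(1)[of j] unfolding G_def by auto
        have "S j < r + 1 / (real n + 1)"
          by (rule less_le_trans[OF S(2)]) (auto intro!: divide_left_mono)
        then have "?R (S j) (\<lambda>_. 1) x < of_nat n" using neg S(1)[of j] x by (meson not_le)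
        moreover have "(\<Sum>k<m. ennreal ((1/S j) ^ k) * (?L ^^ k) (\<lambda>_. 1) x) \<le> ?R (S j) (\<lambda>_. 1) x"
          unfolding resolvent_def by (rule sum_le_suminf) auto
        ultimately have "ennreal (\<Sum>k<m. (1/S j) ^ k * a k) \<le> ennreal (real n)"
          unfolding psum[OF S0] ennreal_of_nat_eq_real_of_nat by (meson less_imp_le order_trans)
        then show ?thesis by (subst (asm) ennreal_le_iff) auto
      qed
      have "(\<Sum>k<m. (1/r) ^ k * a k) \<le> real n" for m
      proof (rule LIMSEQ_le_const2)
        show "(\<lambda>j. \<Sum>k<m. (1/S j) ^ k * a k) \<longlonglongrightarrow> (\<Sum>k<m. (1/r) ^ k * a k)"
          using r0 by (intro tendsto_intros Sr) auto
      qed (use part in auto)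
      then have "(\<Sum>k<m. ennreal ((1/r) ^ k) * (?L ^^ k) (\<lambda>_. 1) x) \<le> of_nat n" for m
        unfolding psum[OF r0] by (simp add: ennreal_of_nat_eq_real_of_nat ennreal_leI)
      then show ?thesis unfolding resolvent_def by (intro suminf_le_const) auto
    qed
    then have "r \<in> G" using r0 unfolding G_def
      by (auto simp: ennreal_of_nat_eq_real_of_nat)
    then show False using rG by blast
  qed
  then obtain s x where s: "\<And>n. s n \<in> G" "\<And>n. s n < r + 1 / (real n + 1)"
    and x: "\<And>n. x n \<in> X" "\<And>n. ?R (s n) (\<lambda>_. 1) (x n) \<ge> of_nat n" by metis
  show ?thesis
  proof (rule that[OF r0 _ _ x(1)])
    show "s \<longlonglongrightarrow> r"
    proof (rule tendsto_sandwich[of "\<lambda>_. r" _ _ "\<lambda>j. r + 1 / (real j + 1)"])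
      have "(\<lambda>j. r + 1 / real (Suc j)) \<longlonglongrightarrow> r + 0"
        by (intro tendsto_intros LIMSEQ_Suc[OF lim_1_over_n])
      then show "(\<lambda>j. r + 1 / (real j + 1)) \<longlonglongrightarrow> r" by (simp add: add_ac)
    qed (use s r_le in \<open>auto intro!: always_eventually less_imp_le\<close>)
    show "s n \<ge> r" for n using s r_le by blast
    show "?R (s n) (\<lambda>_. 1) (x n) < top" for n
      using s(1)[of n] x(1)[of n] unfolding G_def by (auto simp: less_top[symmetric] top_unique)
  qed (rule x(2))
qed

section \<open>Normalised resolvents as probability measures\<close>

text \<open>A normalised sum of point masses over the backward orbit of \<open>x\<close> in
  \<open>X\<close>, the preimages of order \<open>k\<close> being weighted by
  \<open>s powr (- k)\<close> and the product of \<open>\<psi>\<close> along the orbit.\<close>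

definition resolvent_measure ::
  "complex set \<Rightarrow> (complex \<Rightarrow> complex) \<Rightarrow> (complex \<Rightarrow> ennreal) \<Rightarrow> real \<Rightarrow> complex \<Rightarrow> complex measure"
  where "resolvent_measure X g \<psi> s x = measure_of UNIV (sets borel)
    (\<lambda>A. resolvent X g \<psi> s (indicator A) x / resolvent X g \<psi> s (\<lambda>_. 1) x)"

lemma sets_resolvent_measure [simp]: "sets (resolvent_measure X g \<psi> s x) = sets borel"
  unfolding resolvent_measure_def
  by (metis sets.sigma_sets_eq sets_measure_of space_borel subset_Pow_Union Union_Pow_eq sets.space_closed)

lemma space_resolvent_measure [simp]: "space (resolvent_measure X g \<psi> s x) = UNIV"
  unfolding resolvent_measure_def by (simp add: space_measure_of_conv)

lemma emeasure_resolvent_measure: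
  assumes "A \<in> sets borel"
  shows "emeasure (resolvent_measure X g \<psi> s x) A
       = resolvent X g \<psi> s (indicator A) x / resolvent X g \<psi> s (\<lambda>_. 1) x"
  unfolding resolvent_measure_def
proof (rule emeasure_measure_of_sigma)
  show "sigma_algebra UNIV (sets (borel :: complex measure))"
    using sets.sigma_algebra_axioms[of "borel :: complex measure"] by simp
  show "positive (sets borel) (\<lambda>A. resolvent X g \<psi> s (indicator A) x / resolvent X g \<psi> s (\<lambda>_. 1) x)"
    unfolding positive_def using resolvent_zero[of X g \<psi> s x] by (simp add: indicator_def[abs_def])
  show "countably_additive (sets borel) (\<lambda>A. resolvent X g \<psi> s (indicator A) x / resolvent X g \<psi> s (\<lambda>_. 1) x)"
  proof (rule countably_additiveI)
    fix A :: "nat \<Rightarrow> complex set" assume "disjoint_family A"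
    then have "(indicator (\<Union>i. A i) :: complex \<Rightarrow> ennreal) = (\<lambda>v. \<Sum>i. indicator (A i) v)"
      using suminf_indicator by fastforce
    then show "(\<Sum>i. resolvent X g \<psi> s (indicator (A i)) x / resolvent X g \<psi> s (\<lambda>_. 1) x)
      = resolvent X g \<psi> s (indicator (\<Union>i. A i)) x / resolvent X g \<psi> s (\<lambda>_. 1) x"
      by (simp add: resolvent_suminf divide_ennreal_def)
  qed
qed (rule assms)

lemma nn_integral_resolvent_measure:
  assumes "\<phi> \<in> borel_measurable borel"
  shows "(\<integral>\<^sup>+v. \<phi> v \<partial>resolvent_measure X g \<psi> s x)
       = resolvent X g \<psi> s \<phi> x / resolvent X g \<psi> s (\<lambda>_. 1) x"
proof -
  let ?M = "resolvent_measure X g \<psi> s x"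
  have "\<phi> \<in> borel_measurable ?M" using assms by (simp add: measurable_cong_sets[OF sets_resolvent_measure refl])
  then show ?thesis
  proof (induction rule: borel_measurable_induct)
    case (cong f h)
    then show ?case by (metis UNIV_I ext space_resolvent_measure)
  next
    case (set A)
    then show ?case by (simp add: emeasure_resolvent_measure)
  next
    case (mult u c)
    then show ?case by (simp add: nn_integral_cmult resolvent_cmult ennreal_times_divide)
  next
    case (add u v)
    then show ?case by (simp add: nn_integral_add resolvent_add add_divide_distrib_ennreal)
  next
    case (seq U)
    have inc: "incseq U" by fact
    have "(\<integral>\<^sup>+v. (SUP i. U i) v \<partial>?M) = (SUP i. \<integral>\<^sup>+v. U i v \<partial>?M)"
      unfolding SUP_apply by (rule nn_integral_monotone_convergence_SUP) (use seq in auto)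
    also have "\<dots> = (SUP i. resolvent X g \<psi> s (U i) x) / resolvent X g \<psi> s (\<lambda>_. 1) x"
      unfolding seq SUP_divide_ennreal ..
    also have "(SUP i. resolvent X g \<psi> s (U i) x) = resolvent X g \<psi> s (SUP i. U i) x"
      using resolvent_SUP[OF inc, of X g \<psi> s x] by (simp add: SUP_apply[abs_def])
    finally show ?case .
  qed
qed


lemma resolvent_measure_properties:
  assumes s: "s > 0" and x: "x \<in> X" and fin: "resolvent X g \<psi> s (\<lambda>_. 1) x < top"
    and X: "X \<in> sets borel"
  shows "prob_space (resolvent_measure X g \<psi> s x)"
    and "emeasure (resolvent_measure X g \<psi> s x) (- X) = 0"
proof -
  have "resolvent X g \<psi> s (\<lambda>_. 1) x \<ge> 1" by (subst resolvent_split_head[OF s]) simp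
  then have "resolvent X g \<psi> s (\<lambda>_. 1) x \<noteq> 0" by auto
  then have "emeasure (resolvent_measure X g \<psi> s x) UNIV = 1"
    using fin by (simp add: emeasure_resolvent_measure indicator_def[abs_def] ennreal_divide_self less_top)
  then show "prob_space (resolvent_measure X g \<psi> s x)" by (intro prob_spaceI) simp
  have "resolvent X g \<psi> s (indicator (-X)) x = resolvent X g \<psi> s (\<lambda>v. 0) x"
    by (rule resolvent_cong[OF _ x]) auto
  then show "emeasure (resolvent_measure X g \<psi> s x) (- X) = 0"
    using X by (subst emeasure_resolvent_measure) (auto simp: resolvent_zero)
qed

text \<open>The approximate form of the dual eigenvalue equation. The error is the contribution of
  \<open>k = 0\<close> and vanishes once the normalising resolvent tends to infinity. The transform
  has to agree with the Borel function \<open>h\<close> on \<open>X\<close> alone, because the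
  backward orbit of \<open>x\<close> stays there.\<close>

lemma nn_integral_resolvent_measure_transfer:
  assumes s: "s > 0" and x: "x \<in> X"
    and \<phi>: "\<phi> \<in> borel_measurable borel" and h: "h \<in> borel_measurable borel"
    and eq: "\<And>v. v \<in> X \<Longrightarrow> transfer_op X g \<psi> \<phi> v = h v"
  shows "(\<integral>\<^sup>+v. \<phi> v \<partial>resolvent_measure X g \<psi> s x)
     = \<phi> x / resolvent X g \<psi> s (\<lambda>_. 1) x + ennreal (1/s) * (\<integral>\<^sup>+v. h v \<partial>resolvent_measure X g \<psi> s x)"
proof -
  have "resolvent X g \<psi> s \<phi> x = \<phi> x + ennreal (1/s) * resolvent X g \<psi> s h x"
    using resolvent_split_head[OF s, of X g \<psi> \<phi> x] resolvent_cong[OF eq x] by simp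
  then show ?thesis
    unfolding nn_integral_resolvent_measure[OF \<phi>] nn_integral_resolvent_measure[OF h]
    by (simp add: add_divide_distrib_ennreal ennreal_times_divide)
qed

text \<open>The source of tightness: beyond the term \<open>k = 0\<close>, the mass of
  \<open>A\<close> is an average of the transform of its indicator, so a uniform bound on that
  transform bounds the mass.\<close>

lemma emeasure_resolvent_measure_tail:
  assumes s: "s > 0" and x: "x \<in> X" and fin: "resolvent X g \<psi> s (\<lambda>_. 1) x < top"
    and A: "A \<in> sets borel"
    and le: "\<And>v. v \<in> X \<Longrightarrow> transfer_op X g \<psi> (indicator A) v \<le> \<epsilon>"
  shows "emeasure (resolvent_measure X g \<psi> s x) A
     \<le> 1 / resolvent X g \<psi> s (\<lambda>_. 1) x + ennreal (1/s) * \<epsilon>"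
proof -
  let ?N = "resolvent X g \<psi> s (\<lambda>_. 1) x"
  have "?N \<ge> 1" by (subst resolvent_split_head[OF s]) simp
  then have N0: "?N \<noteq> 0" by auto
  have "resolvent X g \<psi> s (indicator A) x
      = indicator A x + ennreal (1/s) * resolvent X g \<psi> s (transfer_op X g \<psi> (indicator A)) x"
    by (rule resolvent_split_head[OF s])
  also have "\<dots> \<le> 1 + ennreal (1/s) * resolvent X g \<psi> s (\<lambda>_. \<epsilon> * 1) x"
    using le by (intro add_mono mult_left_mono resolvent_mono x) (auto simp: indicator_def)
  also have "\<dots> = 1 + ennreal (1/s) * (\<epsilon> * ?N)" unfolding resolvent_cmult ..
  finally have "resolvent X g \<psi> s (indicator A) x / ?N \<le> (1 + ennreal (1/s) * (\<epsilon> * ?N)) / ?N"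
    by (rule divide_right_mono_ennreal)
  also have "\<dots> = 1 / ?N + ennreal (1/s) * \<epsilon>"
    using N0 fin by (simp add: add_divide_distrib_ennreal ennreal_times_divide mult.assoc[symmetric]
      mult_divide_eq_ennreal less_top)
  finally show ?thesis by (simp add: emeasure_resolvent_measure A)
qed

section \<open>The map in the exponential coordinate\<close>

text \<open>A number \<open>\<mu>\<close> strictly between \<open>norm d\<close> and 1 bounds the
  difference quotients near \<open>a\<close>, so \<open>h\<close> contracts a small ball around
  \<open>a\<close> by the factor \<open>\<mu>\<close>.\<close>

lemma attracting_fixed_point_ball:
  fixes h :: "complex \<Rightarrow> complex"
  assumes d: "(h has_field_derivative d) (at a)" and "h a = a" and "norm d < 1"
  obtains \<epsilon> where "\<epsilon> > 0" "\<And>z. z \<in> ball a \<epsilon> \<Longrightarrow> h z \<in> ball a \<epsilon>"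
    "\<And>z. z \<in> ball a \<epsilon> \<Longrightarrow> (\<lambda>n. (h ^^ n) z) \<longlonglongrightarrow> a"
    "uniform_limit (ball a \<epsilon>) (\<lambda>n. h ^^ n) (\<lambda>_. a) sequentially"
proof -
  define \<mu> where "\<mu> = (1 + norm d) / 2"
  have \<mu>: "norm d < \<mu>" "\<mu> < 1" "0 \<le> \<mu>" using assms(3) norm_ge_zero[of d] unfolding \<mu>_def by (auto simp: field_simps)
  have "((\<lambda>z. norm ((h z - h a) / (z - a))) \<longlongrightarrow> norm d) (at a)"
    using d unfolding has_field_derivative_iff by (rule tendsto_norm)
  then have "eventually (\<lambda>z. norm ((h z - h a) / (z - a)) < \<mu>) (at a)"
    using \<mu>(1) by (rule order_tendstoD)
  then obtain \<epsilon> where \<epsilon>: "\<epsilon> > 0" "\<And>z. z \<noteq> a \<Longrightarrow> dist z a < \<epsilon> \<Longrightarrow> norm ((h z - h a) / (z - a)) < \<mu>"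
    unfolding eventually_at by auto
  have contr: "norm (h z - a) \<le> \<mu> * norm (z - a)" if "z \<in> ball a \<epsilon>" for z
  proof (cases "z = a")
    case False
    then have "norm (h z - a) / norm (z - a) < \<mu>"
      using \<epsilon>(2)[of z] that assms(2) by (simp add: norm_divide dist_commute)
    then show ?thesis using False by (simp add: divide_less_eq)
  qed (use assms in simp)
  have inv: "h z \<in> ball a \<epsilon>" if "z \<in> ball a \<epsilon>" for z
  proof -
    have "norm (h z - a) \<le> 1 * norm (z - a)"
      using contr[OF that] \<mu> by (meson less_imp_le mult_right_mono norm_ge_zero order_trans)
    then show ?thesis using that by (simp add: dist_norm norm_minus_commute)
  qed
  have it: "(h ^^ n) z \<in> ball a \<epsilon> \<and> norm ((h ^^ n) z - a) \<le> \<mu> ^ n * norm (z - a)" if "z \<in> ball a \<epsilon>" for z n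
  proof (induction n)
    case (Suc n)
    have "norm (h ((h ^^ n) z) - a) \<le> \<mu> * (\<mu> ^ n * norm (z - a))"
      using contr[of "(h ^^ n) z"] Suc \<mu> by (meson mult_left_mono order_trans)
    then show ?case using Suc inv by (simp add: mult.assoc)
  qed (use that in simp)
  have ul: "uniform_limit (ball a \<epsilon>) (\<lambda>n. h ^^ n) (\<lambda>_. a) sequentially"
  proof (rule uniform_limitI)
    fix e :: real assume "e > 0"
    have "(\<lambda>n. \<mu> ^ n * \<epsilon>) \<longlonglongrightarrow> 0 * \<epsilon>" using \<mu> by (intro tendsto_intros LIMSEQ_power_zero) auto
    then have "eventually (\<lambda>n. \<mu> ^ n * \<epsilon> < e) sequentially" using \<open>e > 0\<close> by (intro order_tendstoD) auto
    then show "\<forall>\<^sub>F n in sequentially. \<forall>x\<in>ball a \<epsilon>. dist ((h ^^ n) x) a < e"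
    proof eventually_elim
      case (elim n)
      show ?case
      proof
        fix z assume z: "z \<in> ball a \<epsilon>"
        have "norm ((h ^^ n) z - a) \<le> \<mu> ^ n * norm (z - a)" using it[OF z] by blast
        also have "\<dots> \<le> \<mu> ^ n * \<epsilon>" using z \<mu> by (intro mult_left_mono) (auto simp: dist_norm norm_minus_commute)
        finally show "dist ((h ^^ n) z) a < e" using elim by (simp add: dist_norm)
      qed
    qed
  qed
  show ?thesis
    using that[OF \<epsilon>(1) inv _ ul] tendsto_uniform_limitI[OF ul] by blast
qed

section \<open>Solving logarithmic equations for preimages\<close>

lemma norm_Ln_le:
  assumes "v \<noteq> 0" shows "norm (Ln v) \<le> \<bar>ln (norm v)\<bar> + pi"
proof -
  have "norm (Ln v) \<le> \<bar>Re (Ln v)\<bar> + \<bar>Im (Ln v)\<bar>" by (rule cmod_le)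
  moreover have "\<bar>Im (Ln v)\<bar> \<le> pi" using mpi_less_Im_Ln[OF assms] Im_Ln_le_pi[OF assms] by auto
  ultimately show ?thesis using assms by (simp add: Re_Ln)
qed

text \<open>Brouwer's theorem for \<open>v = \<zeta> + L * Ln v + 2 pi i q\<close> on the disc
  around \<open>2 pi i q\<close> of radius \<open>pi * q\<close>. The disc lies in the upper
  half-plane, where \<open>Ln\<close> is continuous, and \<open>bd\<close> says that the disc is
  mapped into itself.\<close>

lemma log_fixed_point:
  fixes \<zeta> :: complex and L q :: real
  assumes L: "L \<ge> 0" and q: "pi * q \<ge> 1"
    and bd: "norm \<zeta> + L * (ln (3 * pi * q) + pi) \<le> pi * q"
  obtains v where "v - of_real L * Ln v - 2 * of_real pi * \<i> * of_real q = \<zeta>"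
    "pi * q \<le> norm v" "norm v \<le> 3 * pi * q" "norm (Ln v) \<le> ln (3 * pi * q) + pi"
proof -
  define a where "a = 2 * of_real pi * \<i> * of_real q"
  define S where "S = cball a (pi * q)"
  have q0: "q > 0" using q pi_gt_zero by (smt (verit) mult_nonneg_nonpos)
  have na: "norm a = 2 * pi * q" using q0 unfolding a_def by (simp add: norm_mult)
  have S: "pi * q \<le> norm v" "norm v \<le> 3 * pi * q" "Im v > 0" if "v \<in> S" for v
  proof -
    have d: "norm (v - a) \<le> pi * q" using that unfolding S_def by (simp add: dist_norm norm_minus_commute)
    show "pi * q \<le> norm v" "norm v \<le> 3 * pi * q"
      using d na norm_triangle_ineq2[of v a] norm_triangle_ineq2[of a v] norm_minus_commute[of a v] by linarith+
    have "\<bar>Im v - 2 * pi * q\<bar> \<le> pi * q"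
      using d abs_Im_le_cmod[of "v - a"] by (simp add: a_def)
    then show "Im v > 0" using q q0 by linarith
  qed
  have nl: "norm (Ln v) \<le> ln (3 * pi * q) + pi" if "v \<in> S" for v
  proof -
    have v0: "v \<noteq> 0" using S(3)[OF that] by auto
    have "norm v \<ge> 1" using S(1)[OF that] q by linarith
    then have "\<bar>ln (norm v)\<bar> = ln (norm v)" by simp
    also have "\<dots> \<le> ln (3 * pi * q)" using S(2)[OF that] v0 q0 by (subst ln_le_cancel_iff) auto
    finally show ?thesis using norm_Ln_le[OF v0] by linarith
  qed
  let ?T = "\<lambda>v. \<zeta> + of_real L * Ln v + a"
  obtain v where v: "v \<in> S" "?T v = v"
  proof (rule brouwer[of S ?T])
    show "continuous_on S ?T"
    proof (intro continuous_intros)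
      fix v assume "v \<in> S"
      then have "Im v > 0" by (rule S)
      then show "v \<notin> \<real>\<^sub>\<le>\<^sub>0" by (auto simp: complex_nonpos_Reals_iff)
    qed
    show "?T \<in> S \<rightarrow> S"
    proof
      fix v assume v: "v \<in> S"
      have "norm (\<zeta> + of_real L * Ln v) \<le> norm \<zeta> + L * norm (Ln v)"
        using norm_triangle_ineq[of \<zeta> "of_real L * Ln v"] L by (simp add: norm_mult)
      also have "\<dots> \<le> pi * q" using bd mult_left_mono[OF nl[OF v] L] by linarith
      finally show "?T v \<in> S" unfolding S_def mem_cball dist_norm by (subst norm_minus_commute) simp
    qed
  qed (use q in \<open>auto simp: S_def\<close>)
  have "v - of_real L * Ln v - 2 * of_real pi * \<i> * of_real q = \<zeta>"
    using v(2) unfolding a_def by (simp only: diff_eq_eq) (simp add: ac_simps)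
  then show ?thesis by (rule that[of v]) (use S(1,2)[OF v(1)] nl[OF v(1)] in auto)
qed

lemma log_fixed_point_condition:
  fixes a b :: real
  shows "eventually (\<lambda>q. a + b * (ln (3 * pi * q) + pi) \<le> pi * q) at_top"
proof -
  have "((\<lambda>q. (ln (3 * pi * q) + pi) / q) \<longlongrightarrow> 0) at_top" by real_asymp
  moreover have "((\<lambda>q. a / q) \<longlongrightarrow> 0) at_top"
    by (rule tendsto_divide_0[OF tendsto_const filterlim_at_top_imp_at_infinity[OF filterlim_ident]])
  ultimately have "((\<lambda>q. a / q + b * ((ln (3 * pi * q) + pi) / q)) \<longlongrightarrow> 0 + b * 0) at_top"
    by (intro tendsto_intros)
  then have "eventually (\<lambda>q. a / q + b * ((ln (3 * pi * q) + pi) / q) < pi) at_top"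
    by (rule order_tendstoD) simp
  then show ?thesis using eventually_gt_at_top[of 0]
  proof eventually_elim
    case (elim q)
    have "a + b * (ln (3 * pi * q) + pi) = (a / q + b * ((ln (3 * pi * q) + pi) / q)) * q"
      using elim(2) by (simp add: field_simps)
    also have "\<dots> \<le> pi * q" using elim by (intro mult_right_mono) auto
    finally show ?case .
  qed
qed

locale cyl_map =
  fixes l :: int and c :: complex
  assumes l_ge: "l \<ge> 2" and c_ball: "c \<in> ball (of_int l) 1"
begin

abbreviation f :: "complex \<Rightarrow> complex" where "f \<equiv> f_map l c"

text \<open>The map induced by \<open>f\<close> in the coordinate \<open>w = exp z\<close> of the cylinder.\<close>

definition K :: complex where "K = exp (c - (of_int l - 1) * Ln c)"

definition g :: "complex \<Rightarrow> complex" where "g w = K * w ^ nat l * exp (- w)"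

definition basin :: "complex set" where "basin = {w. (\<lambda>n. (g ^^ n) w) \<longlonglongrightarrow> c}"

definition X :: "complex set" where "X = frontier basin"

lemma norm_l_c: "norm (of_int l - c) < 1"
  using c_ball by (simp add: dist_norm)

lemma of_nat_l: "of_nat (nat l) = (of_int l :: 'a :: ring_1)"
  using l_ge by (simp add: of_nat_nat)

lemma c_nz: "c \<noteq> 0"
proof
  assume "c = 0"
  then have "norm (of_int l :: complex) < 1" using norm_l_c by simp
  then show False using l_ge by simp
qed

lemma K_nz: "K \<noteq> 0" unfolding K_def by simp

lemma exp_f: "exp (f z) = g (exp z)"
proof -
  have "exp (of_int l * z) = exp z ^ nat l" using exp_of_nat_mult[of "nat l" z] by (simp add: of_nat_l)
  then show ?thesis
    unfolding f_map_def g_def K_def by (simp add: exp_add exp_diff exp_minus field_simps)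
qed

lemma exp_f_iter: "exp ((f ^^ n) z) = (g ^^ n) (exp z)"
  by (induction n) (auto simp: exp_f)

text \<open>The constant term of \<open>f\<close> is normalised to make \<open>Ln c\<close> a fixed
  point. Its multiplier is \<open>l - c\<close>, so the assumption on \<open>c\<close> says that it
  is attracting.\<close>

lemma f_fixed: "f (Ln c) = Ln c"
  unfolding f_map_def using c_nz by (simp add: algebra_simps)

lemma g_fixed: "g c = c"
  using exp_f[of "Ln c"] f_fixed c_nz by simp

lemma f_has_derivative: "(f has_field_derivative (of_int l - exp z)) (at z)"
  unfolding f_map_def by (auto intro!: derivative_eq_intros)

lemma f_holomorphic: "f holomorphic_on S"
  unfolding f_map_def by (intro holomorphic_intros)

lemma g_holomorphic: "g holomorphic_on S"
  unfolding g_def by (intro holomorphic_intros)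

lemma g_continuous: "continuous_on S g"
  using g_holomorphic by (rule holomorphic_on_imp_continuous_on)

lemma f_continuous: "continuous_on S f"
  using f_holomorphic by (rule holomorphic_on_imp_continuous_on)

lemma f_iter_holomorphic: "(f ^^ n) holomorphic_on S"
proof (induction n arbitrary: S)
  case (Suc n)
  then show ?case using holomorphic_on_compose[OF Suc f_holomorphic] by (simp add: o_def)
qed simp

lemma g_iter_continuous: "continuous_on S (g ^^ n)"
proof (induction n arbitrary: S)
  case (Suc n)
  then show ?case using continuous_on_compose[OF Suc g_continuous] by (simp add: o_def)
qed simp

lemma g_eq_0_iff: "g w = 0 \<longleftrightarrow> w = 0"
  unfolding g_def using K_nz l_ge by auto

text \<open>The form via the logarithmic derivative \<open>l - w\<close> shows the nonzero critical
  point and the multiplier at \<open>c\<close> at a glance.\<close>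

lemma g_has_derivative:
  assumes "w \<noteq> 0" shows "(g has_field_derivative (g w * (of_int l - w) / w)) (at w)"
proof -
  have 1: "(g has_field_derivative (K * (of_nat (nat l) * w ^ (nat l - 1)) * exp (-w) - K * w ^ nat l * exp (-w))) (at w)"
    unfolding g_def by (auto intro!: derivative_eq_intros simp: algebra_simps)
  have 2: "w ^ nat l = w * w ^ (nat l - 1)" using l_ge power_minus_mult[of "nat l" w] by (simp add: mult.commute)
  have "K * (of_nat (nat l) * w ^ (nat l - 1)) * exp (-w) - K * w ^ nat l * exp (-w) = g w * (of_int l - w) / w"
    unfolding g_def of_nat_l 2 using assms by (simp add: field_simps)
  with 1 show ?thesis by simp
qed

lemma g_attracting: "(g has_field_derivative (of_int l - c)) (at c)"
  using g_has_derivative[OF c_nz] g_fixed c_nz by simp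

lemma f_attracting: "(f has_field_derivative (of_int l - c)) (at (Ln c))"
  using f_has_derivative[of "Ln c"] c_nz by simp

section \<open>The basin of \<open>c\<close> and its boundary\<close>

lemma g_basin_iff: "g w \<in> basin \<longleftrightarrow> w \<in> basin"
proof -
  have "(\<lambda>n. (g ^^ n) (g w)) = (\<lambda>n. (g ^^ Suc n) w)" by (simp add: funpow_swap1)
  then show ?thesis unfolding basin_def by (simp add: filterlim_sequentially_Suc[where f = "\<lambda>n. (g ^^ n) w"] del: funpow.simps)
qed

lemma g_iter_basin_iff: "(g ^^ n) w \<in> basin \<longleftrightarrow> w \<in> basin"
  by (induction n) (auto simp: g_basin_iff)

lemma basin_contains_ball: "\<exists>\<epsilon>>0. ball c \<epsilon> \<subseteq> basin"
proof -
  obtain \<epsilon> where "\<epsilon> > 0" "\<And>z. z \<in> ball c \<epsilon> \<Longrightarrow> (\<lambda>n. (g ^^ n) z) \<longlonglongrightarrow> c"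
    using attracting_fixed_point_ball[OF g_attracting g_fixed norm_l_c] by metis
  then show ?thesis unfolding basin_def by (intro exI[of _ \<epsilon>]) auto
qed

lemma c_basin: "c \<in> basin"
proof -
  obtain \<epsilon> where "\<epsilon> > 0" "ball c \<epsilon> \<subseteq> basin" using basin_contains_ball by blast
  then show ?thesis by (meson centre_in_ball subsetD)
qed

lemma basin_open: "open basin"
proof -
  obtain \<epsilon> where e: "\<epsilon> > 0" "ball c \<epsilon> \<subseteq> basin" using basin_contains_ball by blast
  have "basin = (\<Union>n. (g ^^ n) -` ball c \<epsilon>)"
  proof
    show "basin \<subseteq> (\<Union>n. (g ^^ n) -` ball c \<epsilon>)"
    proof
      fix w assume "w \<in> basin"
      then have "(\<lambda>n. (g ^^ n) w) \<longlonglongrightarrow> c" unfolding basin_def by simp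
      then have "eventually (\<lambda>n. (g ^^ n) w \<in> ball c \<epsilon>) sequentially"
        by (rule topological_tendstoD) (use e in auto)
      then show "w \<in> (\<Union>n. (g ^^ n) -` ball c \<epsilon>)" by (auto simp: eventually_sequentially)
    qed
    show "(\<Union>n. (g ^^ n) -` ball c \<epsilon>) \<subseteq> basin"
      using e g_iter_basin_iff by blast
  qed
  moreover have "open ((g ^^ n) -` ball c \<epsilon>)" for n
    using g_iter_continuous[of UNIV n] by (simp add: continuous_on_open_vimage)
  ultimately show ?thesis by auto
qed

text \<open>Since \<open>l \<ge> 2\<close>, \<open>g\<close> vanishes to second order at 0. For
  \<open>|w| < m \<le> 1\<close> one has \<open>|g w| \<le> |K| |w|^2 exp 1\<close>, and
  \<open>m\<close> is chosen to make this at most \<open>|w| / 2\<close>, so these orbits tend to 0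
  and not to \<open>c\<close>.\<close>

lemma basin_avoids_zero: "\<exists>m>0. ball 0 m \<inter> basin = {}"
proof -
  define m where "m = min 1 (1 / (2 * norm K * exp 1))"
  have m: "m > 0" "m \<le> 1" "m * (2 * norm K * exp 1) \<le> 1"
    using K_nz unfolding m_def by (auto simp: min_def field_simps)
  have half: "norm (g w) \<le> norm w / 2" if w: "norm w < m" for w
  proof -
    have "norm w ^ nat l \<le> norm w ^ 2" using w m l_ge by (intro power_decreasing) auto
    moreover have "norm (exp (- w)) \<le> exp 1"
      using norm_exp[of "-w"] w m by (simp add: order_trans)
    ultimately have "norm (g w) \<le> norm K * norm w ^ 2 * exp 1"
      unfolding g_def norm_mult norm_power by (intro mult_mono) auto
    also have "\<dots> = norm w * (norm w * (norm K * exp 1))" by (simp add: power2_eq_square)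
    also have "\<dots> \<le> norm w * (m * (norm K * exp 1))"
      using w by (intro mult_left_mono mult_right_mono) auto
    also have "\<dots> \<le> norm w * (1/2)" using m by (intro mult_left_mono) (auto simp: algebra_simps)
    finally show ?thesis by simp
  qed
  have it: "norm ((g ^^ n) w) \<le> (1/2) ^ n * norm w \<and> norm ((g ^^ n) w) < m" if "norm w < m" for w n
  proof (induction n)
    case (Suc n)
    then have "norm (g ((g ^^ n) w)) \<le> norm ((g ^^ n) w) / 2" using half by blast
    moreover from this have "norm (g ((g ^^ n) w)) < m" using Suc norm_ge_zero[of "(g ^^ n) w"] by linarith
    ultimately show ?case using Suc by auto
  qed (use that in auto)
  have "w \<notin> basin" if "norm w < m" for w
  proof
    assume "w \<in> basin"
    then have "(\<lambda>n. (g ^^ n) w) \<longlonglongrightarrow> c" unfolding basin_def by simp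
    moreover have "(\<lambda>n. (g ^^ n) w) \<longlonglongrightarrow> 0"
    proof (rule Lim_null_comparison)
      show "\<forall>\<^sub>F n in sequentially. norm ((g ^^ n) w) \<le> (1/2) ^ n * norm w" using it[OF that] by auto
      show "(\<lambda>n. (1/2) ^ n * norm w) \<longlonglongrightarrow> 0"
        using tendsto_mult_right[OF LIMSEQ_power_zero[of "1/2::real"], of "norm w"] by simp
    qed
    ultimately show False using LIMSEQ_unique c_nz by blast
  qed
  then show ?thesis using m by auto
qed

lemma X_closed: "closed X" unfolding X_def by simp

lemma X_eq: "X = closure basin - basin"
  unfolding X_def frontier_def using basin_open by (simp add: interior_open)

lemma X_nonempty: "X \<noteq> {}"
proof -
  obtain m :: real where "m > 0" "ball 0 m \<inter> basin = {}" using basin_avoids_zero by blast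
  then have "0 \<notin> basin" by (metis IntI centre_in_ball empty_iff)
  then show ?thesis unfolding X_def frontier_eq_empty using c_basin by blast
qed

lemma X_avoids_zero: "\<exists>m>0. \<forall>w\<in>X. norm w \<ge> m"
proof -
  obtain m where m: "m > 0" "ball 0 m \<inter> basin = {}" using basin_avoids_zero by blast
  have "ball 0 m \<inter> closure basin = {}" using m(2) by (simp add: open_Int_closure_eq_empty)
  have "m \<le> norm w" if "w \<in> X" for w
  proof (rule ccontr)
    assume "\<not> m \<le> norm w"
    then have "w \<in> ball 0 m" by simp
    then show False using that \<open>ball 0 m \<inter> closure basin = {}\<close> unfolding X_eq by blast
  qed
  then show ?thesis using m(1) by blast
qed

lemma X_nz: assumes "w \<in> X" shows "w \<noteq> 0"
proof -
  obtain m where "m > 0" "\<forall>w\<in>X. norm w \<ge> m" using X_avoids_zero by blast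
  then have "norm w > 0" using assms by (meson less_le_trans)
  then show ?thesis by simp
qed

lemma g_open_map: assumes "open U" shows "open (g ` U)"
proof (rule open_mapping_thm[OF g_holomorphic open_UNIV connected_UNIV assms])
  show "\<not> g constant_on UNIV"
  proof
    assume "g constant_on UNIV"
    then have "g c = g 0" unfolding constant_on_def by auto
    then show False using g_fixed g_eq_0_iff[of 0] c_nz by simp
  qed
qed simp

text \<open>For the closure of the basin, forward invariance is continuity of \<open>g\<close> and
  backward invariance is openness of \<open>g\<close>.\<close>

lemma g_X_iff: "g w \<in> X \<longleftrightarrow> w \<in> X"
proof -
  have "g w \<in> closure basin \<longleftrightarrow> w \<in> closure basin"
  proof
    assume gw: "g w \<in> closure basin"
    show "w \<in> closure basin"
      unfolding closure_iff_nhds_not_empty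
    proof (intro allI impI)
      fix A S assume AS: "S \<subseteq> A" "open S" "w \<in> S"
      have "basin \<inter> g ` S \<noteq> {}"
        using gw g_open_map[OF AS(2)] AS(3) unfolding closure_iff_nhds_not_empty by blast
      then obtain v where "v \<in> S" "g v \<in> basin" by blast
      then show "basin \<inter> A \<noteq> {}" using g_basin_iff AS by blast
    qed
  next
    assume "w \<in> closure basin"
    moreover have "g ` closure basin \<subseteq> closure basin"
      by (rule image_closure_subset[OF g_continuous]) (auto simp: g_basin_iff closure_subset[THEN subsetD])
    ultimately show "g w \<in> closure basin" by blast
  qed
  then show ?thesis unfolding X_eq using g_basin_iff by auto
qed

text \<open>Besides surjectivity, this supplies values that iterates must omit at a prescribed
  distance from the origin, as the normality argument with rescaled iterates requires.\<close>

lemma f_preimages_in_annuli: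
  "eventually (\<lambda>j. \<exists>b. f b = y \<and> pi * real j \<le> norm b \<and> norm b \<le> 3 * pi * real j) sequentially"
proof -
  define \<zeta> where "\<zeta> = c - (of_int l - 1) * Ln c - y"
  have l0: "real_of_int l > 0" using l_ge by simp
  have "filterlim (\<lambda>j. real_of_int l * real j) at_top sequentially"
    by (rule filterlim_tendsto_pos_mult_at_top[OF tendsto_const l0 filterlim_real_sequentially])
  from eventually_compose_filterlim[OF log_fixed_point_condition[of "norm \<zeta>" "of_int l"] this]
  have "eventually (\<lambda>j. norm \<zeta> + of_int l * (ln (3 * pi * (of_int l * real j)) + pi) \<le> pi * (of_int l * real j)) sequentially"
    by blast
  moreover have "eventually (\<lambda>j::nat. j \<ge> 1) sequentially" by (rule eventually_ge_at_top)
  ultimately show ?thesis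
  proof eventually_elim
    case (elim j)
    have j1: "real j \<ge> 1" using elim by simp
    have lj: "of_int l * real j \<ge> 1" using l_ge j1 mult_mono[of 1 "real_of_int l" 1 "real j"] by simp
    have q: "pi * (of_int l * real j) \<ge> 1"
      using lj pi_ge_two mult_mono[of 1 pi 1 "of_int l * real j"] by simp
    obtain v where v: "v - of_real (of_int l) * Ln v - 2 * of_real pi * \<i> * of_real (of_int l * real j) = \<zeta>"
      "pi * (of_int l * real j) \<le> norm v" "norm (Ln v) \<le> ln (3 * pi * (of_int l * real j)) + pi"
      using log_fixed_point[OF less_imp_le[OF l0] q elim(1)] by metis
    \<comment> \<open>With \<open>b = Ln v + 2 pi i j\<close> the equation \<open>f b = y\<close>
      becomes \<open>v - l * Ln v - 2 pi i (l j) = \<zeta>\<close>, hence the choice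
      \<open>q = l * j\<close>. The fixed-point condition also gives
      \<open>|Ln v| \<le> pi * j\<close>, so \<open>2 pi j\<close> dominates
      \<open>|b|\<close>.\<close>
    define b where "b = Ln v + 2 * of_real pi * \<i> * of_int (int j)"
    have v0: "v \<noteq> 0" using v(2) q by auto
    have eb: "exp b = v" unfolding b_def exp_cyl_shift using v0 by simp
    have "f b = c - (of_int l - 1) * Ln c + of_int l * b - v" unfolding f_map_def eb ..
    also have "\<dots> = c - (of_int l - 1) * Ln c
        - (v - of_real (of_int l) * Ln v - 2 * of_real pi * \<i> * of_real (of_int l * real j))"
      unfolding b_def by (simp add: algebra_simps)
    also have "\<dots> = y" unfolding v(1) unfolding \<zeta>_def by simp
    finally have fb: "f b = y" .
    have "of_int l * norm (Ln v) \<le> of_int l * (ln (3 * pi * (of_int l * real j)) + pi)"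
      using v(3) l0 by (intro mult_left_mono) auto
    also have "\<dots> \<le> of_int l * (pi * real j)" using elim(1) norm_ge_zero[of \<zeta>] unfolding mult.left_commute[of "real_of_int l" pi] by linarith
    finally have nl: "norm (Ln v) \<le> pi * real j" using l0 by simp
    have "norm (2 * of_real pi * \<i> * of_int (int j) :: complex) = 2 * pi * real j" by (simp add: norm_mult)
    then have "pi * real j \<le> norm b" "norm b \<le> 3 * pi * real j"
      using nl norm_triangle_ineq[of "Ln v" "2 * of_real pi * \<i> * of_int (int j)"]
        norm_diff_ineq[of "2 * of_real pi * \<i> * of_int (int j)" "Ln v"]
      unfolding b_def by (auto simp: add.commute)
    then show ?case using fb by blast
  qed
qed

lemma f_surj: "\<exists>z. f z = y"
proof -
  obtain j :: nat where "\<exists>b. f b = y \<and> pi * real j \<le> norm b \<and> norm b \<le> 3 * pi * real j"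
    using eventually_happens'[OF sequentially_bot f_preimages_in_annuli[of y]] by blast
  then show ?thesis by blast
qed

text \<open>Some bounded part of \<open>X\<close> has a preimage in itself for each of its points,
  which will keep the spectral radius away from 0. In the logarithmic equation for \<open>v\<close>
  the point \<open>w\<close> enters through \<open>Ln (K / w)\<close>, whose size grows like
  \<open>ln R\<close>, whereas the available room \<open>pi * j\<close> is linear in
  \<open>R\<close>.\<close>

lemma X_bounded_preimages:
  obtains R where "\<exists>x\<in>X. norm x \<le> R" "\<And>w. w \<in> X \<Longrightarrow> norm w \<le> R \<Longrightarrow> \<exists>v\<in>X. g v = w \<and> norm v \<le> R"
proof -
  obtain m where m: "m > 0" "\<And>w. w \<in> X \<Longrightarrow> norm w \<ge> m" using X_avoids_zero by blast
  obtain x where x: "x \<in> X" using X_nonempty by blast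
  define a where "a = \<bar>ln (norm K)\<bar> + \<bar>ln m\<bar> + pi"
  have l0: "real_of_int l + 1 > 0" "real_of_int l \<ge> 0" using l_ge by auto
  have "filterlim (\<lambda>j. real j) at_top sequentially" by (rule filterlim_real_sequentially)
  \<comment> \<open>The additional 1 in the coefficient reserves room for the summand
    \<open>ln R + pi\<close> in the bound for \<open>\<zeta>\<close>, with
    \<open>R = 3 * pi * j\<close>.\<close>
  from eventually_compose_filterlim[OF log_fixed_point_condition[of a "of_int l + 1"] this]
  have e1: "eventually (\<lambda>j. a + (of_int l + 1) * (ln (3 * pi * real j) + pi) \<le> pi * real j) sequentially" .
  have e2: "eventually (\<lambda>j. real j \<ge> max 1 (norm x)) sequentially"
    using filterlim_real_sequentially unfolding filterlim_at_top by blast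
  obtain j where j: "a + (of_int l + 1) * (ln (3 * pi * real j) + pi) \<le> pi * real j" "real j \<ge> 1" "real j \<ge> norm x"
    using eventually_happens'[OF _ eventually_conj[OF e1 e2]] by auto
  have q: "pi * real j \<ge> 1" using j(2) pi_ge_two mult_mono[of 1 pi 1 "real j"] by simp
  define R where "R = 3 * pi * real j"
  have R1: "R \<ge> 1" using q unfolding R_def by simp
  show ?thesis
  proof (rule that[of R])
    have "real j \<le> R" unfolding R_def using pi_ge_two j(2) by simp
    then show "\<exists>x\<in>X. norm x \<le> R" using x j(3) by (intro bexI[of _ x]) auto
    fix w assume w: "w \<in> X" "norm w \<le> R"
    have w0: "w \<noteq> 0" using X_nz[OF w(1)] .
    define \<zeta> where "\<zeta> = Ln (K / w)"
    have lw: "\<bar>ln (norm w)\<bar> \<le> \<bar>ln m\<bar> + ln R"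
    proof -
      have "ln m \<le> ln (norm w)" "ln (norm w) \<le> ln R"
        using m(1) m(2)[OF w(1)] w w0 R1 by (auto simp: ln_le_cancel_iff)
      moreover have "ln R \<ge> 0" using R1 by simp
      ultimately show ?thesis by linarith
    qed
    have "norm \<zeta> \<le> \<bar>ln (norm (K / w))\<bar> + pi" unfolding \<zeta>_def using K_nz w0 by (intro norm_Ln_le) auto
    also have "ln (norm (K / w)) = ln (norm K) - ln (norm w)"
      using K_nz w0 by (simp add: norm_divide ln_div)
    finally have "norm \<zeta> \<le> a + (ln R + pi)" using lw pi_ge_zero unfolding a_def by linarith
    then have "norm \<zeta> + of_int l * (ln (3 * pi * real j) + pi) \<le> pi * real j"
      using j(1) unfolding R_def by (simp add: algebra_simps)
    from log_fixed_point[OF l0(2) q this] obtain v where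
      v: "v - of_real (of_int l) * Ln v - 2 * of_real pi * \<i> * of_real (real j) = \<zeta>"
      "pi * real j \<le> norm v" "norm v \<le> 3 * pi * real j" by metis
    have v0: "v \<noteq> 0" using v(2) q by auto
    have "exp v = exp (\<zeta> + of_int l * Ln v + 2 * of_real pi * \<i> * of_int (int j))"
      unfolding v(1)[symmetric] by simp
    also have "\<dots> = K / w * exp (of_int l * Ln v)"
      unfolding exp_cyl_shift using K_nz w0 by (simp add: exp_add \<zeta>_def)
    also have "exp (of_int l * Ln v) = v ^ nat l"
      using exp_of_nat_mult[of "nat l" "Ln v"] v0 by (simp add: of_nat_l)
    finally have "g v = w" unfolding g_def exp_minus using w0 K_nz v0 by (simp add: field_simps)
    then show "\<exists>v\<in>X. g v = w \<and> norm v \<le> R" using v(3) w(1) g_X_iff unfolding R_def by blast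
  qed
qed

end

section \<open>The critical point is attracted\<close>

text \<open>The derivative \<open>exp z - 1\<close> is at most \<open>exp 1 * r \<le> 3 * r\<close>
  on the disc of radius \<open>r \<le> 1\<close>.\<close>

lemma exp_remainder_lipschitz:
  fixes h h' :: complex
  assumes "norm h \<le> r" "norm h' \<le> r" "r \<le> 1"
  shows "norm ((exp h - 1 - h) - (exp h' - 1 - h')) \<le> 3 * r * norm (h - h')"
proof -
  have d: "((\<lambda>z. exp z - 1 - z) has_field_derivative (exp z - 1)) (at z within cball 0 r)" for z :: complex
    by (auto intro!: derivative_eq_intros)
  have b: "norm (exp z - 1) \<le> 3 * r" if "z \<in> cball 0 r" for z :: complex
  proof -
    have z: "norm z \<le> r" "norm z \<le> 1" using that assms(3) by auto
    have "norm (exp z - (\<Sum>i\<le>0. z ^ i / fact i)) \<le> exp \<bar>Re z\<bar> * (norm z ^ Suc 0) / fact 0"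
      by (rule Taylor_exp)
    also have "\<dots> \<le> 3 * r"
    proof -
      have "exp \<bar>Re z\<bar> \<le> exp 1" using z abs_Re_le_cmod[of z] by simp
      also have "\<dots> \<le> (3::real)" using exp_le by simp
      finally have "exp \<bar>Re z\<bar> * norm z \<le> 3 * r" using z by (intro mult_mono) auto
      then show ?thesis by simp
    qed
    finally show ?thesis by simp
  qed
  show ?thesis
    by (rule field_differentiable_bound[OF convex_cball d b]) (use assms in auto)
qed

context cyl_map
begin

text \<open>Larger than the basin of \<open>Ln c\<close>: orbits in it approach the translates of
  \<open>Ln c\<close> by multiples of \<open>2 pi i\<close> and may escape along them.\<close>

definition lbasin :: "complex set" where "lbasin = exp -` basin"

lemma f_lbasin_iff: "f z \<in> lbasin \<longleftrightarrow> z \<in> lbasin"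
  unfolding lbasin_def by (simp add: exp_f g_basin_iff)

lemma f_iter_lbasin_iff: "(f ^^ n) z \<in> lbasin \<longleftrightarrow> z \<in> lbasin"
  by (induction n) (auto simp: f_lbasin_iff)

lemma lbasin_open: "open lbasin"
  unfolding lbasin_def by (rule open_vimage[OF basin_open]) (intro continuous_intros)

lemma Ln_c_lbasin: "Ln c \<in> lbasin"
  unfolding lbasin_def using c_basin c_nz by simp

text \<open>The radius is uniform although \<open>exp\<close> is unbounded: where
  \<open>|f'|\<close> is large,
  \<open>|exp y| \<le> |f' y| + l \<le> (1 + l / \<delta>) |f' y|\<close>, so the nonlinear part of
  \<open>f\<close> at \<open>y\<close> is controlled by the derivative itself.\<close>

lemma f_local_inverse:
  assumes "\<delta> > 0"
  obtains r where "r > 0" "\<And>y. norm (of_int l - exp y) \<ge> \<delta> \<Longrightarrow> inj_on f (ball y r)"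
    "\<And>y. norm (of_int l - exp y) \<ge> \<delta> \<Longrightarrow> ball (f y) (\<delta> * r / 4) \<subseteq> f ` ball y r"
proof -
  \<comment> \<open>The factor 6 combines the 3 of the remainder estimate with a 2, so that the
    remainder uses up at most half of the linear term once \<open>C * r \<le> 1\<close>.\<close>
  define C where "C = 6 * (1 + of_int l / \<delta>)"
  have C: "C > 0" using l_ge assms unfolding C_def by (simp add: add_pos_nonneg)
  have C6: "C / 6 = 1 + of_int l / \<delta>" unfolding C_def by simp
  define r where "r = min 1 (1 / C)"
  have r: "r > 0" "r \<le> 1" "C * r \<le> 1"
    using C unfolding r_def by (auto simp: min_def field_simps)
  have expand: "norm (f (y + h) - f (y + h')) \<ge> norm (of_int l - exp y) / 2 * norm (h - h')"
    if y: "norm (of_int l - exp y) \<ge> \<delta>" and h: "norm h \<le> r" "norm h' \<le> r" for y h h'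
  proof -
    let ?d = "of_int l - exp y"
    have "norm (exp y) \<le> norm ?d + of_int l"
      using norm_triangle_ineq4[of "of_int l :: complex" ?d] l_ge by simp
    also have "\<dots> \<le> norm ?d * (1 + of_int l / \<delta>)"
    proof -
      have "of_int l * 1 \<le> of_int l * (norm ?d / \<delta>)" using y assms l_ge by (intro mult_left_mono) auto
      then show ?thesis by (simp add: algebra_simps)
    qed
    finally have ey: "norm (exp y) \<le> norm ?d * (C / 6)" unfolding C6 .
    have eq: "f (y + h) - f (y + h') = ?d * (h - h') - exp y * ((exp h - 1 - h) - (exp h' - 1 - h'))"
      unfolding f_map_def by (simp add: exp_add algebra_simps)
    have "norm (exp y * ((exp h - 1 - h) - (exp h' - 1 - h'))) \<le> (norm ?d * (C / 6)) * (3 * r * norm (h - h'))"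
      unfolding norm_mult using C by (intro mult_mono ey exp_remainder_lipschitz[OF h r(2)]) auto
    also have "\<dots> = (C * r) * (norm ?d * norm (h - h') / 2)" by simp
    also have "\<dots> \<le> 1 * (norm ?d * norm (h - h') / 2)" using r by (intro mult_right_mono) auto
    finally have "norm (exp y * ((exp h - 1 - h) - (exp h' - 1 - h'))) \<le> norm ?d * norm (h - h') / 2" by simp
    moreover have "norm (f (y + h) - f (y + h')) \<ge> norm (?d * (h - h')) - norm (exp y * ((exp h - 1 - h) - (exp h' - 1 - h')))"
      unfolding eq by (rule norm_triangle_ineq2)
    ultimately show ?thesis by (simp add: norm_mult)
  qed
  show ?thesis
  proof (rule that[OF r(1)])
    fix y :: complex assume y: "norm (of_int l - exp y) \<ge> \<delta>"
    show inj: "inj_on f (ball y r)"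
    proof (rule inj_onI)
      fix a b assume ab: "a \<in> ball y r" "b \<in> ball y r" "f a = f b"
      have "norm (of_int l - exp y) / 2 * norm ((a - y) - (b - y)) \<le> norm (f (y + (a - y)) - f (y + (b - y)))"
        by (rule expand[OF y]) (use ab in \<open>auto simp: dist_norm norm_minus_commute\<close>)
      then have "norm (of_int l - exp y) * norm (a - b) \<le> 0" using ab(3) by simp
      moreover have "norm (of_int l - exp y) > 0" using y assms by linarith
      ultimately have "norm (a - b) \<le> 0" by (simp add: mult_le_0_iff)
      then show "a = b" by simp
    qed
    have "ball (f y) (\<delta> * r / 4) \<subseteq> f ` ball y (r/2)"
    proof (rule ball_subset_open_map_image)
      show "continuous_on (closure (ball y (r/2))) f" by (rule f_continuous)
      have "inj_on f (ball y (r/2))" using inj by (rule inj_on_subset) (use r in auto)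
      then have "open (f ` ball y (r/2))"
        using open_mapping_thm3[OF f_holomorphic open_ball] by blast
      then show "open (f ` interior (ball y (r/2)))" by (simp add: interior_open)
      show "y \<in> ball y (r/2)" using r by simp
      show "bounded (ball y (r/2))" by simp
      show "0 < \<delta> * r / 4" using assms r by simp
      fix z assume "z \<in> frontier (ball y (r/2))"
      then have z: "norm (z - y) = r/2" using r by (simp add: dist_norm norm_minus_commute)
      have "\<delta> * r / 4 = \<delta> / 2 * norm ((z - y) - 0)" using z by simp
      also have "\<dots> \<le> norm (of_int l - exp y) / 2 * norm ((z - y) - 0)"
        using y by (intro mult_right_mono) auto
      also have "\<dots> \<le> norm (f (y + (z - y)) - f (y + 0))"
        by (rule expand[OF y]) (use z r in auto)
      finally show "\<delta> * r / 4 \<le> norm (f z - f y)" by simp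
    qed
    also have "\<dots> \<subseteq> f ` ball y r" using r by (intro image_mono) auto
    finally show "ball (f y) (\<delta> * r / 4) \<subseteq> f ` ball y r" .
  qed
qed

text \<open>Where \<open>exp y\<close> is within 1 of \<open>l\<close>, the identity
  \<open>l * y = f y - const + exp y\<close> bounds \<open>y\<close>. The infimum is thus taken over
  a compact set, on which it is positive.\<close>

lemma f_deriv_bounded_below:
  assumes W: "compact W" and nc: "\<And>y. f y \<in> W \<Longrightarrow> exp y \<noteq> of_int l"
  obtains \<delta> where "\<delta> > 0" "\<And>y. f y \<in> W \<Longrightarrow> norm (of_int l - exp y) \<ge> \<delta>"
proof -
  define S where "S = {y. f y \<in> W \<and> norm (of_int l - exp y) \<le> 1}"
  obtain B where B: "\<And>w. w \<in> W \<Longrightarrow> norm w \<le> B" using compact_imp_bounded[OF W] by (auto simp: bounded_iff)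
  have "closed S"
  proof -
    have "S = f -` W \<inter> {y. norm (of_int l - exp y) \<le> 1}" unfolding S_def by auto
    moreover have "closed (f -` W)"
      using f_continuous[of UNIV] compact_imp_closed[OF W] by (simp add: continuous_on_closed_vimage)
    moreover have "closed {y::complex. norm (of_int l - exp y) \<le> 1}"
      by (intro closed_Collect_le continuous_intros)
    ultimately show ?thesis by auto
  qed
  moreover have "bounded S"
    unfolding bounded_iff
  proof (intro exI ballI)
    fix y assume "y \<in> S"
    then have y: "f y \<in> W" "norm (of_int l - exp y) \<le> 1" unfolding S_def by auto
    let ?k = "c - (of_int l - 1) * Ln c"
    have "of_int l * y = f y - ?k + of_int l - (of_int l - exp y)" unfolding f_map_def by simp
    then have "norm (of_int l * y) \<le> norm (f y) + norm ?k + norm (of_int l :: complex) + norm (of_int l - exp y)"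
      by (smt (verit) norm_triangle_ineq norm_triangle_ineq4)
    also have "\<dots> \<le> B + norm ?k + norm (of_int l :: complex) + 1" using B[OF y(1)] y(2) by linarith
    finally have 1: "of_int l * norm y \<le> B + norm ?k + norm (of_int l :: complex) + 1"
      using l_ge by (simp add: norm_mult)
    have "1 * norm y \<le> of_int l * norm y" using l_ge by (intro mult_right_mono) auto
    then show "norm y \<le> B + norm ?k + norm (of_int l :: complex) + 1" using 1 by linarith
  qed
  ultimately have comp: "compact S" by (simp add: compact_eq_bounded_closed)
  show ?thesis
  proof (cases "S = {}")
    case True
    show ?thesis
    proof (rule that[of 1])
      fix y assume "f y \<in> W"
      then show "1 \<le> norm (of_int l - exp y)" using True unfolding S_def by fastforce
    qed simp
  next
    case False
    obtain y0 where y0: "y0 \<in> S" "\<And>y. y \<in> S \<Longrightarrow> norm (of_int l - exp y0) \<le> norm (of_int l - exp y)"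
    proof -
      have "continuous_on S (\<lambda>y. norm (of_int l - exp y))" by (intro continuous_intros)
      from continuous_attains_inf[OF comp False this] show ?thesis using that by blast
    qed
    show ?thesis
    proof (rule that[of "min 1 (norm (of_int l - exp y0))"])
      show "0 < min 1 (norm (of_int l - exp y0))" using nc[of y0] y0(1) unfolding S_def by auto
      fix y assume "f y \<in> W"
      then show "min 1 (norm (of_int l - exp y0)) \<le> norm (of_int l - exp y)"
        using y0(2)[of y] unfolding S_def by fastforce
    qed
  qed
qed

text \<open>Over a small ball around \<open>w0\<close> the derivative at all preimages is bounded
  below, so inverse branches of a common radius \<open>r\<close> exist there. The sheet through a
  preimage \<open>y\<close> of \<open>w0\<close> is \<open>U y\<close>; two sheets sharing a point
  \<open>u\<close> would give two preimages of \<open>w0\<close> in \<open>ball u r\<close>, where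
  \<open>f\<close> is injective.\<close>

lemma f_covering:
  assumes crit: "of_int l \<notin> basin"
  shows "covering_space lbasin f lbasin"
proof (rule covering_spaceI)
  show "continuous_on lbasin f" by (rule f_continuous)
  show "f ` lbasin = lbasin" using f_lbasin_iff f_surj by (metis image_iff subsetI subset_antisym)
  fix w0 assume w0: "w0 \<in> lbasin"
  obtain \<rho>1 where \<rho>1: "\<rho>1 > 0" "cball w0 \<rho>1 \<subseteq> lbasin"
    using lbasin_open w0 open_contains_cball by blast
  obtain \<delta> where \<delta>: "\<delta> > 0" "\<And>y. f y \<in> cball w0 \<rho>1 \<Longrightarrow> norm (of_int l - exp y) \<ge> \<delta>"
  proof (rule f_deriv_bounded_below[OF compact_cball])
    fix y assume "f y \<in> cball w0 \<rho>1"
    then have "y \<in> lbasin" using \<rho>1 f_lbasin_iff by blast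
    then show "exp y \<noteq> of_int l" using crit unfolding lbasin_def by auto
  qed (rule that)
  obtain r where r: "r > 0" "\<And>y. norm (of_int l - exp y) \<ge> \<delta> \<Longrightarrow> inj_on f (ball y r)"
    "\<And>y. norm (of_int l - exp y) \<ge> \<delta> \<Longrightarrow> ball (f y) (\<delta> * r / 4) \<subseteq> f ` ball y r"
    using f_local_inverse[OF \<delta>(1)] by metis
  define \<rho> where "\<rho> = min \<rho>1 (\<delta> * r / 4)"
  define T where "T = ball w0 \<rho>"
  have \<rho>: "\<rho> > 0" "\<rho> \<le> \<rho>1" "\<rho> \<le> \<delta> * r / 4" using \<rho>1 \<delta> r unfolding \<rho>_def by auto
  have TB: "T \<subseteq> lbasin" using \<rho>1 \<rho> unfolding T_def by (auto simp: subset_iff)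
  have dT: "norm (of_int l - exp y) \<ge> \<delta>" if "f y \<in> T" for y
    using \<delta>(2)[of y] that \<rho> unfolding T_def by auto
  define U where "U y = ball y r \<inter> f -` T" for y
  have w0T: "w0 \<in> T" using \<rho> unfolding T_def by simp
  have opn: "open (U y)" for y
    unfolding U_def T_def using f_continuous[of UNIV] by (auto simp: continuous_on_open_vimage)
  show "\<exists>T. w0 \<in> T \<and> openin (top_of_set lbasin) T \<and>
          (\<exists>v. \<Union>v = lbasin \<inter> f -` T \<and> (\<forall>u\<in>v. openin (top_of_set lbasin) u) \<and>
               pairwise disjnt v \<and> (\<forall>u\<in>v. \<exists>q. homeomorphism u T f q))"
  proof (intro exI[of _ T] conjI exI[of _ "U ` {y. f y = w0}"])
    show "w0 \<in> T" by fact
    show "openin (top_of_set lbasin) T"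
      using TB unfolding T_def by (simp add: open_openin_trans lbasin_open)
    show "\<Union> (U ` {y. f y = w0}) = lbasin \<inter> f -` T"
    proof
      show "\<Union> (U ` {y. f y = w0}) \<subseteq> lbasin \<inter> f -` T"
        using TB f_lbasin_iff unfolding U_def by blast
      show "lbasin \<inter> f -` T \<subseteq> \<Union> (U ` {y. f y = w0})"
      proof
        fix u assume u: "u \<in> lbasin \<inter> f -` T"
        then have "w0 \<in> ball (f u) (\<delta> * r / 4)" using \<rho> unfolding T_def by (auto simp: dist_commute)
        then obtain y where "y \<in> ball u r" "f y = w0" using r(3)[of u] dT[of u] u by auto
        then show "u \<in> \<Union> (U ` {y. f y = w0})" using u unfolding U_def by (auto simp: dist_commute)
      qed
    qed
    show "\<forall>u\<in>U ` {y. f y = w0}. openin (top_of_set lbasin) u"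
    proof
      fix u assume "u \<in> U ` {y. f y = w0}"
      then obtain y where "u = U y" by blast
      moreover have "U y \<subseteq> lbasin" using TB f_lbasin_iff unfolding U_def by blast
      ultimately show "openin (top_of_set lbasin) u" using opn[of y] by (simp add: open_openin_trans lbasin_open)
    qed
    show "pairwise disjnt (U ` {y. f y = w0})"
    proof (rule pairwiseI)
      fix A B assume AB: "A \<in> U ` {y. f y = w0}" "B \<in> U ` {y. f y = w0}" "A \<noteq> B"
      then obtain y y' where y: "A = U y" "B = U y'" "f y = w0" "f y' = w0" by auto
      show "disjnt A B"
      proof (rule ccontr)
        assume "\<not> disjnt A B"
        then obtain u where u: "u \<in> U y" "u \<in> U y'" unfolding y disjnt_def by blast
        then have "y \<in> ball u r" "y' \<in> ball u r" "f u \<in> T" unfolding U_def by (auto simp: dist_commute)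
        then have "y = y'" using r(2)[OF dT[of u]] y(3,4) by (auto dest: inj_onD)
        then show False using AB(3) y by simp
      qed
    qed
    show "\<forall>u\<in>U ` {y. f y = w0}. \<exists>q. homeomorphism u T f q"
    proof
      fix u assume "u \<in> U ` {y. f y = w0}"
      then obtain y where y: "u = U y" "f y = w0" by blast
      have dy: "norm (of_int l - exp y) \<ge> \<delta>" using dT[of y] y w0T by simp
      have inj: "inj_on f (U y)" using r(2)[OF dy] by (rule inj_on_subset) (auto simp: U_def)
      have im: "f ` U y = T"
      proof
        show "T \<subseteq> f ` U y"
        proof
          fix w assume w: "w \<in> T"
          then have "w \<in> ball (f y) (\<delta> * r / 4)" using \<rho> y unfolding T_def by auto
          then show "w \<in> f ` U y" using r(3)[OF dy] w unfolding U_def by auto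
        qed
      qed (auto simp: U_def)
      obtain q where "homeomorphism (U y) (f ` U y) f q"
        using invariance_of_domain_homeomorphism[OF opn f_continuous _ inj] by auto
      then show "\<exists>q. homeomorphism u T f q" using im y by auto
    qed
  qed
qed

lemma f_iter_has_derivative:
  "((f ^^ n) has_field_derivative (\<Prod>i<n. of_int l - exp ((f ^^ i) z))) (at z)"
proof (induction n)
  case (Suc n)
  from DERIV_chain[OF f_has_derivative Suc]
  show ?case by (simp add: o_def mult.commute)
qed simp

lemma f_iter_fixed: "(f ^^ n) (Ln c) = Ln c"
  by (induction n) (auto simp: f_fixed)

text \<open>Fatou's theorem that an attracting fixed point attracts a critical point: otherwise all inverse
  branches of \<open>f ^^ n\<close> fixing \<open>Ln c\<close> exist on a common disc, where they are uniformly bounded from the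
  left, although their derivatives at \<open>Ln c\<close> tend to infinity.\<close>

lemma critical_point_in_basin: "of_int l \<in> basin"
proof (rule ccontr)
  assume crit: "of_int l \<notin> basin"
  let ?p = "Ln c"
  \<comment> \<open>If \<open>c = l\<close>, the critical point is the fixed point itself and lies
    in the basin.\<close>
  have nz: "of_int l - c \<noteq> 0" using crit c_basin by auto
  obtain \<epsilon> where \<epsilon>: "\<epsilon> > 0" "ball ?p \<epsilon> \<subseteq> lbasin"
    using lbasin_open Ln_c_lbasin open_contains_ball by blast
  obtain m where m: "m > 0" "ball 0 m \<inter> basin = {}" using basin_avoids_zero by blast
  define D where "D = ball ?p \<epsilon>"
  have pD: "?p \<in> D" using \<epsilon> unfolding D_def by simp
  \<comment> \<open>The disc is simply connected, so the branch of order \<open>n\<close> lifts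
    through the covering \<open>f\<close>, normalised to fix \<open>Ln c\<close>.\<close>
  have ex: "\<exists>G. continuous_on D G \<and> G \<in> D \<rightarrow> lbasin \<and> G ?p = ?p \<and> (\<forall>y\<in>D. (f ^^ n) (G y) = y)" for n
  proof (induction n)
    case 0
    show ?case using \<epsilon> unfolding D_def by (intro exI[of _ "\<lambda>y. y"]) (auto simp: subset_iff)
  next
    case (Suc n)
    then obtain G where G: "continuous_on D G" "G \<in> D \<rightarrow> lbasin" "G ?p = ?p" "\<forall>y\<in>D. (f ^^ n) (G y) = y" by blast
    obtain H where H: "continuous_on D H" "H \<in> D \<rightarrow> lbasin" "H ?p = ?p" "\<And>y. y \<in> D \<Longrightarrow> f (H y) = G y"
    proof (rule covering_space_lift_strong[OF f_covering[OF crit] Ln_c_lbasin pD _ _ G(1,2)])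
      show "simply_connected D" unfolding D_def by (simp add: convex_imp_simply_connected)
      show "locally path_connected D" unfolding D_def by (simp add: convex_imp_locally_path_connected)
      show "G ?p = f ?p" using G(3) f_fixed by simp
    qed (rule that)
    have "\<forall>y\<in>D. (f ^^ Suc n) (H y) = y" using H(4) G(4) by (simp add: funpow_swap1)
    then show ?case using H by blast
  qed
  define B where "B = (1 / m) / (\<epsilon> / 2)"
  \<comment> \<open>Cauchy's inequality for \<open>E = exp (- G)\<close> at \<open>Ln c\<close>,
    where the derivative has modulus \<open>|1/c| / |l - c| ^ n\<close>. Since
    \<open>|l - c| < 1\<close> and \<open>B\<close> is independent of \<open>n\<close>, this is
    absurd for large \<open>n\<close>.\<close>
  have bound: "norm (1 / c) \<le> B * norm (of_int l - c) ^ n" for n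
  proof -
    obtain G where G: "continuous_on D G" "G \<in> D \<rightarrow> lbasin" "G ?p = ?p" "\<forall>y\<in>D. (f ^^ n) (G y) = y"
      using ex[of n] by blast
    let ?d = "\<lambda>z. \<Prod>i<n. of_int l - exp ((f ^^ i) z)"
    have dG: "(G has_field_derivative inverse (?d (G y))) (at y)" if y: "y \<in> D" for y
    proof (rule has_field_derivative_inverse_basic[OF f_iter_has_derivative])
      have "G y \<in> lbasin" using G(2) y by blast
      then have "exp ((f ^^ i) (G y)) \<noteq> of_int l" for i
        using crit f_iter_lbasin_iff[of i "G y"] unfolding lbasin_def by auto
      then show "?d (G y) \<noteq> 0" unfolding prod_zero_iff[OF finite_lessThan] by (metis right_minus_eq)
      show "isCont G y" using G(1) y unfolding D_def by (auto simp: continuous_on_eq_continuous_at)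
      show "open D" "y \<in> D" using y unfolding D_def by auto
      show "(f ^^ n) (G z) = z" if "z \<in> D" for z using G(4) that by blast
    qed
    \<comment> \<open>The values \<open>exp (G y)\<close> lie in the basin, hence outside the disc
      of radius \<open>m\<close> around 0. This turns the lower bound on the real part of
      \<open>G\<close> into the bound \<open>1 / m\<close> for \<open>E\<close>.\<close>
    define E where "E = (\<lambda>y. exp (- G y))"
    have dE: "(E has_field_derivative (- exp (- G y) * inverse (?d (G y)))) (at y)" if "y \<in> D" for y
      unfolding E_def using dG[OF that] by (auto intro!: derivative_eq_intros)
    have E_hol: "E holomorphic_on D" unfolding D_def
      by (rule holomorphic_onI) (use dE in \<open>auto simp: D_def field_differentiable_def intro: has_field_derivative_at_within\<close>)
    have sub: "cball ?p (\<epsilon>/2) \<subseteq> D" using \<epsilon> unfolding D_def by auto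
    have "norm ((deriv ^^ 1) E ?p) \<le> fact 1 * (1/m) / (\<epsilon>/2) ^ 1"
    proof (rule Cauchy_inequality)
      show "E holomorphic_on ball ?p (\<epsilon>/2)" using E_hol by (rule holomorphic_on_subset) (use sub in auto)
      show "continuous_on (cball ?p (\<epsilon>/2)) E"
        using holomorphic_on_imp_continuous_on[OF E_hol] continuous_on_subset sub by blast
      show "0 < \<epsilon>/2" using \<epsilon> by simp
      fix x assume "norm (?p - x) = \<epsilon>/2"
      then have "x \<in> D" using sub by (auto simp: dist_norm)
      then have "exp (G x) \<in> basin" using G(2) unfolding lbasin_def by auto
      then have "norm (exp (G x)) \<ge> m" using m by (metis IntI empty_iff mem_ball_0 not_le)
      then have "1 / norm (exp (G x)) \<le> 1 / m" using m by (intro divide_left_mono) auto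
      then show "norm (E x) \<le> 1/m" unfolding E_def by (simp add: exp_minus inverse_eq_divide norm_divide)
    qed
    moreover have "deriv E ?p = - (1/c) * inverse ((of_int l - c) ^ n)"
    proof -
      have "?d ?p = (of_int l - c) ^ n" using f_iter_fixed c_nz by simp
      then show ?thesis using DERIV_imp_deriv[OF dE[OF pD]] G(3) c_nz by (simp add: exp_minus inverse_eq_divide)
    qed
    ultimately have "norm (1/c) * inverse (norm (of_int l - c) ^ n) \<le> B"
      unfolding B_def by (simp add: norm_mult norm_inverse norm_power norm_divide inverse_eq_divide)
    then show ?thesis using nz by (simp add: field_simps)
  qed
  have "(\<lambda>n. B * norm (of_int l - c) ^ n) \<longlonglongrightarrow> B * 0"
    using norm_l_c by (intro tendsto_intros LIMSEQ_power_zero) auto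
  then have "norm (1 / c) \<le> B * 0" using bound by (intro LIMSEQ_le_const) auto
  then show False using c_nz by simp
qed

lemma critical_point_notin_X: "of_int l \<notin> X"
  unfolding X_eq using critical_point_in_basin by blast

end

section \<open>The basin boundary lifts into the Julia set\<close>

text \<open>Schottky's theorem turns the bound at the single point \<open>w\<close> into bounds on
  all compact subsets of the domain, so the limit infinity does not occur and Montel's theorem for
  bounded families applies.\<close>

lemma Montel_omitting_0_1:
  fixes h :: "nat \<Rightarrow> complex \<Rightarrow> complex"
  assumes S: "open S" "connected S" "w \<in> S" and hol: "\<And>n. h n holomorphic_on S"
    and om: "\<And>n z. z \<in> S \<Longrightarrow> h n z \<noteq> 0 \<and> h n z \<noteq> 1" and w: "\<And>n. norm (h n w) \<le> 1"
  obtains G r where "G holomorphic_on S" "strict_mono (r::nat\<Rightarrow>nat)"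
    "\<And>z. z \<in> S \<Longrightarrow> (\<lambda>n. h (r n) z) \<longlonglongrightarrow> G z"
proof -
  have "\<exists>B. \<forall>k\<in>range h. \<forall>z\<in>K. norm (k z) \<le> B" if K: "compact K" "K \<subseteq> S" for K
  proof -
    obtain B where "\<And>k z. \<lbrakk>k \<in> range h; z \<in> K\<rbrakk> \<Longrightarrow> norm (k z) \<le> B"
      by (rule GPicard3[OF S order_refl, of "range h" K]) (use hol om w K in auto)
    then show ?thesis by blast
  qed
  from Montel[OF S(1) _ this order_refl] hol that show ?thesis by (metis rangeE)
qed

lemma open_exp_image:
  fixes S :: "complex set" assumes "open S" shows "open (exp ` S)"
proof (rule open_mapping_thm[OF _ open_UNIV connected_UNIV assms])
  show "\<not> (exp :: complex \<Rightarrow> complex) constant_on UNIV"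
  proof
    assume "(exp :: complex \<Rightarrow> complex) constant_on UNIV"
    then have "exp (0::complex) = exp (of_real pi * \<i>)" unfolding constant_on_def by (metis UNIV_I)
    then show False by simp
  qed
qed (auto intro: holomorphic_intros)

context cyl_map
begin

text \<open>A translation by \<open>2 pi i k\<close> is multiplied by \<open>l\<close> under
  \<open>f\<close>. An orbit that is near \<open>Ln c + 2 pi i j\<close> at time \<open>N\<close>
  therefore follows \<open>Ln c + 2 pi i j l ^ (n - N)\<close>, which corresponds to
  \<open>\<rho> = j / l ^ N\<close>; the number \<open>\<rho>\<close> records the speed of escape,
  and 0 means convergence to \<open>Ln c\<close>.\<close>

definition shifted_basin :: "real \<Rightarrow> complex set" where
  "shifted_basin \<rho> = {u. (\<lambda>n. (f ^^ n) u - 2 * of_real pi * \<i> * of_real (\<rho> * of_int l ^ n)) \<longlonglongrightarrow> Ln c}"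

lemma f_iter_shift:
  "(f ^^ n) (z + 2 * of_real pi * \<i> * of_int k) = (f ^^ n) z + 2 * of_real pi * \<i> * of_int (l ^ n * k)"
proof (induction n)
  case (Suc n)
  then show ?case using f_map_shift[of l c "(f ^^ n) z" "l ^ n * k"] by (simp add: mult.assoc)
qed simp

lemma of_int_l_pow_nz: "(of_int l :: real) ^ n > 0"
  using l_ge by simp

lemma filterlim_l_pow: "filterlim (\<lambda>n. (of_int l :: real) ^ n) at_top sequentially"
proof (rule filterlim_at_infinity_imp_filterlim_at_top)
  show "filterlim (\<lambda>n. (of_int l :: real) ^ n) at_infinity sequentially"
    using l_ge by (intro filterlim_realpow_sequentially_gt1) simp
qed (use of_int_l_pow_nz in auto)

lemma shifted_basin_0: "u \<in> shifted_basin 0 \<longleftrightarrow> (\<lambda>n. (f ^^ n) u) \<longlonglongrightarrow> Ln c"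
  unfolding shifted_basin_def by simp

lemma shifted_basin_of_iter:
  assumes "(\<lambda>n. (f ^^ n) ((f ^^ N) u - 2 * of_real pi * \<i> * of_int j)) \<longlonglongrightarrow> Ln c"
  shows "u \<in> shifted_basin (of_int j / of_int l ^ N)"
proof -
  let ?b = "(f ^^ N) u - 2 * of_real pi * \<i> * of_int j"
  have "(f ^^ (n + N)) u - 2 * of_real pi * \<i> * of_real (of_int j / of_int l ^ N * of_int l ^ (n + N)) = (f ^^ n) ?b" for n
  proof -
    have "(f ^^ (n + N)) u = (f ^^ n) (?b + 2 * of_real pi * \<i> * of_int j)" by (simp add: funpow_add)
    also have "\<dots> = (f ^^ n) ?b + 2 * of_real pi * \<i> * of_int (l ^ n * j)" by (rule f_iter_shift)
    also have "of_int (l ^ n * j) = complex_of_real (of_int j / of_int l ^ N * of_int l ^ (n + N))"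
      using l_ge by (simp add: power_add)
    finally show ?thesis by simp
  qed
  then have "(\<lambda>n. (f ^^ (n + N)) u - 2 * of_real pi * \<i> * of_real (of_int j / of_int l ^ N * of_int l ^ (n + N))) \<longlonglongrightarrow> Ln c"
    using assms by simp
  then show ?thesis unfolding shifted_basin_def mem_Collect_eq
    by (rule LIMSEQ_offset[where f = "\<lambda>n. (f ^^ n) u - 2 * of_real pi * \<i> * of_real (of_int j / of_int l ^ N * of_int l ^ n)"])
qed

lemma shifted_basin_of_iter_eq:
  assumes "(f ^^ N) u = Ln c + 2 * of_real pi * \<i> * of_int j"
  shows "u \<in> shifted_basin (of_int j / of_int l ^ N)"
  by (rule shifted_basin_of_iter) (simp add: assms f_iter_fixed)

lemma lbasin_imp_shifted_basin:
  assumes "v \<in> lbasin"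
  obtains k :: int and m :: nat and U where "open U" "v \<in> U" "U \<subseteq> shifted_basin (of_int k / of_int l ^ m)"
proof -
  obtain \<epsilon> where \<epsilon>: "\<epsilon> > 0" "\<And>z. z \<in> ball (Ln c) \<epsilon> \<Longrightarrow> (\<lambda>n. (f ^^ n) z) \<longlonglongrightarrow> Ln c"
    using attracting_fixed_point_ball[OF f_attracting f_fixed norm_l_c] by metis
  have "open (exp ` ball (Ln c) \<epsilon>)"
    by (rule open_exp_image) simp
  moreover have "c \<in> exp ` ball (Ln c) \<epsilon>" using \<epsilon>(1) c_nz by (intro image_eqI[of _ _ "Ln c"]) auto
  moreover have "(\<lambda>n. (g ^^ n) (exp v)) \<longlonglongrightarrow> c" using assms unfolding lbasin_def basin_def by simp
  ultimately have "eventually (\<lambda>n. (g ^^ n) (exp v) \<in> exp ` ball (Ln c) \<epsilon>) sequentially"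
    by (rule topological_tendstoD[rotated])
  then obtain m where "(g ^^ m) (exp v) \<in> exp ` ball (Ln c) \<epsilon>"
    using eventually_happens'[OF sequentially_bot] by blast
  then obtain b where b: "b \<in> ball (Ln c) \<epsilon>" "exp ((f ^^ m) v) = exp b" by (auto simp: exp_f_iter)
  then obtain k :: int where k: "(f ^^ m) v = b + (of_int (2 * k) * pi) * \<i>" unfolding exp_eq by blast
  define U where "U = (\<lambda>u. (f ^^ m) u - 2 * of_real pi * \<i> * of_int k) -` ball (Ln c) \<epsilon>"
  have "continuous_on UNIV (f ^^ m)" by (rule holomorphic_on_imp_continuous_on[OF f_iter_holomorphic])
  then have "continuous_on UNIV (\<lambda>u. (f ^^ m) u - 2 * of_real pi * \<i> * of_int k)" by (intro continuous_intros)
  then have "open U" unfolding U_def by (simp add: continuous_on_open_vimage)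
  moreover have "v \<in> U" using b k unfolding U_def by (simp add: algebra_simps)
  moreover have "U \<subseteq> shifted_basin (of_int k / of_int l ^ m)"
    unfolding U_def using shifted_basin_of_iter \<epsilon>(2) by auto
  ultimately show ?thesis by (rule that)
qed

text \<open>A single visit near \<open>c\<close> suffices, because the basin contains a ball around
  \<open>c\<close> and is backward invariant; a subsequence is thus as good as the full
  orbit.\<close>

lemma frequently_near_fixed_imp_lbasin:
  assumes "(\<lambda>n. exp ((f ^^ r n) z)) \<longlonglongrightarrow> c" shows "z \<in> lbasin"
proof -
  obtain \<epsilon> where e: "\<epsilon> > 0" "ball c \<epsilon> \<subseteq> basin" using basin_contains_ball by blast
  have "eventually (\<lambda>n. exp ((f ^^ r n) z) \<in> ball c \<epsilon>) sequentially"
    by (rule topological_tendstoD[OF assms]) (use e in auto)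
  then obtain n where "exp ((f ^^ r n) z) \<in> basin"
    using e eventually_happens'[OF sequentially_bot] by blast
  then have "(f ^^ r n) z \<in> lbasin" unfolding lbasin_def by simp
  then show ?thesis by (simp add: f_iter_lbasin_iff)
qed

lemma frontier_lift_in_closure_lbasin:
  assumes "exp z \<in> X" "open S" "z \<in> S" shows "S \<inter> lbasin \<noteq> {}"
proof -
  have "open (exp ` S)"
    by (rule open_exp_image[OF assms(2)])
  moreover have "exp z \<in> closure basin" using assms(1) unfolding X_eq by blast
  ultimately have "basin \<inter> exp ` S \<noteq> {}"
    using assms(3) unfolding closure_iff_nhds_not_empty by blast
  then show ?thesis unfolding lbasin_def by blast
qed

text \<open>On a domain where the iterates tend to infinity, they omit the basin of \<open>Ln c\<close>, in particular the
  solutions \<open>b\<close> of \<open>f b = Ln c\<close> with imaginary part comparable to \<open>l ^ n\<close>. Hence \<open>f ^^ n / l ^ n\<close> is normal,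
  and its limits, which equal \<open>2 pi i \<rho>\<close> on \<open>shifted_basin \<rho>\<close> up to a common factor, are constant.\<close>

lemma shifted_basin_unique:
  assumes S: "open S" "connected S" and esc: "\<And>u. u \<in> S \<Longrightarrow> u \<notin> shifted_basin 0"
    and U: "open U" "U \<subseteq> S" "v \<in> U" "U \<subseteq> shifted_basin \<rho>" and u: "u \<in> S" "u \<in> shifted_basin \<sigma>"
  shows "\<sigma> = \<rho>"
proof -
  let ?p = "Ln c"
  let ?\<tau> = "2 * of_real pi * \<i> :: complex"
  have vS: "v \<in> S" using U by blast
  have \<rho>0: "\<rho> \<noteq> 0" using esc[OF vS] U by auto
  \<comment> \<open>With \<open>N \<ge> 2 |\<rho>| + 1\<close> the bound
    \<open>|b n| \<ge> pi N l ^ n\<close> exceeds the growth \<open>2 pi |\<rho>| l ^ n\<close> of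
    the orbit of \<open>v\<close> by \<open>pi l ^ n\<close>, which absorbs
    \<open>1 + |Ln c|\<close>.\<close>
  define N where "N = nat \<lceil>2 * \<bar>\<rho>\<bar>\<rceil> + 1"
  have N: "real N \<ge> 2 * \<bar>\<rho>\<bar> + 1" unfolding N_def by (simp add: of_nat_ceiling)
  define q where "q n = N * nat l ^ n" for n
  have q: "real (q n) = real N * of_int l ^ n" for n unfolding q_def by (simp add: of_nat_l)
  have "filterlim (\<lambda>n. real (q n)) at_top sequentially"
    unfolding q by (rule filterlim_tendsto_pos_mult_at_top[OF tendsto_const _ filterlim_l_pow]) (use N in linarith)
  then have "filterlim q at_top sequentially"
    using filterlim_sequentially_iff_filterlim_real by blast
  from eventually_compose_filterlim[OF f_preimages_in_annuli[of ?p] this]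
  have ev1: "eventually (\<lambda>n. \<exists>b. f b = ?p \<and> pi * real (q n) \<le> norm b \<and> norm b \<le> 3 * pi * real (q n)) sequentially" .

  have ev2: "eventually (\<lambda>n. norm ((f ^^ n) v - ?\<tau> * of_real (\<rho> * of_int l ^ n) - ?p) < 1) sequentially"
  proof -
    have "v \<in> shifted_basin \<rho>" using U by blast
    then have "(\<lambda>n. (f ^^ n) v - ?\<tau> * of_real (\<rho> * of_int l ^ n)) \<longlonglongrightarrow> ?p" unfolding shifted_basin_def by simp
    then show ?thesis using tendstoD[of _ ?p sequentially 1] by (simp add: dist_norm)
  qed
  have ev3: "eventually (\<lambda>n. (of_int l :: real) ^ n \<ge> 1 + norm ?p) sequentially"
    using filterlim_l_pow unfolding filterlim_at_top by blast
  obtain n1 where n1: "\<And>n. n \<ge> n1 \<Longrightarrow> \<exists>b. f b = ?p \<and> pi * real (q n) \<le> norm b \<and> norm b \<le> 3 * pi * real (q n)"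
     "\<And>n. n \<ge> n1 \<Longrightarrow> norm ((f ^^ n) v - ?\<tau> * of_real (\<rho> * of_int l ^ n) - ?p) < 1"
     "\<And>n. n \<ge> n1 \<Longrightarrow> (of_int l :: real) ^ n \<ge> 1 + norm ?p"
    using eventually_conj[OF ev1 eventually_conj[OF ev2 ev3]] unfolding eventually_sequentially by blast
  obtain b where b: "\<And>n. n \<ge> n1 \<Longrightarrow> f (b n) = ?p" "\<And>n. n \<ge> n1 \<Longrightarrow> pi * real (q n) \<le> norm (b n)"
     "\<And>n. n \<ge> n1 \<Longrightarrow> norm (b n) \<le> 3 * pi * real (q n)"
    using n1(1) by metis
  have lower: "norm (b n - ?p) \<ge> 1 + 2 * pi * \<bar>\<rho>\<bar> * of_int l ^ n" if n: "n \<ge> n1" for n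
  proof -
    let ?L = "(of_int l :: real) ^ n"
    have "pi * ?L \<ge> 1 + norm ?p"
      using n1(3)[OF n] pi_ge_two of_int_l_pow_nz[of n] mult_right_mono[of 1 pi ?L] by linarith
    moreover have "pi * real N * ?L \<ge> pi * (2 * \<bar>\<rho>\<bar> + 1) * ?L"
      using N of_int_l_pow_nz[of n] by (intro mult_right_mono mult_left_mono) auto
    moreover have "pi * (2 * \<bar>\<rho>\<bar> + 1) * ?L = 2 * pi * \<bar>\<rho>\<bar> * ?L + pi * ?L" by (simp add: algebra_simps)
    moreover have "norm (b n) \<ge> pi * real N * ?L" using b(2)[OF n] unfolding q by (simp add: mult.assoc)
    moreover have "norm (b n - ?p) \<ge> norm (b n) - norm ?p" by (rule norm_triangle_ineq2)
    ultimately show ?thesis by linarith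
  qed
  have lower1: "norm (b n - ?p) \<ge> 1" if "n \<ge> n1" for n
    using lower[OF that] of_int_l_pow_nz[of n] by (smt (verit) mult_nonneg_nonneg pi_ge_zero abs_ge_zero)
  then have bp: "b n \<noteq> ?p" if "n \<ge> n1" for n using that by fastforce
  \<comment> \<open>The affine change sends the two omitted values \<open>Ln c\<close> and
    \<open>b n\<close> to 0 and 1, and \<open>N\<close> was chosen so that the value at
    \<open>v\<close> has norm at most 1. The index shift \<open>n1\<close> makes all estimates valid
    from the first term on.\<close>
  define h where "h n x = ((f ^^ (n + n1)) x - ?p) / (b (n + n1) - ?p)" for n x
  \<comment> \<open>The common factor of the limits: on \<open>shifted_basin s\<close> the functions
    \<open>h n\<close> behave like \<open>2 pi i s * \<beta> n\<close>.\<close>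
  define \<beta> where "\<beta> n = of_real (of_int l ^ (n + n1)) / (b (n + n1) - ?p)" for n
  obtain G r where G: "G holomorphic_on S" "strict_mono (r::nat\<Rightarrow>nat)" "\<And>z. z \<in> S \<Longrightarrow> (\<lambda>n. h (r n) z) \<longlonglongrightarrow> G z"
  proof (rule Montel_omitting_0_1[OF S vS, of h])
    show "h n holomorphic_on S" for n
      unfolding h_def using bp[of "n + n1"] by (intro holomorphic_intros f_iter_holomorphic) auto
    show "h n z \<noteq> 0 \<and> h n z \<noteq> 1" if z: "z \<in> S" for n z
    proof
      show "h n z \<noteq> 0"
      proof
        assume "h n z = 0"
        then have "(f ^^ (n + n1)) z = ?p + 2 * of_real pi * \<i> * of_int 0" unfolding h_def using bp[of "n + n1"] by simp
        from shifted_basin_of_iter_eq[OF this] esc[OF z] show False by simp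
      qed
      show "h n z \<noteq> 1"
      proof
        assume "h n z = 1"
        then have "(f ^^ (n + n1)) z = b (n + n1)" unfolding h_def using bp[of "n + n1"] by simp
        then have "(f ^^ Suc (n + n1)) z = ?p + 2 * of_real pi * \<i> * of_int 0" using b(1)[of "n + n1"] by simp
        from shifted_basin_of_iter_eq[OF this] esc[OF z] show False by simp
      qed
    qed
    show "norm (h n v) \<le> 1" for n
    proof -
      have "norm ((f ^^ (n + n1)) v - ?p) \<le> norm ((f ^^ (n + n1)) v - ?\<tau> * of_real (\<rho> * of_int l ^ (n + n1)) - ?p)
          + norm (?\<tau> * of_real (\<rho> * of_int l ^ (n + n1)))"
        by (rule order_trans[OF _ norm_triangle_ineq]) simp
      also have "norm (?\<tau> * of_real (\<rho> * of_int l ^ (n + n1))) = 2 * pi * \<bar>\<rho>\<bar> * of_int l ^ (n + n1)"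
        using l_ge by (simp add: norm_mult norm_power abs_mult power_abs)
      finally have "norm ((f ^^ (n + n1)) v - ?p) \<le> norm (b (n + n1) - ?p)"
        using n1(2)[of "n + n1"] lower[of "n + n1"] by linarith
      then show ?thesis unfolding h_def using bp[of "n + n1"] by (simp add: norm_divide divide_le_eq)
    qed
  qed (rule that)
  have diff: "(\<lambda>n. h n x - ?\<tau> * of_real s * \<beta> n) \<longlonglongrightarrow> 0" if x: "x \<in> shifted_basin s" for x s
  proof (rule Lim_null_comparison)
    have "(\<lambda>n. (f ^^ n) x - ?\<tau> * of_real (s * of_int l ^ n)) \<longlonglongrightarrow> ?p" using x unfolding shifted_basin_def by simp
    then have "(\<lambda>n. norm ((f ^^ n) x - ?\<tau> * of_real (s * of_int l ^ n) - ?p)) \<longlonglongrightarrow> 0"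
      using LIM_zero tendsto_norm_zero by blast
    then show "(\<lambda>n. norm ((f ^^ (n + n1)) x - ?\<tau> * of_real (s * of_int l ^ (n + n1)) - ?p)) \<longlonglongrightarrow> 0"
      by (rule LIMSEQ_ignore_initial_segment)
    show "\<forall>\<^sub>F n in sequentially. norm (h n x - ?\<tau> * of_real s * \<beta> n)
       \<le> norm ((f ^^ (n + n1)) x - ?\<tau> * of_real (s * of_int l ^ (n + n1)) - ?p)"
    proof (intro always_eventually allI)
      fix n
      have "h n x - ?\<tau> * of_real s * \<beta> n = ((f ^^ (n + n1)) x - ?\<tau> * of_real (s * of_int l ^ (n + n1)) - ?p) / (b (n + n1) - ?p)"
        unfolding h_def \<beta>_def by (simp add: diff_divide_distrib mult.assoc)
      then have "norm (h n x - ?\<tau> * of_real s * \<beta> n) = norm ((f ^^ (n + n1)) x - ?\<tau> * of_real (s * of_int l ^ (n + n1)) - ?p) / norm (b (n + n1) - ?p)"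
        by (simp add: norm_divide)
      also have "\<dots> \<le> norm ((f ^^ (n + n1)) x - ?\<tau> * of_real (s * of_int l ^ (n + n1)) - ?p) / 1"
        using lower1[of "n + n1"] by (intro divide_left_mono) auto
      finally show "norm (h n x - ?\<tau> * of_real s * \<beta> n) \<le> norm ((f ^^ (n + n1)) x - ?\<tau> * of_real (s * of_int l ^ (n + n1)) - ?p)" by simp
    qed
  qed
  have lim: "(\<lambda>n. ?\<tau> * of_real s * \<beta> (r n)) \<longlonglongrightarrow> G x" if x: "x \<in> S" "x \<in> shifted_basin s" for x s
    using tendsto_diff[OF G(3)[OF x(1)] LIMSEQ_subseq_LIMSEQ[OF diff[OF x(2)] G(2)]] by (simp add: o_def)
  define B where "B = G v / (?\<tau> * of_real \<rho>)"
  have \<beta>B: "(\<lambda>n. \<beta> (r n)) \<longlonglongrightarrow> B"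
  proof -
    have "(\<lambda>n. ?\<tau> * of_real \<rho> * \<beta> (r n) / (?\<tau> * of_real \<rho>)) \<longlonglongrightarrow> G v / (?\<tau> * of_real \<rho>)"
      by (intro tendsto_divide lim tendsto_const vS) (use U \<rho>0 in auto)
    then show ?thesis unfolding B_def using \<rho>0 by simp
  qed
  have G_eq: "G x = ?\<tau> * of_real s * B" if x: "x \<in> S" "x \<in> shifted_basin s" for x s
    by (rule LIMSEQ_unique[OF lim[OF x]]) (intro tendsto_intros \<beta>B)
  \<comment> \<open>The upper bound \<open>|b n| \<le> 3 pi N l ^ n\<close> keeps
    \<open>\<beta>\<close> away from 0; without it the limit function would not distinguish
    parameters.\<close>
  have B0: "B \<noteq> 0"
  proof
    assume "B = 0"
    have "norm (\<beta> n) \<ge> 1 / (3 * pi * real N + 1)" for n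
    proof -
      let ?L = "(of_int l :: real) ^ (n + n1)"
      have "norm (b (n + n1) - ?p) \<le> norm (b (n + n1)) + norm ?p" by (rule norm_triangle_ineq4)
      also have "\<dots> \<le> 3 * pi * real N * ?L + ?L"
        using b(3)[of "n + n1"] n1(3)[of "n + n1"] unfolding q by (simp add: mult.assoc)
      finally have "norm (b (n + n1) - ?p) \<le> (3 * pi * real N + 1) * ?L" by (simp add: algebra_simps)
      moreover have "norm (b (n + n1) - ?p) > 0" using bp[of "n + n1"] by simp
      moreover have "3 * pi * real N + 1 > 0" by (simp add: add_nonneg_pos)
      moreover have "norm (\<beta> n) = ?L / norm (b (n + n1) - ?p)"
        unfolding \<beta>_def using l_ge by (simp add: norm_divide norm_power)
      ultimately show ?thesis by (simp add: divide_le_eq le_divide_eq mult.commute)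
    qed
    moreover have "(\<lambda>n. norm (\<beta> (r n))) \<longlonglongrightarrow> norm B" using \<beta>B by (rule tendsto_norm)
    ultimately have "norm B \<ge> 1 / (3 * pi * real N + 1)" by (intro LIMSEQ_le_const) auto
    moreover have "1 / (3 * pi * real N + 1) > 0" by (intro divide_pos_pos add_nonneg_pos) auto
    ultimately show False using \<open>B = 0\<close> by simp
  qed
  \<comment> \<open>The limit is constant on \<open>U\<close>, hence on the connected set
    \<open>S\<close>, so its value at \<open>u\<close> reveals \<open>\<sigma>\<close>.\<close>
  have "G u = ?\<tau> * of_real \<rho> * B"
  proof (rule analytic_continuation_open[OF U(1) S(1) _ S(2) U(2) G(1) holomorphic_on_const _ u(1)])
    show "U \<noteq> {}" using U by blast
    show "G z = ?\<tau> * of_real \<rho> * B" if "z \<in> U" for z using G_eq[of z \<rho>] that U by blast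
  qed
  moreover have "G u = ?\<tau> * of_real \<sigma> * B" using G_eq[OF u] .
  ultimately have "?\<tau> * of_real \<rho> * B = ?\<tau> * of_real \<sigma> * B" by metis
  then show ?thesis using B0 by simp
qed

text \<open>A domain of normality around \<open>z\<close> meets \<open>lbasin\<close> in an open set
  \<open>U\<close> of some \<open>shifted_basin \<rho>\<close>. A finite limit forces
  \<open>\<rho> = 0\<close> and equals \<open>Ln c\<close> on \<open>U\<close>, hence at
  \<open>z\<close>. If the limit is infinity, \<open>\<rho>\<close> is the only parameter on the
  domain, so the iterates minus \<open>2 pi i \<rho> l ^ n\<close> omit \<open>Ln c - 2 pi i\<close>
  and \<open>Ln c + 2 pi i\<close> and tend to \<open>Ln c\<close> along a subsequence. In both
  cases \<open>exp z\<close> would lie in the basin.\<close>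

lemma X_lift_in_julia:
  assumes zX: "exp z \<in> X" shows "z \<in> julia_set f"
proof (rule ccontr)
  assume "z \<notin> julia_set f"
  then obtain S where S: "open S" "connected S" "z \<in> S" "normal_family_on S (range (\<lambda>n. f ^^ n))"
    unfolding julia_set_def fatou_set_def by auto
  have znb: "z \<notin> lbasin" using zX unfolding X_eq lbasin_def by simp
  let ?p = "Ln c"
  let ?\<tau> = "2 * of_real pi * \<i> :: complex"
  obtain v where v: "v \<in> S" "v \<in> lbasin" using frontier_lift_in_closure_lbasin[OF zX S(1,3)] by blast
  obtain k :: int and m and U0 where U0: "open U0" "v \<in> U0" "U0 \<subseteq> shifted_basin (of_int k / of_int l ^ m)"
    using lbasin_imp_shifted_basin[OF v(2)] by metis
  define \<rho> :: real where "\<rho> = of_int k / of_int l ^ m"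
  define U where "U = U0 \<inter> S"
  have U: "open U" "U \<subseteq> S" "v \<in> U" "U \<subseteq> shifted_basin \<rho>" using U0 v S unfolding U_def \<rho>_def by auto
  obtain r :: "nat \<Rightarrow> nat" where r: "strict_mono r" and
    cases: "(\<exists>G. \<forall>K. compact K \<and> K \<subseteq> S \<longrightarrow> uniform_limit K ((\<lambda>n. f ^^ n) \<circ> r) G sequentially) \<or>
      (\<forall>K. compact K \<and> K \<subseteq> S \<longrightarrow> (\<forall>B. eventually (\<lambda>n. \<forall>z\<in>K. B < norm ((f ^^ r n) z)) sequentially))"
    using S(4) unfolding normal_family_on_def by blast
  from cases show False
  proof
    assume "\<exists>G. \<forall>K. compact K \<and> K \<subseteq> S \<longrightarrow> uniform_limit K ((\<lambda>n. f ^^ n) \<circ> r) G sequentially"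
    then obtain G where G: "\<And>K. compact K \<Longrightarrow> K \<subseteq> S \<Longrightarrow> uniform_limit K ((\<lambda>n. f ^^ n) \<circ> r) G sequentially" by blast
    have ptw: "(\<lambda>n. (f ^^ r n) x) \<longlonglongrightarrow> G x" if "x \<in> S" for x
      using tendsto_uniform_limitI[OF G[of "{x}"]] that by (simp add: o_def)
    have Ghol: "G holomorphic_on S"
    proof (rule holomorphic_uniform_sequence[OF S(1), of "(\<lambda>n. f ^^ n) \<circ> r"])
      show "((\<lambda>n. f ^^ n) \<circ> r) n holomorphic_on S" for n by (simp add: f_iter_holomorphic)
      fix x assume "x \<in> S"
      then obtain d where d: "d > 0" "cball x d \<subseteq> S" using S(1) open_contains_cball by blast
      then show "\<exists>d>0. cball x d \<subseteq> S \<and> uniform_limit (cball x d) ((\<lambda>n. f ^^ n) \<circ> r) G sequentially"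
        using G[of "cball x d"] by auto
    qed
    \<comment> \<open>Otherwise the iterates at \<open>v\<close> would grow like
      \<open>l ^ n\<close> and have no finite limit.\<close>
    have "\<rho> = 0"
    proof (rule ccontr)
      assume \<rho>: "\<rho> \<noteq> 0"
      have "v \<in> shifted_basin \<rho>" using U by blast
      then have "(\<lambda>n. (f ^^ n) v - ?\<tau> * of_real (\<rho> * of_int l ^ n)) \<longlonglongrightarrow> ?p" unfolding shifted_basin_def by simp
      from LIMSEQ_subseq_LIMSEQ[OF this r]
      have 1: "(\<lambda>n. (f ^^ r n) v - ?\<tau> * of_real (\<rho> * of_int l ^ r n)) \<longlonglongrightarrow> ?p" by (simp add: o_def)
      have "(\<lambda>n. ?\<tau> * of_real (\<rho> * of_int l ^ r n)) \<longlonglongrightarrow> G v - ?p"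
        using tendsto_diff[OF ptw[OF v(1)] 1] by simp
      from tendsto_norm[OF this]
      have "(\<lambda>n. (2 * pi * \<bar>\<rho>\<bar>) * of_int l ^ r n) \<longlonglongrightarrow> norm (G v - ?p)"
        using l_ge by (simp add: norm_mult norm_power abs_mult power_abs mult.assoc)
      moreover have "filterlim (\<lambda>n. (2 * pi * \<bar>\<rho>\<bar>) * of_int l ^ r n) at_top sequentially"
        by (rule filterlim_tendsto_pos_mult_at_top[OF tendsto_const _ filterlim_compose[OF filterlim_l_pow filterlim_subseq[OF r]]])
           (use \<rho> in simp)
      ultimately show False using not_tendsto_and_filterlim_at_infinity[OF sequentially_bot] filterlim_at_top_imp_at_infinity by blast
    qed
    then have "G x = ?p" if "x \<in> U" for x
    proof -
      have "(\<lambda>n. (f ^^ n) x) \<longlonglongrightarrow> ?p" using that U \<open>\<rho> = 0\<close> shifted_basin_0 by blast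
      from LIMSEQ_subseq_LIMSEQ[OF this r] ptw[of x] that U(2) show ?thesis by (auto simp: o_def intro: LIMSEQ_unique)
    qed
    then have "G z = ?p"
      using analytic_continuation_open[OF U(1) S(1) _ S(2) U(2) Ghol holomorphic_on_const _ S(3)] U(3) by blast
    then have "(\<lambda>n. exp ((f ^^ r n) z)) \<longlonglongrightarrow> exp ?p" using ptw[OF S(3)] by (intro tendsto_exp) simp
    then have "z \<in> lbasin" using frequently_near_fixed_imp_lbasin[of r z] c_nz by simp
    then show False using znb by blast
  next
    assume inf: "\<forall>K. compact K \<and> K \<subseteq> S \<longrightarrow> (\<forall>B. eventually (\<lambda>n. \<forall>z\<in>K. B < norm ((f ^^ r n) z)) sequentially)"
    have esc: "u \<notin> shifted_basin 0" if u: "u \<in> S" for u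
    proof
      assume "u \<in> shifted_basin 0"
      then have "(\<lambda>n. (f ^^ n) u) \<longlonglongrightarrow> ?p" by (simp add: shifted_basin_0)
      from LIMSEQ_subseq_LIMSEQ[OF this r] have "(\<lambda>n. (f ^^ r n) u) \<longlonglongrightarrow> ?p" by (simp add: o_def)
      then have "eventually (\<lambda>n. norm ((f ^^ r n) u) < norm ?p + 1) sequentially"
        by (rule order_tendstoD(2)[OF tendsto_norm]) simp
      moreover have "eventually (\<lambda>n. \<forall>z\<in>{u}. norm ?p + 1 < norm ((f ^^ r n) z)) sequentially"
        using inf[rule_format, of "{u}"] u by simp
      ultimately have "eventually (\<lambda>n. False) sequentially" by eventually_elim auto
      then show False by simp
    qed
    have uniq: "\<sigma> = \<rho>" if "u \<in> S" "u \<in> shifted_basin \<sigma>" for u \<sigma>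
      by (rule shifted_basin_unique[OF S(1,2) esc U that])
    \<comment> \<open>Normalised so that \<open>Ln c - 2 pi i\<close>, \<open>Ln c\<close> and
      \<open>Ln c + 2 pi i\<close> go to 0, 1/2 and 1.\<close>
    define H where "H n x = ((f ^^ n) x - ?\<tau> * of_real (\<rho> * of_int l ^ n) - (?p - ?\<tau>)) / (2 * ?\<tau>)" for n x
    have "v \<in> shifted_basin \<rho>" using U by blast
    have H_lim: "(\<lambda>n. H n x) \<longlonglongrightarrow> 1/2" if "x \<in> shifted_basin \<rho>" for x
    proof -
      have "(\<lambda>n. (f ^^ n) x - ?\<tau> * of_real (\<rho> * of_int l ^ n)) \<longlonglongrightarrow> ?p" using that unfolding shifted_basin_def by simp
      then have "(\<lambda>n. H n x) \<longlonglongrightarrow> (?p - (?p - ?\<tau>)) / (2 * ?\<tau>)"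
        unfolding H_def by (intro tendsto_intros) auto
      then show ?thesis by simp
    qed
    have "eventually (\<lambda>n. norm (H n v) < 1) sequentially"
      by (rule order_tendstoD(2)[OF tendsto_norm[OF H_lim]]) (use \<open>v \<in> shifted_basin \<rho>\<close> in auto)
    then obtain n0 where n0: "\<And>n. n \<ge> n0 \<Longrightarrow> norm (H n v) < 1" unfolding eventually_sequentially by blast
    define n1 where "n1 = max n0 m"
    \<comment> \<open>From time \<open>m\<close> on, the drift \<open>\<rho> * l ^ n\<close> is an
      integer, so subtracting it amounts to a translation by a period of \<open>exp\<close>.\<close>
    have int: "\<rho> * of_int l ^ (n + n1) = of_int (k * l ^ (n + n1 - m))" for n
    proof -
      have "(of_int l :: real) ^ (n + n1) = of_int l ^ (n + n1 - m) * of_int l ^ m"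
        unfolding power_add[symmetric] n1_def by simp
      then show ?thesis unfolding \<rho>_def using l_ge by simp
    qed
    \<comment> \<open>Hitting a translate of \<open>Ln c\<close> other than the expected one would
      place \<open>x\<close> in a shifted basin with a different parameter.\<close>
    have no: "(f ^^ (n + n1)) x \<noteq> ?p + ?\<tau> * of_int (k * l ^ (n + n1 - m) + j)" if x: "x \<in> S" and j: "j \<noteq> 0" for n x j
    proof
      assume "(f ^^ (n + n1)) x = ?p + ?\<tau> * of_int (k * l ^ (n + n1 - m) + j)"
      from uniq[OF x shifted_basin_of_iter_eq[OF this]]
      have "of_int (k * l ^ (n + n1 - m) + j) = \<rho> * of_int l ^ (n + n1)"
        by (metis of_int_l_pow_nz less_irrefl nonzero_divide_eq_eq)
      then show False unfolding int using j by simp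
    qed
    obtain G s where G: "G holomorphic_on S" "strict_mono (s::nat\<Rightarrow>nat)" "\<And>x. x \<in> S \<Longrightarrow> (\<lambda>n. H (s n + n1) x) \<longlonglongrightarrow> G x"
    proof (rule Montel_omitting_0_1[OF S(1,2) v(1), of "\<lambda>n. H (n + n1)"])
      show "H (n + n1) holomorphic_on S" for n
        unfolding H_def[abs_def] by (intro holomorphic_intros f_iter_holomorphic) auto
      show "norm (H (n + n1) v) \<le> 1" for n
        by (rule less_imp_le[OF n0]) (simp add: n1_def trans_le_add2)
      show "H (n + n1) x \<noteq> 0 \<and> H (n + n1) x \<noteq> 1" if x: "x \<in> S" for n x
      proof
        show "H (n + n1) x \<noteq> 0" using no[OF x, of "-1" n] unfolding H_def int by (auto simp: algebra_simps)
        show "H (n + n1) x \<noteq> 1" using no[OF x, of 1 n] unfolding H_def int by (auto simp: algebra_simps)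
      qed
    qed (rule that)
    have "G x = 1/2" if x: "x \<in> U" for x
    proof -
      have "(\<lambda>n. H (n + n1) x) \<longlonglongrightarrow> 1/2" using H_lim[of x] x U(4) by (intro LIMSEQ_ignore_initial_segment) blast
      from LIMSEQ_subseq_LIMSEQ[OF this G(2)] have "(\<lambda>n. H (s n + n1) x) \<longlonglongrightarrow> 1/2" by (simp add: o_def)
      moreover have "(\<lambda>n. H (s n + n1) x) \<longlonglongrightarrow> G x" using G(3) x U(2) by blast
      ultimately show ?thesis by (metis LIMSEQ_unique)
    qed
    then have Gz: "G z = 1/2"
      using analytic_continuation_open[OF U(1) S(1) _ S(2) U(2) G(1) holomorphic_on_const _ S(3)] U(3) by blast
    \<comment> \<open>Exponentiation forgets the subtracted multiples of \<open>2 pi i\<close>, so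
      the limit 1/2 of \<open>H\<close> at \<open>z\<close> says that the orbit of
      \<open>exp z\<close> comes close to \<open>c\<close>.\<close>
    have "(\<lambda>n. exp (H (s n + n1) z * (2 * ?\<tau>) + (?p - ?\<tau>))) \<longlonglongrightarrow> exp (1/2 * (2 * ?\<tau>) + (?p - ?\<tau>))"
      by (intro tendsto_intros G(3)[OF S(3), unfolded Gz])
    moreover have "exp (H (s n + n1) z * (2 * ?\<tau>) + (?p - ?\<tau>)) = exp ((f ^^ (s n + n1)) z)" for n
    proof -
      have "H (s n + n1) z * (2 * ?\<tau>) + (?p - ?\<tau>) = (f ^^ (s n + n1)) z + ?\<tau> * of_int (- (k * l ^ (s n + n1 - m)))"
        unfolding H_def int by simp
      then show ?thesis by (simp only: exp_cyl_shift)
    qed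
    ultimately have "(\<lambda>n. exp ((f ^^ (s n + n1)) z)) \<longlonglongrightarrow> c" using c_nz by simp
    from frequently_near_fixed_imp_lbasin[OF this] znb show False by blast
  qed
qed

end

section \<open>Sums over preimages\<close>

text \<open>A branch of the logarithm that is holomorphic on the half-plane around the direction
  \<open>\<omega>\<close>.\<close>

definition rotated_Ln :: "complex \<Rightarrow> complex \<Rightarrow> complex" where
  "rotated_Ln \<omega> v = Ln (v * cnj \<omega>) + Ln \<omega>"

lemma mult_cnj_unit: "norm \<omega> = 1 \<Longrightarrow> cnj \<omega> * \<omega> = 1"
  using complex_norm_square[of \<omega>] by (simp add: mult.commute)

lemma exp_rotated_Ln:
  assumes "norm \<omega> = 1" "v \<noteq> 0" shows "exp (rotated_Ln \<omega> v) = v"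
proof -
  have w: "\<omega> \<noteq> 0" using assms(1) by auto
  then have "exp (rotated_Ln \<omega> v) = v * (cnj \<omega> * \<omega>)"
    unfolding rotated_Ln_def exp_add using assms(2) by simp
  then show ?thesis using mult_cnj_unit[OF assms(1)] by simp
qed

lemma Im_rotated_Ln:
  assumes "norm \<omega> = 1" "v \<noteq> 0" shows "\<bar>Im (rotated_Ln \<omega> v)\<bar> \<le> 2 * pi"
proof -
  have w: "\<omega> \<noteq> 0" "v * cnj \<omega> \<noteq> 0" using assms by auto
  show ?thesis unfolding rotated_Ln_def
    using mpi_less_Im_Ln[OF w(1)] Im_Ln_le_pi[OF w(1)] mpi_less_Im_Ln[OF w(2)] Im_Ln_le_pi[OF w(2)] by auto
qed

lemma rotated_Ln_lipschitz:
  assumes w: "norm \<omega> = 1" and R: "R > 0" and v: "Re (v * cnj \<omega>) \<ge> R" "Re (v' * cnj \<omega>) \<ge> R"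
  shows "norm (rotated_Ln \<omega> v - rotated_Ln \<omega> v') \<le> norm (v - v') / R"
proof -
  have "norm (Ln (v * cnj \<omega>) - Ln (v' * cnj \<omega>)) \<le> 1/R * norm (v * cnj \<omega> - v' * cnj \<omega>)"
  proof (rule field_differentiable_bound)
    show "convex {z. Re z \<ge> R}" by (rule convex_halfspace_Re_ge)
    fix z :: complex assume z: "z \<in> {z. Re z \<ge> R}"
    then have "Re z > 0" using R by simp
    then have "z \<notin> \<real>\<^sub>\<le>\<^sub>0" by (simp add: complex_nonpos_Reals_iff)
    then show "(Ln has_field_derivative inverse z) (at z within {z. Re z \<ge> R})"
      by (rule has_field_derivative_at_within[OF has_field_derivative_Ln])
    have "norm z \<ge> R" using z complex_Re_le_cmod[of z] by auto
    then have "1 / norm z \<le> 1 / R" using R by (intro divide_left_mono mult_pos_pos) linarith+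
    then show "norm (inverse z) \<le> 1/R" by (simp only: norm_inverse inverse_eq_divide[of "norm z"])
  qed (use v in auto)
  also have "norm (v * cnj \<omega> - v' * cnj \<omega>) = norm (v - v')"
    using w by (metis complex_mod_cnj left_diff_distrib mult.right_neutral norm_mult)
  finally show ?thesis unfolding rotated_Ln_def by simp
qed

definition axis_direction :: "bool \<times> bool \<Rightarrow> complex" where
  "axis_direction a = (if fst a then 1 else \<i>) * (if snd a then 1 else -1)"

lemma norm_axis_direction: "norm (axis_direction a) = 1"
  unfolding axis_direction_def by (simp add: norm_mult)

lemma axis_direction_exists:
  assumes "norm v \<ge> 2 * R" shows "\<exists>a. Re (v * cnj (axis_direction a)) \<ge> R"
proof -
  have "\<bar>Re v\<bar> \<ge> R \<or> \<bar>Im v\<bar> \<ge> R" using assms cmod_le[of v] by linarith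
  then consider "Re v \<ge> R" | "- Re v \<ge> R" | "Im v \<ge> R" | "- Im v \<ge> R" by linarith
  then show ?thesis
  proof cases
    case 1 then show ?thesis by (intro exI[of _ "(True, True)"]) (simp add: axis_direction_def)
  next
    case 2 then show ?thesis by (intro exI[of _ "(True, False)"]) (simp add: axis_direction_def)
  next
    case 3 then show ?thesis by (intro exI[of _ "(False, True)"]) (simp add: axis_direction_def)
  next
    case 4 then show ?thesis by (intro exI[of _ "(False, False)"]) (simp add: axis_direction_def)
  qed
qed

context cyl_map
begin

text \<open>Taking logarithms in \<open>g v = w\<close>, the preimages far from the origin are labelled by one of four
  half-planes and an integer; the label determines \<open>v\<close> because \<open>l * log\<close> is a contraction on the half-plane.\<close>

definition preimage_label :: "complex \<Rightarrow> bool \<times> bool \<Rightarrow> int \<Rightarrow> complex \<Rightarrow> bool" where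
  "preimage_label w a k v \<longleftrightarrow> Re (v * cnj (axis_direction a)) \<ge> 2 * of_int l \<and>
     v - of_int l * rotated_Ln (axis_direction a) v - Ln (K / w) = 2 * of_int k * of_real pi * \<i>"

lemma preimage_label_exists:
  assumes "g v = w" "w \<noteq> 0" "norm v \<ge> 4 * of_int l"
  shows "\<exists>a k. preimage_label w a k v"
proof -
  obtain a where a: "Re (v * cnj (axis_direction a)) \<ge> 2 * of_int l"
    using axis_direction_exists[of "2 * of_int l" v] assms(3) by auto
  let ?R = "rotated_Ln (axis_direction a) v"
  have v0: "v \<noteq> 0" using assms g_eq_0_iff by auto
  have "exp (of_int l * ?R) = v ^ nat l"
    using exp_of_nat_mult[of "nat l" ?R] exp_rotated_Ln[OF norm_axis_direction v0] by (simp add: of_nat_l)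
  then have "exp (v - of_int l * ?R - Ln (K / w)) = exp v / v ^ nat l / (K / w)"
    using assms(2) K_nz by (simp add: exp_diff)
  also have "\<dots> = 1" using assms(1,2) K_nz v0 unfolding g_def exp_minus by (auto simp: field_simps)
  finally have "exp (v - of_int l * ?R - Ln (K / w)) = exp 0" by simp
  then obtain k :: int where "v - of_int l * ?R - Ln (K / w) = 0 + (of_int (2 * k) * pi) * \<i>"
    unfolding exp_eq by blast
  then have "preimage_label w a k v" using a unfolding preimage_label_def by simp
  then show ?thesis by blast
qed

lemma preimage_label_unique:
  assumes "preimage_label w a k v" "preimage_label w a k v'" shows "v = v'"
proof -
  let ?R = "rotated_Ln (axis_direction a)"
  have l0: "real_of_int l > 0" using l_ge by simp
  have "v - of_int l * ?R v = v' - of_int l * ?R v'"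
    using assms unfolding preimage_label_def by (metis diff_add_cancel)
  then have "v - v' = of_int l * (?R v - ?R v')" by (simp add: algebra_simps)
  then have "norm (v - v') = of_int l * norm (?R v - ?R v')" using l0 by (simp add: norm_mult)
  \<comment> \<open>On the half-plane at distance \<open>2 * l\<close> the logarithm has Lipschitz
    constant \<open>1 / (2 * l)\<close>, so \<open>l\<close> times it contracts by 1/2.\<close>
  also have "\<dots> \<le> of_int l * (norm (v - v') / (2 * of_int l))"
    using assms l0 unfolding preimage_label_def
    by (intro mult_left_mono rotated_Ln_lipschitz norm_axis_direction) auto
  also have "\<dots> = norm (v - v') / 2" using l0 by simp
  finally show ?thesis by simp
qed

text \<open>In the defining equation both logarithms have bounded imaginary part, so
  \<open>2 pi k\<close> differs from \<open>Im v\<close> by a bounded amount.\<close>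

lemma preimage_label_bound:
  assumes "preimage_label w a k v" "w \<noteq> 0" "v \<noteq> 0"
  shows "2 * pi * \<bar>of_int k\<bar> \<le> norm v + (2 * pi * of_int l + pi)"
proof -
  let ?R = "rotated_Ln (axis_direction a) v"
  have "Im (v - of_int l * ?R - Ln (K / w)) = Im (2 * of_int k * of_real pi * \<i>)"
    using assms(1) unfolding preimage_label_def by simp
  then have "2 * of_int k * pi = Im v - of_int l * Im ?R - Im (Ln (K / w))" by simp
  moreover have "\<bar>of_int l * Im ?R\<bar> \<le> of_int l * (2 * pi)"
    using Im_rotated_Ln[OF norm_axis_direction assms(3)] l_ge unfolding abs_mult by (intro mult_mono) auto
  moreover have "\<bar>Im (Ln (K / w))\<bar> \<le> pi"
    using mpi_less_Im_Ln[of "K/w"] Im_Ln_le_pi[of "K/w"] assms(2) K_nz by auto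
  ultimately have "\<bar>2 * of_int k * pi\<bar> \<le> norm v + of_int l * (2 * pi) + pi"
    using abs_Im_le_cmod[of v] by linarith
  then show ?thesis by (simp add: abs_mult mult_ac)
qed

text \<open>The bound for the weight of a preimage with label of modulus \<open>j\<close> and norm
  at least \<open>n + 4 * l\<close>. The first entry of the maximum keeps the base positive and
  gives decay in \<open>n\<close>; the second, half of the lower bound on the norm in terms of the
  label, gives summability in \<open>j\<close>.\<close>

definition tail_term :: "real \<Rightarrow> nat \<Rightarrow> nat \<Rightarrow> real" where
  "tail_term t n j = max (real n + 1) (pi * real j - (2 * pi * of_int l + pi) / 2) powr (- t)"

lemma preimage_term_le:
  assumes t: "t > 0" and v: "preimage_label w a k v" "w \<noteq> 0" "norm v \<ge> real n + 4 * of_int l"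
  shows "norm (of_int l - v) powr (- t) \<le> tail_term t n (nat \<bar>k\<bar>)"
proof -
  have l2: "real_of_int l \<ge> 2" using l_ge by simp
  have v0: "v \<noteq> 0" using v(3) l2 by auto
  have 1: "norm (of_int l - v) \<ge> norm v - of_int l"
    using norm_triangle_ineq2[of v "of_int l"] l_ge by (simp add: norm_minus_commute)
  have "norm (of_int l - v) \<ge> real n + 1" using 1 v(3) l2 by linarith
  moreover have "norm (of_int l - v) \<ge> pi * real (nat \<bar>k\<bar>) - (2 * pi * of_int l + pi) / 2"
  proof -
    have "2 * (pi * \<bar>of_int k\<bar>) \<le> norm v + (2 * pi * of_int l + pi)"
      using preimage_label_bound[OF v(1,2) v0] by (simp add: mult.assoc)
    moreover have "norm (of_int l - v) \<ge> norm v / 2" using 1 v(3) l2 by simp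
    ultimately have "pi * \<bar>of_int k\<bar> - (2 * pi * of_int l + pi) / 2 \<le> norm (of_int l - v)"
      by (simp add: field_simps)
    then show ?thesis by simp
  qed
  ultimately show ?thesis unfolding tail_term_def using t by (intro powr_mono2') auto
qed

text \<open>Here \<open>t > 1\<close> makes the sum converge, by comparison with
  \<open>j powr (- t)\<close>; the term for \<open>n = 0\<close> then dominates all others as
  \<open>n\<close> grows.\<close>

lemma tail_term_sums:
  assumes t: "t > 1"
  shows "(\<integral>\<^sup>+j. ennreal (tail_term t n j) \<partial>count_space UNIV) < top"
    and "(\<lambda>n. \<integral>\<^sup>+j. ennreal (tail_term t n j) \<partial>count_space UNIV) \<longlonglongrightarrow> 0"
proof -
  let ?C = "(2 * pi * real_of_int l + pi) / 2"
  have le0: "tail_term t n j \<le> tail_term t 0 j" for n j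
    unfolding tail_term_def using t by (intro powr_mono2') auto
  have nonneg: "0 \<le> tail_term t n j" for n j unfolding tail_term_def by simp
  have summ: "summable (\<lambda>j. tail_term t 0 j)"
  proof (rule summable_comparison_test')
    show "summable (\<lambda>j. real j powr (- t))" using t by (simp add: summable_real_powr_iff)
    fix j assume "j \<ge> nat \<lceil>?C\<rceil> + 1"
    then have "real j \<ge> real (nat \<lceil>?C\<rceil>) + 1" by linarith
    then have j: "real j \<ge> ?C" "real j \<ge> 1" using of_nat_ceiling[of ?C] by linarith+
    have "pi * real j \<ge> 2 * real j" using pi_ge_two by (intro mult_right_mono) auto
    then have "real j \<le> max (real 0 + 1) (pi * real j - ?C)" using j by linarith
    then have "tail_term t 0 j \<le> real j powr (- t)"
      unfolding tail_term_def using t j by (intro powr_mono2') auto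
    then show "norm (tail_term t 0 j) \<le> real j powr (- t)" unfolding tail_term_def by simp
  qed
  have fin: "(\<integral>\<^sup>+j. ennreal (tail_term t 0 j) \<partial>count_space UNIV) < top"
    unfolding nn_integral_count_space_nat
    by (subst suminf_ennreal2[OF nonneg summ]) simp
  show "(\<integral>\<^sup>+j. ennreal (tail_term t n j) \<partial>count_space UNIV) < top"
    by (rule le_less_trans[OF nn_integral_mono fin]) (use le0 in \<open>auto intro: ennreal_leI\<close>)
  have "(\<lambda>n. \<integral>\<^sup>+j. ennreal (tail_term t n j) \<partial>count_space UNIV) \<longlonglongrightarrow> (\<integral>\<^sup>+j. 0 \<partial>count_space (UNIV :: nat set))"
  proof (rule nn_integral_dominated_convergence[where w = "\<lambda>j. ennreal (tail_term t 0 j)"])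
    show "AE j in count_space UNIV. (\<lambda>n. ennreal (tail_term t n j)) \<longlonglongrightarrow> 0"
    proof (rule AE_I2)
      fix j :: nat
      have "(\<lambda>n. tail_term t n j) \<longlonglongrightarrow> 0"
      proof (rule tendsto_sandwich[of "\<lambda>_. 0" _ _ "\<lambda>n. (real n + 1) powr (- t)"])
        show "(\<lambda>n. (real n + 1) powr (- t)) \<longlonglongrightarrow> 0"
          using t by (intro tendsto_neg_powr filterlim_tendsto_add_at_top[OF tendsto_const filterlim_real_sequentially,
            of 1, unfolded add.commute[of 1]]) auto
        have "tail_term t n j \<le> (real n + 1) powr (- t)" for n
          unfolding tail_term_def using t by (intro powr_mono2') auto
        then show "\<forall>\<^sub>F n in sequentially. tail_term t n j \<le> (real n + 1) powr (- t)" by simp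
      qed (auto simp: tail_term_def)
      then show "(\<lambda>n. ennreal (tail_term t n j)) \<longlonglongrightarrow> 0" using tendsto_ennrealI by fastforce
    qed
    show "(\<integral>\<^sup>+j. ennreal (tail_term t 0 j) \<partial>count_space UNIV) < \<infinity>" using fin by simp
    show "\<And>n. AE j in count_space UNIV. ennreal (tail_term t n j) \<le> ennreal (tail_term t 0 j)"
      using le0 by (auto intro: ennreal_leI)
  qed auto
  then show "(\<lambda>n. \<integral>\<^sup>+j. ennreal (tail_term t n j) \<partial>count_space UNIV) \<longlonglongrightarrow> 0" by simp
qed

text \<open>Preimages are mapped injectively to their labels, and a modulus \<open>j\<close> is
  shared by at most 8 labels: four half-planes and two signs.\<close>

lemma preimage_sum_tail:
  assumes t: "t > 1" and w: "w \<noteq> 0"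
  shows "(\<integral>\<^sup>+v. ennreal (norm (of_int l - v) powr (- t)) \<partial>count_space {v. g v = w \<and> norm v \<ge> real n + 4 * of_int l})
     \<le> 8 * (\<integral>\<^sup>+j. ennreal (tail_term t n j) \<partial>count_space UNIV)"
proof -
  define Z where "Z = {v. g v = w \<and> norm v \<ge> real n + 4 * of_int l}"
  have "\<exists>a k. preimage_label w a k v" if "v \<in> Z" for v
    using that w by (intro preimage_label_exists) (auto simp: Z_def)
  then obtain A k where Ak: "\<And>v. v \<in> Z \<Longrightarrow> preimage_label w (A v) (k v) v" by metis
  define lab where "lab v = ((A v, k v \<ge> 0), nat \<bar>k v\<bar>)" for v
  have inj: "inj_on lab Z"
  proof (rule inj_onI)
    fix v v' assume vv: "v \<in> Z" "v' \<in> Z" "lab v = lab v'"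
    then have "A v = A v'" "k v = k v'" unfolding lab_def by auto
    then show "v = v'" using preimage_label_unique Ak vv by metis
  qed
  let ?b = "\<lambda>x :: ((bool \<times> bool) \<times> bool) \<times> nat. ennreal (tail_term t n (snd x))"
  have "(\<integral>\<^sup>+v. ennreal (norm (of_int l - v) powr (- t)) \<partial>count_space Z) \<le> (\<integral>\<^sup>+v. ?b (lab v) \<partial>count_space Z)"
  proof (rule nn_integral_mono)
    fix v assume "v \<in> space (count_space Z)"
    then have v: "v \<in> Z" by simp
    show "ennreal (norm (of_int l - v) powr (- t)) \<le> ?b (lab v)"
      unfolding lab_def snd_conv
      by (intro ennreal_leI preimage_term_le[OF _ Ak[OF v] w]) (use t v in \<open>auto simp: Z_def\<close>)
  qed
  also have "\<dots> = (\<integral>\<^sup>+x. ?b x \<partial>count_space (lab ` Z))"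
    by (rule nn_integral_bij_count_space) (use inj in \<open>auto simp: bij_betw_def\<close>)
  also have "\<dots> \<le> (\<integral>\<^sup>+x. ?b x \<partial>count_space UNIV)"
  proof -
    have "(\<integral>\<^sup>+x. ?b x \<partial>count_space (lab ` Z)) = (\<integral>\<^sup>+x. ?b x * indicator (lab ` Z) x \<partial>count_space UNIV)"
      by (simp add: nn_integral_count_space_indicator)
    also have "\<dots> \<le> (\<integral>\<^sup>+x. ?b x \<partial>count_space UNIV)"
      by (rule nn_integral_mono) (simp split: split_indicator)
    finally show ?thesis .
  qed
  also have "\<dots> = (\<integral>\<^sup>+a. \<integral>\<^sup>+j. ?b (a, j) \<partial>count_space UNIV \<partial>count_space UNIV)"
    by (rule nn_integral_fst_count_space[symmetric])
  also have "\<dots> = 8 * (\<integral>\<^sup>+j. ennreal (tail_term t n j) \<partial>count_space UNIV)"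
    by (simp add: mult.commute card_UNIV_bool)
  finally show ?thesis unfolding Z_def .
qed

section \<open>Uniform bounds for the transfer operator on \<open>X\<close>\<close>

lemma g_locally_injective:
  assumes "v \<noteq> 0" "v \<noteq> of_int l"
  obtains r where "r > 0" "inj_on g (ball v r)"
proof -
  have "deriv g v = g v * (of_int l - v) / v"
    by (rule DERIV_imp_deriv[OF g_has_derivative[OF assms(1)]])
  then have "deriv g v \<noteq> 0" using assms g_eq_0_iff by auto
  from has_complex_derivative_locally_injective[OF g_holomorphic UNIV_I open_UNIV this]
  show ?thesis using that by metis
qed

lemma X_dist_critical: "\<exists>\<delta>>0. \<forall>v\<in>X. norm (of_int l - v) \<ge> \<delta>"
proof -
  obtain \<delta> where "\<delta> > 0" "ball (of_int l) \<delta> \<subseteq> - X"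
    using critical_point_notin_X X_closed by (metis ComplI open_Compl open_contains_ball)
  moreover have "\<delta> \<le> norm (of_int l - v)" if "v \<in> X" for v
  proof (rule ccontr)
    assume "\<not> \<delta> \<le> norm (of_int l - v)"
    then have "v \<in> ball (of_int l) \<delta>" by (simp add: dist_norm)
    then show False using that \<open>ball (of_int l) \<delta> \<subseteq> - X\<close> by blast
  qed
  ultimately show ?thesis by blast
qed

text \<open>Finitely many balls on which \<open>g\<close> is injective cover the compact set
  \<open>X \<inter> cball 0 R\<close>, and each contains at most one preimage of
  \<open>w\<close>.\<close>

lemma card_preimages_bounded:
  "\<exists>N. \<forall>w. finite {v\<in>X. norm v \<le> R \<and> g v = w} \<and> card {v\<in>X. norm v \<le> R \<and> g v = w} \<le> N"
proof -
  have "\<exists>r>0. inj_on g (ball v r)" if "v \<in> X" for v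
    using g_locally_injective[of v] X_nz[OF that] critical_point_notin_X that by metis
  then obtain r where r: "\<And>v. v \<in> X \<Longrightarrow> r v > 0" "\<And>v. v \<in> X \<Longrightarrow> inj_on g (ball v (r v))" by metis
  have "compact (X \<inter> cball 0 R)" using X_closed by (simp add: closed_Int_compact)
  moreover have "X \<inter> cball 0 R \<subseteq> (\<Union>v\<in>X. ball v (r v))" using r(1) by force
  ultimately obtain F where F: "F \<subseteq> X" "finite F" "X \<inter> cball 0 R \<subseteq> (\<Union>v\<in>F. ball v (r v))"
    using compactE_image[of "X \<inter> cball 0 R" X "\<lambda>v. ball v (r v)"] by (metis open_ball)
  have "finite {v\<in>X. norm v \<le> R \<and> g v = w} \<and> card {v\<in>X. norm v \<le> R \<and> g v = w} \<le> card F" for w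
  proof -
    let ?P = "{v\<in>X. norm v \<le> R \<and> g v = w}"
    have "\<exists>u\<in>F. v \<in> ball u (r u)" if "v \<in> ?P" for v using that F(3) by (auto simp: subset_iff)
    then obtain c where c: "\<And>v. v \<in> ?P \<Longrightarrow> c v \<in> F \<and> v \<in> ball (c v) (r (c v))" by metis
    have i1: "inj_on c ?P"
    proof (rule inj_onI)
      fix a b assume ab: "a \<in> ?P" "b \<in> ?P" "c a = c b"
      have "a \<in> ball (c a) (r (c a))" "b \<in> ball (c a) (r (c a))" "c a \<in> X"
        using c[OF ab(1)] c[OF ab(2)] ab(3) F(1) by auto
      then show "a = b" using r(2)[of "c a"] ab(1,2) by (auto dest: inj_onD)
    qed
    have i2: "c ` ?P \<subseteq> F" using c by blast
    show ?thesis using inj_on_finite[OF i1 i2 F(2)] card_inj_on_le[OF i1 i2 F(2)] by (rule conjI)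
  qed
  then show ?thesis by blast
qed

text \<open>The geometric potential \<open>|F'| powr (- t)\<close> in the coordinate
  \<open>v = exp z\<close>.\<close>

abbreviation weight :: "real \<Rightarrow> complex \<Rightarrow> ennreal" where
  "weight t v \<equiv> ennreal (norm (of_int l - v) powr (- t))"

lemma transfer_tail:
  assumes t: "t > 1" and w: "w \<in> X"
  shows "transfer_op X g (weight t) (indicator {v. norm v \<ge> real n + 4 * of_int l}) w
    \<le> 8 * (\<integral>\<^sup>+j. ennreal (tail_term t n j) \<partial>count_space UNIV)"
proof -
  have "transfer_op X g (weight t) (indicator {v. norm v \<ge> real n + 4 * of_int l}) w
     \<le> (\<integral>\<^sup>+v. weight t v \<partial>count_space {v. g v = w \<and> norm v \<ge> real n + 4 * of_int l})"
    unfolding transfer_op_def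
    by (subst (1 2) nn_integral_count_space_indicator) (auto intro!: nn_integral_mono simp: indicator_def)
  also have "\<dots> \<le> 8 * (\<integral>\<^sup>+j. ennreal (tail_term t n j) \<partial>count_space UNIV)"
    by (rule preimage_sum_tail[OF t X_nz[OF w]])
  finally show ?thesis .
qed

text \<open>Far preimages are covered by the tail estimate with \<open>n = 0\<close>; the near ones
  are bounded in number, and the distance to the critical point bounds the weight of each.\<close>

lemma transfer_one_bounded:
  assumes t: "t > 1"
  shows "\<exists>C\<ge>0. \<forall>w\<in>X. transfer_op X g (weight t) (\<lambda>_. 1) w \<le> ennreal C"
proof -
  define R where "R = 4 * real_of_int l"
  obtain \<delta> where \<delta>: "\<delta> > 0" "\<And>v. v \<in> X \<Longrightarrow> norm (of_int l - v) \<ge> \<delta>" using X_dist_critical by blast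
  obtain N where N: "\<And>w. finite {v\<in>X. norm v \<le> R \<and> g v = w}" "\<And>w. card {v\<in>X. norm v \<le> R \<and> g v = w} \<le> N"
    using card_preimages_bounded[of R] by blast
  define E where "E = 8 * (\<integral>\<^sup>+j. ennreal (tail_term t 0 j) \<partial>count_space UNIV)"
  have E: "E < top" unfolding E_def using tail_term_sums(1)[OF t, of 0] by (simp add: ennreal_mult_less_top)
  define C where "C = real N * \<delta> powr (- t) + enn2real E"
  have "transfer_op X g (weight t) (\<lambda>_. 1) w \<le> ennreal C" if w: "w \<in> X" for w
  proof -
    let ?P = "{v\<in>X. g v = w}" and ?Q = "{v\<in>X. norm v \<le> R \<and> g v = w}"
    have "transfer_op X g (weight t) (\<lambda>_. 1) w = (\<integral>\<^sup>+v. weight t v \<partial>count_space ?P)"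
      unfolding transfer_op_def by simp
    also have "\<dots> \<le> (\<integral>\<^sup>+v. weight t v * indicator ?Q v + weight t v * indicator {v. norm v \<ge> real 0 + 4 * of_int l} v \<partial>count_space ?P)"
      by (intro nn_integral_mono) (auto simp: indicator_def R_def)
    also have "\<dots> = (\<integral>\<^sup>+v. weight t v * indicator ?Q v \<partial>count_space ?P) + transfer_op X g (weight t) (indicator {v. norm v \<ge> real 0 + 4 * of_int l}) w"
      unfolding transfer_op_def by (rule nn_integral_add) auto
    also have "\<dots> \<le> ennreal (real N * \<delta> powr (- t)) + E"
    proof (rule add_mono)
      have "(\<integral>\<^sup>+v. weight t v * indicator ?Q v \<partial>count_space ?P) \<le> (\<integral>\<^sup>+v. weight t v \<partial>count_space ?Q)"
        by (subst (1 2) nn_integral_count_space_indicator) (auto intro!: nn_integral_mono simp: indicator_def)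
      also have "\<dots> \<le> (\<integral>\<^sup>+v. ennreal (\<delta> powr (- t)) \<partial>count_space ?Q)"
        by (intro nn_integral_mono ennreal_leI powr_mono2') (use t \<delta> in auto)
      also have "\<dots> = ennreal (\<delta> powr (- t)) * of_nat (card ?Q)" using N(1) by simp
      also have "\<dots> \<le> ennreal (\<delta> powr (- t)) * of_nat N" using N(2) by (intro mult_left_mono) auto
      also have "\<dots> = ennreal (real N * \<delta> powr (- t))"
        by (simp add: ennreal_of_nat_eq_real_of_nat ennreal_mult mult.commute)
      finally show "(\<integral>\<^sup>+v. weight t v * indicator ?Q v \<partial>count_space ?P) \<le> ennreal (real N * \<delta> powr (- t))" .
      show "transfer_op X g (weight t) (indicator {v. norm v \<ge> real 0 + 4 * of_int l}) w \<le> E"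
        unfolding E_def by (rule transfer_tail[OF t w])
    qed
    also have "\<dots> = ennreal C" unfolding C_def using E by (simp add: ennreal_plus)
    finally show ?thesis .
  qed
  moreover have "C \<ge> 0" unfolding C_def by simp
  ultimately show ?thesis by blast
qed

lemma transfer_lower_bound:
  assumes t: "t > 1"
  obtains X0 \<eta> where "X0 \<subseteq> X" "X0 \<noteq> {}" "\<eta> > 0"
    "\<And>x. x \<in> X0 \<Longrightarrow> transfer_op X g (weight t) (indicator X0) x \<ge> ennreal \<eta>"
proof -
  obtain R where R: "\<exists>x\<in>X. norm x \<le> R" "\<And>w. w \<in> X \<Longrightarrow> norm w \<le> R \<Longrightarrow> \<exists>v\<in>X. g v = w \<and> norm v \<le> R"
    using X_bounded_preimages by metis
  have R0: "R \<ge> 0" using R(1) norm_ge_zero order_trans by blast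
  have l2: "real_of_int l \<ge> 2" using l_ge by simp
  define X0 where "X0 = X \<inter> cball 0 R"
  show ?thesis
  proof (rule that[of X0 "(R + of_int l) powr (- t)"])
    show "X0 \<subseteq> X" "X0 \<noteq> {}" using R(1) unfolding X0_def by auto
    show "0 < (R + of_int l) powr (- t)" using R0 l2 by simp
    fix x assume "x \<in> X0"
    then obtain v where v: "v \<in> X" "g v = x" "norm v \<le> R" using R(2)[of x] unfolding X0_def by auto
    have "norm (of_int l - v) \<le> R + of_int l"
      using norm_triangle_ineq4[of "of_int l :: complex" v] v(3) l2 by simp
    moreover have "norm (of_int l - v) > 0" using critical_point_notin_X v(1) by auto
    ultimately have "(R + of_int l) powr (- t) \<le> norm (of_int l - v) powr (- t)"
      using t by (intro powr_mono2') auto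
    then have "ennreal ((R + of_int l) powr (- t)) \<le> weight t v * indicator X0 v"
      using v unfolding X0_def by (auto intro: ennreal_leI)
    also have "\<dots> \<le> transfer_op X g (weight t) (indicator X0) x"
      unfolding transfer_op_def by (rule nn_integral_ge_point) (use v in auto)
    finally show "transfer_op X g (weight t) (indicator X0) x \<ge> ennreal ((R + of_int l) powr (- t))" .
  qed
qed

end

section \<open>Existence of an eigenmeasure\<close>

lemma fatou_set_open: "open (fatou_set h)"
proof -
  have "fatou_set h = \<Union>{S. open S \<and> connected S \<and> normal_family_on S (range (\<lambda>n. h ^^ n))}"
    unfolding fatou_set_def by blast
  then show ?thesis by auto
qed

lemma julia_set_closed: "closed (julia_set h)"
  unfolding julia_set_def using fatou_set_open by (simp add: closed_Compl)

lemma fatou_set_backward_invariant: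
  fixes h :: "complex \<Rightarrow> complex"
  assumes cont: "continuous_on UNIV h" and hz: "h z \<in> fatou_set h"
  shows "z \<in> fatou_set h"
proof -
  obtain S where S: "open S" "connected S" "h z \<in> S" "normal_family_on S (range (\<lambda>n. h ^^ n))"
    using hz unfolding fatou_set_def by blast
  have "open (h -` S)" using cont S(1) by (simp add: continuous_on_open_vimage)
  then obtain d where d: "d > 0" "ball z d \<subseteq> h -` S" using S(3) open_contains_ball by (metis vimageI)
  have "normal_family_on (ball z d) (range (\<lambda>n. h ^^ n))"
    unfolding normal_family_on_def
  proof (intro allI impI)
    fix H :: "nat \<Rightarrow> complex \<Rightarrow> complex" assume "range H \<subseteq> range (\<lambda>n. h ^^ n)"
    then have "\<forall>n. \<exists>k. H n = h ^^ k" by blast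
    then obtain k where k: "\<And>n. H n = h ^^ k n" by metis
    let ?P = "\<lambda>r::nat\<Rightarrow>nat. strict_mono r \<and>
         ((\<exists>G. \<forall>K. compact K \<and> K \<subseteq> ball z d \<longrightarrow> uniform_limit K (H \<circ> r) G sequentially) \<or>
          (\<forall>K. compact K \<and> K \<subseteq> ball z d \<longrightarrow>
             (\<forall>B. eventually (\<lambda>n. \<forall>z\<in>K. B < cmod (H (r n) z)) sequentially)))"
    \<comment> \<open>One application of \<open>h\<close> is split off each iterate and normality is
      used on \<open>S\<close>. The identity admits no such splitting: if it occurs infinitely often
      it is itself a convergent subsequence, otherwise finitely many terms are dropped.\<close>
    show "\<exists>r. ?P r"
    proof (cases "infinite {n. k n = 0}")
      case True
      then obtain r :: "nat \<Rightarrow> nat" where r: "strict_mono r" "\<And>n. r n \<in> {n. k n = 0}"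
        using infinite_enumerate[OF True] by blast
      have "H \<circ> r = (\<lambda>n x. x)" using r(2) k by (auto simp: fun_eq_iff)
      then have "uniform_limit K (H \<circ> r) (\<lambda>x. x) sequentially" for K
        by (simp add: uniform_limit_iff)
      then have "?P r" using r(1) by blast
      then show ?thesis by blast
    next
      case False
      then have "\<exists>m. \<forall>n\<in>{n. k n = 0}. n < m" unfolding not_not finite_nat_set_iff_bounded .
      then obtain n0 where n0: "\<And>n. k n = 0 \<Longrightarrow> n < n0" by blast
      define H' where "H' n = h ^^ (k (n + n0) - 1)" for n
      have HH: "H (n + n0) x = H' n (h x)" for n x
      proof -
        have "k (n + n0) \<noteq> 0" using n0[of "n + n0"] by auto
        then have "k (n + n0) = Suc (k (n + n0) - 1)" by simp
        then have "h ^^ k (n + n0) = (h ^^ (k (n + n0) - 1)) \<circ> h" by (metis funpow_Suc_right)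
        then show ?thesis unfolding k H'_def by simp
      qed
      have rng: "range H' \<subseteq> range (\<lambda>n. h ^^ n)" unfolding H'_def by blast
      then obtain r :: "nat \<Rightarrow> nat" where r: "strict_mono r" and
        cs: "(\<exists>G. \<forall>K. compact K \<and> K \<subseteq> S \<longrightarrow> uniform_limit K (H' \<circ> r) G sequentially) \<or>
          (\<forall>K. compact K \<and> K \<subseteq> S \<longrightarrow> (\<forall>B. eventually (\<lambda>n. \<forall>z\<in>K. B < cmod (H' (r n) z)) sequentially))"
        using S(4) unfolding normal_family_on_def by blast
      define r' where "r' n = r n + n0" for n
      have r': "strict_mono r'" using r unfolding r'_def strict_mono_def by simp
      have img: "compact (h ` K) \<and> h ` K \<subseteq> S" if "compact K \<and> K \<subseteq> ball z d" for K
        using that d(2) compact_continuous_image[OF continuous_on_subset[OF cont]] by blast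
      from cs have "?P r'"
      proof
        assume "\<exists>G. \<forall>K. compact K \<and> K \<subseteq> S \<longrightarrow> uniform_limit K (H' \<circ> r) G sequentially"
        then obtain G where G: "\<And>K. compact K \<and> K \<subseteq> S \<Longrightarrow> uniform_limit K (H' \<circ> r) G sequentially" by blast
        have "uniform_limit K (H \<circ> r') (\<lambda>x. G (h x)) sequentially" if "compact K \<and> K \<subseteq> ball z d" for K
          using G[OF img[OF that]] unfolding uniform_limit_iff r'_def by (simp add: HH)
        then show ?thesis using r' by blast
      next
        assume inf: "\<forall>K. compact K \<and> K \<subseteq> S \<longrightarrow> (\<forall>B. eventually (\<lambda>n. \<forall>z\<in>K. B < cmod (H' (r n) z)) sequentially)"
        have "eventually (\<lambda>n. \<forall>z\<in>K. B < cmod (H (r' n) z)) sequentially" if "compact K \<and> K \<subseteq> ball z d" for K B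
          using inf[rule_format, OF img[OF that], of B] unfolding r'_def by (simp add: HH)
        then show ?thesis using r' by blast
      qed
      then show ?thesis by blast
    qed
  qed
  then show ?thesis unfolding fatou_set_def using d(1) by (auto intro!: exI[of _ "ball z d"])
qed

context cyl_map
begin

lemma f_julia: "z \<in> julia_set f \<Longrightarrow> f z \<in> julia_set f"
  unfolding julia_set_def using fatou_set_backward_invariant[OF f_continuous] by blast

end

section \<open>Passing to the limit measure\<close>

lemma finite_measure_tight:
  fixes M :: "'a::real_normed_vector measure"
  assumes "finite_measure M" "sets M = sets borel" "\<epsilon> > 0"
  shows "\<exists>R. measure M {v. R < norm v} \<le> \<epsilon>"
proof -
  interpret finite_measure M by fact
  let ?A = "\<lambda>k::nat. {v::'a. real k < norm v}"
  have o: "open (?A k)" for k by (intro open_Collect_less continuous_intros)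
  have "(\<lambda>k. measure M (?A k)) \<longlonglongrightarrow> measure M (\<Inter>k. ?A k)"
  proof (rule finite_Lim_measure_decseq)
    show "range ?A \<subseteq> sets M" unfolding assms(2) using o by auto
    show "decseq ?A" unfolding decseq_def by force
  qed
  moreover have "(\<Inter>k. ?A k) = {}"
  proof -
    have "v \<notin> (\<Inter>k. ?A k)" for v :: 'a
    proof -
      obtain k :: nat where "norm v \<le> real k" using real_arch_simple by blast
      then have "v \<notin> ?A k" by simp
      then show ?thesis by blast
    qed
    then show ?thesis by blast
  qed
  ultimately have "(\<lambda>k. measure M (?A k)) \<longlonglongrightarrow> 0" by simp
  then have "eventually (\<lambda>k. measure M (?A k) < \<epsilon>) sequentially" using assms(3) by (rule order_tendstoD)
  then obtain k where "measure M (?A k) < \<epsilon>" using eventually_happens'[OF sequentially_bot] by blast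
  then show ?thesis by (intro exI[of _ "real k"]) simp
qed

text \<open>The axiom \<open>eig\<close> is the dual eigenvalue equation, restricted to bounded
  continuous \<open>\<phi>\<close> whose transform agrees on \<open>X\<close> with a bounded
  continuous function on the plane. This is the form that survives weak limits.\<close>

locale cyl_eigenmeasure = cyl_map +
  fixes t r :: real and \<mu> :: "complex measure"
  assumes t_gt: "t > 1" and r_pos: "r > 0" and prob_mu: "prob_space \<mu>" and sets_mu: "sets \<mu> = sets borel"
    and null_mu: "emeasure \<mu> (- X) = 0"
    and eig: "\<And>\<phi> h B. \<lbrakk>continuous_on UNIV \<phi>; continuous_on UNIV h; \<And>v. 0 \<le> \<phi> v \<and> \<phi> v \<le> B; \<And>v. 0 \<le> h v \<and> h v \<le> B;
       \<And>v. v \<in> X \<Longrightarrow> transfer_op X g (weight t) (\<lambda>u. ennreal (\<phi> u)) v = ennreal (h v)\<rbrakk> \<Longrightarrow>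
       integral\<^sup>L \<mu> h = r * integral\<^sup>L \<mu> \<phi>"

context cyl_map
begin

lemma X_borel: "X \<in> sets borel" using X_closed by simp

lemma transfer_eigenmeasure:
  assumes t: "t > 1"
  shows "\<exists>r \<mu>. cyl_eigenmeasure l c t r \<mu>"
proof -
  let ?R = "resolvent X g (weight t)"
  obtain C where C: "C \<ge> 0" "\<And>w. w \<in> X \<Longrightarrow> transfer_op X g (weight t) (\<lambda>_. 1) w \<le> ennreal C"
    using transfer_one_bounded[OF t] by blast
  obtain X0 \<eta> where X0: "X0 \<subseteq> X" "X0 \<noteq> {}" "\<eta> > 0"
    "\<And>x. x \<in> X0 \<Longrightarrow> transfer_op X g (weight t) (indicator X0) x \<ge> ennreal \<eta>"
    using transfer_lower_bound[OF t] by metis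
  obtain r s x where r: "r > 0" "s \<longlonglongrightarrow> r" "\<And>n::nat. s n \<ge> r" "\<And>n. x n \<in> X"
    "\<And>n. ?R (s n) (\<lambda>_. 1) (x n) < top" "\<And>n. ?R (s n) (\<lambda>_. 1) (x n) \<ge> of_nat n"
  proof (rule resolvent_critical_parameter[OF C(2,1) X0])
  qed (assumption | rule that)+
  have s0: "s n > 0" for n using r(1) r(3)[of n] by linarith
  define M where "M n = resolvent_measure X g (weight t) (s n) (x n)" for n
  define N where "N n = enn2real (?R (s n) (\<lambda>_. 1) (x n))" for n
  have NR: "?R (s n) (\<lambda>_. 1) (x n) = ennreal (N n)" for n
    unfolding N_def by (rule ennreal_enn2real[OF r(5), symmetric])
  have Nn: "N n \<ge> real n" for n
  proof -
    have "N n \<ge> 0" unfolding N_def by (rule enn2real_nonneg)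
    then show ?thesis
      using r(6)[of n] unfolding NR ennreal_of_nat_eq_real_of_nat by (subst (asm) ennreal_le_iff)
  qed
  have N1: "N n \<ge> 1" for n
  proof -
    have "(1::ennreal) \<le> ?R (s n) (\<lambda>_. 1) (x n)" by (subst resolvent_split_head[OF s0]) simp
    then have "ennreal 1 \<le> ennreal (N n)" unfolding NR by simp
    moreover have "N n \<ge> 0" unfolding N_def by (rule enn2real_nonneg)
    ultimately show ?thesis by (subst (asm) ennreal_le_iff)
  qed
  have prob: "prob_space (M n)" for n
    unfolding M_def by (rule resolvent_measure_properties[OF s0 r(4) r(5) X_borel])
  have null: "emeasure (M n) (- X) = 0" for n
    unfolding M_def by (rule resolvent_measure_properties[OF s0 r(4) r(5) X_borel])
  have sets: "sets (M n) = sets borel" for n unfolding M_def by simp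
  have invN: "(\<lambda>n. 1 / N n) \<longlonglongrightarrow> 0"
  proof (rule tendsto_sandwich[of "\<lambda>_. 0" _ _ "\<lambda>n. 1 / real n"])
    show "\<forall>\<^sub>F n in sequentially. 1 / N n \<le> 1 / real n"
      using eventually_gt_at_top[of 0]
    proof eventually_elim
      case (elim n)
      then show ?case using Nn[of n] by (intro divide_left_mono) auto
    qed
    show "\<forall>\<^sub>F n in sequentially. 0 \<le> 1 / N n" using N1 by (auto intro!: always_eventually simp: order_trans[OF zero_le_one])
  qed (auto intro: lim_1_over_n)
  have tight: "\<exists>R. \<forall>n. measure (M n) {v. R < norm v} \<le> \<epsilon>" if \<epsilon>: "\<epsilon> > 0" for \<epsilon>
  proof -
    \<comment> \<open>The radius \<open>D\<close> makes the transferred tail at most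
      \<open>r * \<epsilon> / 2\<close>. As \<open>s n \<ge> r\<close>, this costs at most
      \<open>\<epsilon> / 2\<close> of mass, and \<open>1 / N n\<close> is below the other half from
      \<open>n0\<close> on. The finitely many earlier measures are tight one by one.\<close>
    let ?e = "\<lambda>n. 8 * (\<integral>\<^sup>+j. ennreal (tail_term t n j) \<partial>count_space UNIV)"
    have "?e \<longlonglongrightarrow> 8 * 0" by (intro ennreal_tendsto_cmult tail_term_sums(2)[OF t]) simp
    then have "eventually (\<lambda>n. ?e n < ennreal (r * \<epsilon> / 2)) sequentially"
      using r(1) \<epsilon> by (intro order_tendstoD) auto
    then obtain k where k: "?e k < ennreal (r * \<epsilon> / 2)" using eventually_happens'[OF sequentially_bot] by blast
    define D where "D = real k + 4 * of_int l"
    have "eventually (\<lambda>n. 1 / N n < \<epsilon> / 2) sequentially" using \<epsilon> by (intro order_tendstoD[OF invN]) auto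
    then obtain n0 where n0: "\<And>n. n \<ge> n0 \<Longrightarrow> 1 / N n < \<epsilon> / 2" unfolding eventually_sequentially by blast
    have big: "measure (M n) {v. D < norm v} \<le> \<epsilon>" if n: "n \<ge> n0" for n
    proof -
      interpret Mn: prob_space "M n" by (rule prob)
      have A: "{v::complex. D \<le> norm v} \<in> sets borel" by (simp add: closed_Collect_le continuous_on_norm continuous_on_id)
      have "emeasure (M n) {v. D < norm v} \<le> emeasure (M n) {v. D \<le> norm v}"
        using A by (intro emeasure_mono) (auto simp: sets)
      also have "\<dots> \<le> 1 / ?R (s n) (\<lambda>_. 1) (x n) + ennreal (1 / s n) * ennreal (r * \<epsilon> / 2)"
        unfolding M_def
        by (rule emeasure_resolvent_measure_tail[OF s0 r(4) r(5) A])
           (use transfer_tail[OF t, of _ k] k in \<open>auto simp: D_def intro: order_trans less_imp_le\<close>)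
      also have "1 / ?R (s n) (\<lambda>_. 1) (x n) = ennreal (1 / N n)"
        unfolding NR using N1[of n] divide_ennreal[of 1 "N n"] by simp
      also have "ennreal (1 / s n) * ennreal (r * \<epsilon> / 2) = ennreal (r / s n * (\<epsilon> / 2))"
        using s0[of n] r(1) \<epsilon> by (subst ennreal_mult[symmetric]) auto
      also have "ennreal (1 / N n) + ennreal (r / s n * (\<epsilon> / 2)) = ennreal (1 / N n + r / s n * (\<epsilon> / 2))"
        using N1[of n] s0[of n] r(1) \<epsilon> by (intro ennreal_plus[symmetric]) auto
      also have "\<dots> \<le> ennreal \<epsilon>"
      proof (rule ennreal_leI)
        have "r / s n \<le> 1" using r(3)[of n] s0[of n] by simp
        then have "r / s n * (\<epsilon> / 2) \<le> 1 * (\<epsilon> / 2)" using \<epsilon> by (intro mult_right_mono) auto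
        then show "1 / N n + r / s n * (\<epsilon> / 2) \<le> \<epsilon>" using n0[OF n] by linarith
      qed
      finally show ?thesis unfolding Mn.emeasure_eq_measure using \<epsilon> by (subst (asm) ennreal_le_iff) auto
    qed
    have "\<exists>R. measure (M n) {v. R < norm v} \<le> \<epsilon>" for n
      by (rule finite_measure_tight[OF _ sets \<epsilon>]) (rule prob_space.finite_measure[OF prob])
    then obtain RR where RR: "\<And>n. measure (M n) {v. RR n < norm v} \<le> \<epsilon>" by metis
    define R where "R = Max (insert D (RR ` {..<n0}))"
    have "measure (M n) {v. R < norm v} \<le> \<epsilon>" for n
    proof -
      interpret Mn: prob_space "M n" by (rule prob)
      obtain R' where R': "R' \<le> R" "measure (M n) {v. R' < norm v} \<le> \<epsilon>"
      proof (cases "n < n0")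
        case True
        then have "RR n \<le> R" unfolding R_def by (intro Max_ge) auto
        then show ?thesis using RR that by blast
      next
        case False
        have "D \<le> R" unfolding R_def by (intro Max_ge) auto
        then show ?thesis using big[of n] False that by (simp add: not_less)
      qed
      have "{v::complex. R' < norm v} \<in> sets (M n)" unfolding sets
        by (intro borel_open open_Collect_less continuous_intros)
      then have "measure (M n) {v. R < norm v} \<le> measure (M n) {v. R' < norm v}"
        using R'(1) by (intro Mn.finite_measure_mono) auto
      then show ?thesis using R'(2) by linarith
    qed
    then show ?thesis by blast
  qed
  obtain d \<mu> where \<mu>: "strict_mono (d::nat\<Rightarrow>nat)" "prob_space \<mu>" "sets \<mu> = sets borel"
    "\<And>\<phi> B. continuous_on UNIV (\<phi>::complex\<Rightarrow>real) \<Longrightarrow> (\<And>v. \<bar>\<phi> v\<bar> \<le> B) \<Longrightarrow>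
       (\<lambda>n. integral\<^sup>L (M (d n)) \<phi>) \<longlonglongrightarrow> integral\<^sup>L \<mu> \<phi>"
  proof (rule tight_imp_weakly_convergent_subsequence_complex[of M, OF prob sets tight])
    fix d \<mu>
    assume 1: "strict_mono (d::nat\<Rightarrow>nat)" "prob_space \<mu>" "sets \<mu> = sets borel"
      and 2: "\<And>\<phi> B. continuous_on UNIV (\<phi>::complex\<Rightarrow>real) \<Longrightarrow> (\<And>v. \<bar>\<phi> v\<bar> \<le> B) \<Longrightarrow>
       (\<lambda>n. integral\<^sup>L (M (d n)) \<phi>) \<longlonglongrightarrow> integral\<^sup>L \<mu> \<phi>"
    show thesis by (rule that[OF 1 2])
  qed
  interpret \<mu>: prob_space \<mu> by (rule \<mu>(2))
  have int: "integrable Q \<phi>" if "prob_space Q" "sets Q = sets borel" "continuous_on UNIV \<phi>" "\<And>v. 0 \<le> \<phi> v \<and> \<phi> v \<le> B"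
    for Q and \<phi> :: "complex \<Rightarrow> real" and B
  proof -
    interpret Q: prob_space Q by fact
    have "\<phi> \<in> borel_measurable Q"
      using borel_measurable_continuous_onI[OF that(3)] measurable_cong_sets[OF that(2) refl] by blast
    then show ?thesis using that(4) by (intro Q.integrable_const_bound[of _ B]) auto
  qed
  show ?thesis
  proof (intro exI cyl_eigenmeasure.intro cyl_map_axioms cyl_eigenmeasure_axioms.intro)
    show "t > 1" "r > 0" "prob_space \<mu>" "sets \<mu> = sets borel" by (fact t r(1) \<mu>(2,3))+
    \<comment> \<open>A bounded continuous function vanishing exactly on the closed set
      \<open>X\<close>; its integrals are 0 along the sequence, hence also in the limit.\<close>
    define \<phi> where "\<phi> v = min 1 (infdist v X)" for v
    have c: "continuous_on UNIV \<phi>" unfolding \<phi>_def by (intro continuous_intros)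
    have b: "0 \<le> \<phi> v \<and> \<phi> v \<le> 1" for v unfolding \<phi>_def by (simp add: infdist_nonneg)
    have "integral\<^sup>L (M n) \<phi> = 0" for n
    proof -
      have "AE v in M n. v \<notin> - X" using null[of n] X_borel sets[of n] by (intro AE_not_in) (auto simp: null_sets_def)
      then have "AE v in M n. \<phi> v = 0" by eventually_elim (simp add: \<phi>_def)
      then show ?thesis by (rule integral_eq_zero_AE)
    qed
    moreover have "(\<lambda>n. integral\<^sup>L (M (d n)) \<phi>) \<longlonglongrightarrow> integral\<^sup>L \<mu> \<phi>"
      using b by (intro \<mu>(4)[OF c, of 1]) (simp add: abs_le_iff)
    ultimately have "integral\<^sup>L \<mu> \<phi> = 0" by (simp add: LIMSEQ_const_iff)
    then have "AE v in \<mu>. \<phi> v = 0"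
      using integral_nonneg_eq_0_iff_AE[OF int[OF \<mu>(2,3) c b]] b by auto
    then have "AE v in \<mu>. v \<in> X"
      by eventually_elim (use X_nonempty X_closed in \<open>auto simp: \<phi>_def min_def in_closed_iff_infdist_zero split: if_splits\<close>)
    then show "emeasure \<mu> (- X) = 0"
      using X_borel \<mu>(3) sets_eq_imp_space_eq[OF \<mu>(3)] by (subst (asm) AE_iff_measurable[of "- X"]) auto
  next
    fix \<phi> h :: "complex \<Rightarrow> real" and B
    assume \<phi>: "continuous_on UNIV \<phi>" and h: "continuous_on UNIV h"
      and \<phi>B: "\<And>v. 0 \<le> \<phi> v \<and> \<phi> v \<le> B" and hB: "\<And>v. 0 \<le> h v \<and> h v \<le> B"
      and eq: "\<And>v. v \<in> X \<Longrightarrow> transfer_op X g (weight t) (\<lambda>u. ennreal (\<phi> u)) v = ennreal (h v)"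
    have B0: "B \<ge> 0" using \<phi>B[of 0] by linarith
    \<comment> \<open>Exact for each \<open>n\<close>; the first summand is bounded by
      \<open>B / N n\<close> and disappears in the limit, while \<open>s n\<close> tends to
      \<open>r\<close>.\<close>
    have rel: "integral\<^sup>L (M n) \<phi> = \<phi> (x n) / N n + 1 / s n * integral\<^sup>L (M n) h" for n
    proof -
      have "(\<integral>\<^sup>+v. ennreal (\<phi> v) \<partial>M n) = ennreal (\<phi> (x n)) / ennreal (N n) + ennreal (1 / s n) * (\<integral>\<^sup>+v. ennreal (h v) \<partial>M n)"
        unfolding M_def NR[symmetric]
        by (rule nn_integral_resolvent_measure_transfer[OF s0 r(4) _ _ eq])
           (use borel_measurable_continuous_onI[OF \<phi>] borel_measurable_continuous_onI[OF h] in auto)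
      moreover have "(\<integral>\<^sup>+v. ennreal (\<phi> v) \<partial>M n) = ennreal (integral\<^sup>L (M n) \<phi>)"
        by (rule nn_integral_eq_integral[OF int[OF prob sets \<phi> \<phi>B]]) (use \<phi>B in auto)
      moreover have "(\<integral>\<^sup>+v. ennreal (h v) \<partial>M n) = ennreal (integral\<^sup>L (M n) h)"
        by (rule nn_integral_eq_integral[OF int[OF prob sets h hB]]) (use hB in auto)
      moreover have h0: "integral\<^sup>L (M n) h \<ge> 0" "integral\<^sup>L (M n) \<phi> \<ge> 0"
        using hB \<phi>B by (auto intro!: integral_nonneg)
      moreover have "ennreal (\<phi> (x n)) / ennreal (N n) = ennreal (\<phi> (x n) / N n)"
        using \<phi>B N1[of n] by (intro divide_ennreal) auto
      ultimately have "ennreal (integral\<^sup>L (M n) \<phi>) = ennreal (\<phi> (x n) / N n + 1 / s n * integral\<^sup>L (M n) h)"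
        using \<phi>B[of "x n"] N1[of n] s0[of n] by (simp add: ennreal_mult[symmetric] ennreal_plus[symmetric] del: ennreal_plus)
      then show ?thesis
        using h0 \<phi>B[of "x n"] N1[of n] s0[of n] by (subst (asm) ennreal_inj) auto
    qed
    have "(\<lambda>n. \<phi> (x (d n)) / N (d n)) \<longlonglongrightarrow> 0"
    proof (rule Lim_null_comparison)
      show "\<forall>\<^sub>F n in sequentially. norm (\<phi> (x (d n)) / N (d n)) \<le> B * (1 / N (d n))"
      proof (intro always_eventually allI)
        fix n show "norm (\<phi> (x (d n)) / N (d n)) \<le> B * (1 / N (d n))"
          using \<phi>B[of "x (d n)"] N1[of "d n"] by (simp add: divide_right_mono)
      qed
      have "(\<lambda>n. B * (1 / N (d n))) \<longlonglongrightarrow> B * 0"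
        by (intro tendsto_mult tendsto_const LIMSEQ_subseq_LIMSEQ[OF invN \<mu>(1), unfolded o_def])
      then show "(\<lambda>n. B * (1 / N (d n))) \<longlonglongrightarrow> 0" by simp
    qed
    moreover have "(\<lambda>n. 1 / s (d n)) \<longlonglongrightarrow> 1 / r"
      using r(1) by (intro tendsto_divide tendsto_const LIMSEQ_subseq_LIMSEQ[OF r(2) \<mu>(1), unfolded o_def]) auto
    moreover have "(\<lambda>n. integral\<^sup>L (M (d n)) h) \<longlonglongrightarrow> integral\<^sup>L \<mu> h"
      using hB B0 by (intro \<mu>(4)[OF h, of B]) (simp add: abs_le_iff)
    ultimately have "(\<lambda>n. integral\<^sup>L (M (d n)) \<phi>) \<longlonglongrightarrow> 0 + 1 / r * integral\<^sup>L \<mu> h"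
      unfolding rel by (intro tendsto_add tendsto_mult)
    moreover have "(\<lambda>n. integral\<^sup>L (M (d n)) \<phi>) \<longlonglongrightarrow> integral\<^sup>L \<mu> \<phi>"
      using \<phi>B B0 by (intro \<mu>(4)[OF \<phi>, of B]) (simp add: abs_le_iff)
    ultimately have "integral\<^sup>L \<mu> \<phi> = 1 / r * integral\<^sup>L \<mu> h" using LIMSEQ_unique by fastforce
    then show "integral\<^sup>L \<mu> h = r * integral\<^sup>L \<mu> \<phi>" using r(1) by simp
  qed
qed

end

section \<open>Conformality of the eigenmeasure\<close>

lemma infdist_bump_tendsto:
  fixes E :: "complex set" and c0 :: real
  assumes "closed E" "E \<noteq> {}"
  shows "(\<lambda>k. max 0 (1 - (real k + c0) * infdist v E)) \<longlonglongrightarrow> indicator E v"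
proof (cases "v \<in> E")
  case True
  then show ?thesis by simp
next
  case False
  then have d: "infdist v E > 0" using assms by (metis in_closed_iff_infdist_zero infdist_nonneg less_eq_real_def)
  have "eventually (\<lambda>k. real k \<ge> 1 / infdist v E - c0) sequentially"
    using filterlim_real_sequentially unfolding filterlim_at_top by blast
  then have "eventually (\<lambda>k. max 0 (1 - (real k + c0) * infdist v E) = indicator E v) sequentially"
  proof eventually_elim
    case (elim k)
    then have "(1 / infdist v E) * infdist v E \<le> (real k + c0) * infdist v E"
      using d by (intro mult_right_mono) auto
    then have "1 \<le> (real k + c0) * infdist v E" using d by simp
    then show ?case using False by simp
  qed
  then show ?thesis by (rule tendsto_eventually)
qed

section \<open>Local inverse branches and Borel images\<close>

context cyl_map
begin

text \<open>The ball of injectivity is called \<open>2 * \<rho>\<close> to leave room for three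
  radii: sets in \<open>cball v0 \<rho>\<close>, bumps supported in \<open>3/2 * \<rho>\<close>, the
  inverse branch on \<open>2 * \<rho>\<close>.\<close>

lemma g_local_homeomorphism:
  assumes "v0 \<noteq> 0" "v0 \<noteq> of_int l"
  obtains \<rho> h where "\<rho> > 0" "open (g ` ball v0 (2 * \<rho>))" "continuous_on (g ` ball v0 (2 * \<rho>)) h"
    "\<And>v. v \<in> ball v0 (2 * \<rho>) \<Longrightarrow> h (g v) = v"
proof -
  obtain r where r: "r > 0" "inj_on g (ball v0 r)" using g_locally_injective[OF assms] by metis
  obtain h where h: "homeomorphism (ball v0 r) (g ` ball v0 r) g h"
    using invariance_of_domain_homeomorphism[OF open_ball g_continuous _ r(2)] by auto
  have e: "2 * (r / 2) = r" by simp
  show ?thesis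
  proof (rule that[of "r / 2" h])
    show "r / 2 > 0" using r(1) by simp
    show "open (g ` ball v0 (2 * (r / 2)))" by (intro g_open_map open_ball)
    show "continuous_on (g ` ball v0 (2 * (r / 2))) h" using h unfolding e homeomorphism_def by blast
    show "h (g v) = v" if "v \<in> ball v0 (2 * (r / 2))" for v using h that unfolding e homeomorphism_def by blast
  qed
qed

text \<open>The continuous inverse branch turns an image into a preimage.\<close>

lemma g_image_borel_local:
  assumes \<rho>: "\<rho> > 0" and h: "continuous_on (g ` ball v0 (2 * \<rho>)) h" "\<And>v. v \<in> ball v0 (2 * \<rho>) \<Longrightarrow> h (g v) = v"
    and A: "A \<in> sets borel" "A \<subseteq> cball v0 \<rho>"
  shows "g ` A = h -` A \<inter> g ` cball v0 \<rho>" "g ` A \<in> sets borel"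
proof -
  have sub: "cball v0 \<rho> \<subseteq> ball v0 (2 * \<rho>)" using \<rho> by auto
  show eq: "g ` A = h -` A \<inter> g ` cball v0 \<rho>"
    using A(2) h(2) sub by (auto simp: subset_iff)
  have "compact (g ` cball v0 \<rho>)" by (intro compact_continuous_image g_continuous compact_cball)
  then have B: "g ` cball v0 \<rho> \<in> sets borel" by (simp add: borel_closed compact_imp_closed)
  have "h \<in> borel_measurable (restrict_space borel (g ` cball v0 \<rho>))"
    by (rule borel_measurable_continuous_on_restrict)
       (rule continuous_on_subset[OF h(1)], use sub in blast)
  from measurable_sets[OF this A(1)] have "h -` A \<inter> g ` cball v0 \<rho> \<in> sets (restrict_space borel (g ` cball v0 \<rho>))"
    by (simp add: space_restrict_space)
  then show "g ` A \<in> sets borel"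
    unfolding eq using B by (simp add: sets_restrict_space_iff)
qed

lemma countable_ball_cover:
  fixes D :: "complex set" and \<rho> :: "complex \<Rightarrow> real"
  assumes "\<And>v. v \<in> D \<Longrightarrow> \<rho> v > 0"
  obtains C where "countable C" "C \<subseteq> D" "D \<subseteq> (\<Union>v\<in>C. ball v (\<rho> v))"
proof -
  have op: "open S" if "S \<in> (\<lambda>v. ball v (\<rho> v)) ` D" for S using that by auto
  obtain F where F: "F \<subseteq> (\<lambda>v. ball v (\<rho> v)) ` D" "countable F" "\<Union>F = \<Union>((\<lambda>v. ball v (\<rho> v)) ` D)"
    by (rule Lindelof[OF op])
  obtain C where C: "countable C" "C \<subseteq> D" "F = (\<lambda>v. ball v (\<rho> v)) ` C"
    using countable_subset_image[of F "\<lambda>v. ball v (\<rho> v)" D] F(1,2) by blast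
  have "v \<in> (\<Union>v\<in>C. ball v (\<rho> v))" if v: "v \<in> D" for v
  proof -
    have "v \<in> ball v (\<rho> v)" using assms[OF v] by simp
    then show ?thesis using F(3) C(3) v by blast
  qed
  then show ?thesis using that[OF C(1,2)] by blast
qed

text \<open>Away from 0 and \<open>l\<close>, countably many balls with inverse branches suffice;
  the critical point contributes at most one point to the image.\<close>

lemma g_image_borel:
  assumes A: "A \<in> sets borel" "0 \<notin> A" shows "g ` A \<in> sets borel"
proof -
  let ?D = "- {0, of_int l}"
  have "\<exists>\<rho>>0. \<forall>A\<in>sets borel. A \<subseteq> cball v \<rho> \<longrightarrow> g ` A \<in> sets borel" if v: "v \<in> ?D" for v
  proof -
    obtain \<rho> h where \<rho>: "\<rho> > 0" "continuous_on (g ` ball v (2 * \<rho>)) h" "\<And>u. u \<in> ball v (2 * \<rho>) \<Longrightarrow> h (g u) = u"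
      using g_local_homeomorphism[of v] v by (metis ComplD insertI1 insertI2)
    then show ?thesis using g_image_borel_local(2)[OF \<rho>] by blast
  qed
  then obtain \<rho> where \<rho>: "\<And>v. v \<in> ?D \<Longrightarrow> \<rho> v > 0"
    "\<And>v A. v \<in> ?D \<Longrightarrow> A \<in> sets borel \<Longrightarrow> A \<subseteq> cball v (\<rho> v) \<Longrightarrow> g ` A \<in> sets borel" by metis
  obtain C where C: "countable C" "C \<subseteq> ?D" "?D \<subseteq> (\<Union>v\<in>C. ball v (\<rho> v))"
    using countable_ball_cover[of ?D \<rho>] \<rho>(1) by metis
  have "A = (\<Union>v\<in>C. A \<inter> ball v (\<rho> v)) \<union> (A \<inter> {of_int l})"
  proof
    show "A \<subseteq> (\<Union>v\<in>C. A \<inter> ball v (\<rho> v)) \<union> (A \<inter> {of_int l})"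
    proof
      fix u assume u: "u \<in> A"
      show "u \<in> (\<Union>v\<in>C. A \<inter> ball v (\<rho> v)) \<union> (A \<inter> {of_int l})"
      proof (cases "u = of_int l")
        case False
        then have "u \<in> ?D" using u A(2) by auto
        then show ?thesis using C(3) u by blast
      qed (use u in simp)
    qed
  qed auto
  then have "g ` A = (\<Union>v\<in>C. g ` (A \<inter> ball v (\<rho> v))) \<union> g ` (A \<inter> {of_int l})"
    by (metis image_UN image_Un)
  moreover have "g ` (A \<inter> ball v (\<rho> v)) \<in> sets borel" if "v \<in> C" for v
    using that C(2) A(1) by (intro \<rho>(2)[of v]) auto
  moreover have "g ` (A \<inter> {of_int l}) \<in> sets borel"
    by (rule borel_closed, rule finite_imp_closed) auto
  ultimately show ?thesis using C(1) by (auto intro!: sets.countable_UN')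
qed

end

context cyl_eigenmeasure
begin

text \<open>For a function supported in a ball on which \<open>g\<close> is injective, only one preimage contributes to the
  transfer operator, so that its image is again continuous.\<close>

lemma eigenmeasure_bump:
  fixes a :: "complex \<Rightarrow> real"
  assumes \<rho>: "\<rho> > 0" and op: "open (g ` ball v0 (2 * \<rho>))" and hc: "continuous_on (g ` ball v0 (2 * \<rho>)) h"
    and hg: "\<And>v. v \<in> ball v0 (2 * \<rho>) \<Longrightarrow> h (g v) = v"
    and a: "continuous_on UNIV a" "\<And>v. 0 \<le> a v \<and> a v \<le> 1" "\<And>v. v \<notin> cball v0 (3/2 * \<rho>) \<Longrightarrow> a v = 0"
  shows "(\<integral>w. (if w \<in> g ` ball v0 (2 * \<rho>) then a (h w) else 0) \<partial>\<mu>)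
       = r * (\<integral>v. a v * norm (of_int l - v) powr t \<partial>\<mu>)"
proof -
  let ?O = "ball v0 (2 * \<rho>)" and ?C = "cball v0 (3/2 * \<rho>)"
  let ?h = "\<lambda>w. if w \<in> g ` ?O then a (h w) else 0"
  let ?\<phi> = "\<lambda>v. a v * norm (of_int l - v) powr t"
  have CO: "?C \<subseteq> ?O" using \<rho> by auto
  define B where "B = max 1 ((of_int l + norm v0 + 3/2 * \<rho>) powr t)"
  show ?thesis
  proof (rule eig[of ?\<phi> ?h B])
    show "continuous_on UNIV ?\<phi>"
      using t_gt by (intro continuous_intros continuous_on_powr' a(1)) auto
    have "continuous_on (g ` ?O) ?h"
    proof (rule continuous_on_eq)
      show "continuous_on (g ` ?O) (\<lambda>w. a (h w))"
        by (rule continuous_on_compose2[OF a(1) hc]) auto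
    qed auto
    \<comment> \<open>The image of the large ball is open, the image of the support is compact, and
      \<open>?h\<close> vanishes off the latter; this open set and the complement of this compact
      set cover the plane.\<close>
    moreover have "continuous_on (- (g ` ?C)) ?h"
    proof (rule continuous_on_eq)
      show "continuous_on (- (g ` ?C)) (\<lambda>w. 0::real)" by simp
      fix w assume w: "w \<in> - (g ` ?C)"
      show "0 = ?h w"
      proof (cases "w \<in> g ` ?O")
        case True
        then obtain v where v: "v \<in> ?O" "w = g v" by blast
        then have "h w = v" using hg by simp
        moreover have "v \<notin> ?C" using w v by blast
        ultimately show ?thesis using a(3) by simp
      qed simp
    qed
    moreover have "open (- (g ` ?C))"
      by (intro open_Compl compact_imp_closed compact_continuous_image g_continuous compact_cball)
    ultimately have "continuous_on (g ` ?O \<union> - (g ` ?C)) ?h"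
      using op by (intro continuous_on_open_Un)
    moreover have "g ` ?O \<union> - (g ` ?C) = UNIV" using CO by blast
    ultimately show "continuous_on UNIV ?h" by simp
    show "0 \<le> ?h w \<and> ?h w \<le> B" for w using a(2)[of "h w"] unfolding B_def by auto
    show "0 \<le> ?\<phi> v \<and> ?\<phi> v \<le> B" for v
    proof (cases "v \<in> ?C")
      case True
      have "norm v \<le> norm v0 + norm (v - v0)" using norm_triangle_ineq[of v0 "v - v0"] by simp
      then have "norm v \<le> norm v0 + 3/2 * \<rho>" using True by (simp add: dist_norm norm_minus_commute)
      then have "norm (of_int l - v) \<le> of_int l + norm v0 + 3/2 * \<rho>"
        using norm_triangle_ineq4[of "of_int l :: complex" v] l_ge by simp
      then have "norm (of_int l - v) powr t \<le> (of_int l + norm v0 + 3/2 * \<rho>) powr t"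
        using t_gt by (intro powr_mono2) auto
      then have "a v * norm (of_int l - v) powr t \<le> 1 * (of_int l + norm v0 + 3/2 * \<rho>) powr t"
        using a(2)[of v] by (intro mult_mono) auto
      then show ?thesis using a(2)[of v] unfolding B_def by auto
    next
      case False
      then show ?thesis using a(3)[of v] unfolding B_def by simp
    qed
    fix w assume w: "w \<in> X"
    \<comment> \<open>The factor \<open>|l - v| powr t\<close> in the test function cancels the
      weight, so the transform is the plain sum of \<open>a\<close> over the preimages.\<close>
    have eq: "weight t v * ennreal (?\<phi> v) = ennreal (a v)" if "v \<in> X" for v
    proof -
      have "norm (of_int l - v) > 0" using critical_point_notin_X that by auto
      then show ?thesis using a(2)[of v]
        by (simp add: ennreal_mult[symmetric] powr_minus field_simps)
    qed
    have "transfer_op X g (weight t) (\<lambda>u. ennreal (?\<phi> u)) w = (\<integral>\<^sup>+v. ennreal (a v) \<partial>count_space {v\<in>X. g v = w})"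
      unfolding transfer_op_def by (intro nn_integral_cong) (use eq in auto)
    also have "\<dots> = ennreal (?h w)"
    proof (cases "w \<in> g ` ?O")
      case True
      then obtain v1 where v1: "v1 \<in> ?O" "w = g v1" by blast
      have hw: "h w = v1" using hg v1 by simp
      have "(\<integral>\<^sup>+v. ennreal (a v) \<partial>count_space {v\<in>X. g v = w}) = (\<Sum>v\<in>{v1}. ennreal (a v))"
      proof (rule nn_integral_count_space')
        show "{v1} \<subseteq> {v\<in>X. g v = w}" using v1 w g_X_iff by auto
        fix v assume v: "v \<in> {v\<in>X. g v = w}" "v \<notin> {v1}"
        have "v \<notin> ?O" using hg[of v] hw v by auto
        then have "v \<notin> ?C" using CO by blast
        then show "ennreal (a v) = 0" using a(3)[of v] by simp
      qed auto
      then show ?thesis using True hw by simp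
    next
      case False
      have "a v = 0" if "v \<in> {v\<in>X. g v = w}" for v
        using that False a(3)[of v] CO by blast
      then have "(\<integral>\<^sup>+v. ennreal (a v) \<partial>count_space {v\<in>X. g v = w}) = (\<integral>\<^sup>+v. 0 \<partial>count_space {v\<in>X. g v = w})"
        by (intro nn_integral_cong) auto
      then show ?thesis using False by simp
    qed
    finally show "transfer_op X g (weight t) (\<lambda>u. ennreal (?\<phi> u)) w = ennreal (?h w)" .
  qed
qed

text \<open>The bumps decrease to the indicator of \<open>E\<close>, and dominated convergence
  applies on both sides of the identity for bumps.\<close>

lemma eigenmeasure_compact:
  fixes E :: "complex set"
  assumes \<rho>: "\<rho> > 0" and op: "open (g ` ball v0 (2 * \<rho>))" and hc: "continuous_on (g ` ball v0 (2 * \<rho>)) h"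
    and hg: "\<And>v. v \<in> ball v0 (2 * \<rho>) \<Longrightarrow> h (g v) = v"
    and E: "compact E" "E \<subseteq> cball v0 \<rho>"
  shows "emeasure \<mu> (g ` E) = (\<integral>\<^sup>+v. ennreal (r * norm (of_int l - v) powr t) * indicator E v \<partial>\<mu>)"
proof (cases "E = {}")
  case False
  interpret prob_space \<mu> by (rule prob_mu)
  let ?O = "ball v0 (2 * \<rho>)"
  have Kc: "closed E" using E compact_imp_closed by blast
  have mb: "borel_measurable \<mu> = borel_measurable borel" using measurable_cong_sets[OF sets_mu refl] .
  \<comment> \<open>Outside \<open>cball v0 (3/2 * \<rho>)\<close> the distance to \<open>E\<close>
    is at least \<open>\<rho> / 2\<close>, so the slope \<open>2 / \<rho>\<close> already makes the
    bump with \<open>k = 0\<close> vanish there.\<close>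
  define c0 where "c0 = 2 / \<rho>"
  define a where "a k v = max 0 (1 - (real k + c0) * infdist v E)" for k v
  have c0: "c0 > 0" using \<rho> unfolding c0_def by simp
  have a_cont: "continuous_on UNIV (a k)" for k unfolding a_def by (intro continuous_intros)
  have a_bd: "0 \<le> a k v \<and> a k v \<le> 1" for k v
    unfolding a_def using c0 infdist_nonneg[of v E] by (auto intro!: mult_nonneg_nonneg)
  have a_supp: "a k v = 0" if v: "v \<notin> cball v0 (3/2 * \<rho>)" for k v
  proof -
    have "infdist v E \<ge> \<rho> / 2"
    proof -
      obtain u where u: "u \<in> E" "infdist v E = dist v u"
        using infdist_attains_inf[OF Kc False] by blast
      have "dist v0 v \<le> dist v0 u + dist u v" by (rule dist_triangle)
      moreover have "dist v0 u \<le> \<rho>" using u E(2) by auto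
      moreover have "dist v0 v > 3/2 * \<rho>" using v by simp
      ultimately show ?thesis using u(2) by (simp add: dist_commute)
    qed
    moreover have "real k + c0 \<ge> c0" by simp
    ultimately have "(real k + c0) * infdist v E \<ge> c0 * (\<rho> / 2)" using c0 \<rho> by (intro mult_mono) auto
    moreover have "c0 * (\<rho> / 2) = 1" unfolding c0_def using \<rho> by simp
    ultimately show ?thesis unfolding a_def by simp
  qed
  let ?H = "\<lambda>k w. if w \<in> g ` ?O then a k (h w) else 0"
  let ?P = "\<lambda>k v. a k v * norm (of_int l - v) powr t"
  define B where "B = (of_int l + norm v0 + 3/2 * \<rho>) powr t"
  have P_bd: "norm (?P k v) \<le> B" for k v
  proof (cases "v \<in> cball v0 (3/2 * \<rho>)")
    case True
    have "norm v \<le> norm v0 + norm (v - v0)" using norm_triangle_ineq[of v0 "v - v0"] by simp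
    then have "norm v \<le> norm v0 + 3/2 * \<rho>" using True by (simp add: dist_norm norm_minus_commute)
    then have "norm (of_int l - v) \<le> of_int l + norm v0 + 3/2 * \<rho>"
      using norm_triangle_ineq4[of "of_int l :: complex" v] l_ge by simp
    then have "norm (of_int l - v) powr t \<le> B" unfolding B_def
      using t_gt by (intro powr_mono2) auto
    then have "a k v * norm (of_int l - v) powr t \<le> 1 * B"
      using a_bd[of k v] by (intro mult_mono) auto
    then show ?thesis using a_bd[of k v] by (simp add: abs_mult)
  next
    case False
    then show ?thesis using a_supp unfolding B_def by simp
  qed
  have ev: "integral\<^sup>L \<mu> (?H k) = r * integral\<^sup>L \<mu> (?P k)" for k
    by (rule eigenmeasure_bump[OF \<rho> op hc hg a_cont a_bd a_supp])
  have P_cont: "continuous_on UNIV (?P k)" for k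
    using t_gt by (intro continuous_intros continuous_on_powr' a_cont) auto
  have wE_meas: "(\<lambda>v. indicator E v * norm (of_int l - v) powr t) \<in> borel_measurable borel"
  proof (rule borel_measurable_times)
    show "(\<lambda>v. norm (of_int l - v) powr t) \<in> borel_measurable borel"
      using t_gt by (intro borel_measurable_continuous_onI continuous_on_powr' continuous_intros) auto
  qed (use Kc in auto)
  have gK: "compact (g ` E)" by (intro compact_continuous_image g_continuous E)
  have KO: "E \<subseteq> ?O" using E(2) \<rho> by (auto simp: subset_iff)
  have H_meas: "?H k \<in> borel_measurable \<mu>" for k
  proof -
    have "(\<lambda>w. a k (h w)) \<in> borel_measurable (restrict_space borel (g ` ?O))"
      by (intro borel_measurable_continuous_on_restrict continuous_on_compose2[OF a_cont hc]) auto
    then have "(\<lambda>w. indicator (g ` ?O) w *\<^sub>R a k (h w)) \<in> borel_measurable borel"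
      using op by (subst (asm) borel_measurable_restrict_space_iff) auto
    moreover have "(\<lambda>w. indicator (g ` ?O) w *\<^sub>R a k (h w)) = ?H k" by (auto simp: indicator_def)
    ultimately show ?thesis unfolding mb by simp
  qed
  have "(\<lambda>k. integral\<^sup>L \<mu> (?H k)) \<longlonglongrightarrow> (\<integral>w. indicator (g ` E) w \<partial>\<mu>)"
  proof (rule integral_dominated_convergence[where w = "\<lambda>_. 1"])
    show "(\<lambda>w. indicator (g ` E) w :: real) \<in> borel_measurable \<mu>"
      unfolding mb using gK by (auto intro!: borel_measurable_indicator borel_closed compact_imp_closed)
    show "AE w in \<mu>. (\<lambda>k. ?H k w) \<longlonglongrightarrow> indicator (g ` E) w"
    proof (intro AE_I2)
      fix w
      show "(\<lambda>k. ?H k w) \<longlonglongrightarrow> indicator (g ` E) w"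
      proof (cases "w \<in> g ` ?O")
        case True
        then obtain v where v: "v \<in> ?O" "w = g v" by blast
        have hw: "h w = v" using hg v by simp
        have "w \<in> g ` E \<longleftrightarrow> v \<in> E"
        proof
          assume "w \<in> g ` E"
          then obtain u where "u \<in> E" "w = g u" by blast
          then show "v \<in> E" using hg[of u] hw KO by auto
        qed (use v in auto)
        then have "indicator (g ` E) w = (indicator E v :: real)" by (simp add: indicator_def)
        then show ?thesis using True hw infdist_bump_tendsto[OF Kc False, of c0 v] unfolding a_def by simp
      next
        case False
        then have "w \<notin> g ` E" using KO by blast
        then show ?thesis using False by simp
      qed
    qed
    show "\<And>k. AE w in \<mu>. norm (?H k w) \<le> 1" using a_bd by (auto simp: abs_le_iff)
  qed (use H_meas in auto)
  moreover have "(\<lambda>k. r * integral\<^sup>L \<mu> (?P k)) \<longlonglongrightarrow> r * (\<integral>v. indicator E v * norm (of_int l - v) powr t \<partial>\<mu>)"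
  proof (intro tendsto_mult tendsto_const integral_dominated_convergence[where w = "\<lambda>_. B"])
    show "(\<lambda>v. indicator E v * norm (of_int l - v) powr t) \<in> borel_measurable \<mu>"
      unfolding mb by (rule wE_meas)
    show "\<And>k. ?P k \<in> borel_measurable \<mu>" unfolding mb by (rule borel_measurable_continuous_onI[OF P_cont])
    show "AE v in \<mu>. (\<lambda>k. ?P k v) \<longlonglongrightarrow> indicator E v * norm (of_int l - v) powr t"
      unfolding a_def by (intro AE_I2 tendsto_mult tendsto_const infdist_bump_tendsto[OF Kc False])
    show "\<And>k. AE v in \<mu>. norm (?P k v) \<le> B" using P_bd by auto
  qed auto
  ultimately have eq: "(\<integral>w. indicator (g ` E) w \<partial>\<mu>) = r * (\<integral>v. indicator E v * norm (of_int l - v) powr t \<partial>\<mu>)"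
    unfolding ev using LIMSEQ_unique by blast
  have KB: "g ` E \<in> sets \<mu>" "E \<in> sets \<mu>" unfolding sets_mu using gK Kc by (auto intro!: borel_closed compact_imp_closed)
  have bdK: "indicator E v * norm (of_int l - v) powr t \<le> B" for v
  proof (cases "v \<in> E")
    case True
    then have "a 0 v = 1" unfolding a_def by simp
    then show ?thesis using P_bd[of 0 v] True by simp
  qed (simp add: B_def)
  have intK: "integrable \<mu> (\<lambda>v. r * (indicator E v * norm (of_int l - v) powr t))"
  proof (rule integrable_mult_right, rule integrable_const_bound[where B = B])
    show "(\<lambda>v. indicator E v * norm (of_int l - v) powr t) \<in> borel_measurable \<mu>"
      unfolding mb by (rule wE_meas)
    show "AE v in \<mu>. norm (indicator E v * norm (of_int l - v) powr t) \<le> B" using bdK by (simp add: abs_mult)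
  qed
  have "emeasure \<mu> (g ` E) = ennreal (measure \<mu> (g ` E))" by (rule emeasure_eq_measure)
  also have "measure \<mu> (g ` E) = (\<integral>w. indicator (g ` E) w \<partial>\<mu>)"
    using KB(1) sets.sets_into_space[OF KB(1)] by (simp add: Int_absorb2)
  also have "ennreal \<dots> = ennreal (\<integral>v. r * (indicator E v * norm (of_int l - v) powr t) \<partial>\<mu>)" unfolding eq by simp
  also have "\<dots> = (\<integral>\<^sup>+v. ennreal (r * (indicator E v * norm (of_int l - v) powr t)) \<partial>\<mu>)"
    by (rule nn_integral_eq_integral[OF intK, symmetric]) (use r_pos in auto)
  also have "\<dots> = (\<integral>\<^sup>+v. ennreal (r * norm (of_int l - v) powr t) * indicator E v \<partial>\<mu>)"
    by (intro nn_integral_cong) (simp split: split_indicator)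
  finally show ?thesis .
qed simp

end

context cyl_eigenmeasure
begin

lemma density_measurable: "(\<lambda>v::complex. ennreal (r * norm (of_int l - v) powr t)) \<in> borel_measurable borel"
proof -
  have "(\<lambda>v::complex. norm (of_int l - v) powr t) \<in> borel_measurable borel"
    using t_gt by (intro borel_measurable_continuous_onI continuous_on_powr' continuous_intros) auto
  then show ?thesis by auto
qed

text \<open>Both sides are finite measures in \<open>A\<close>; they agree on closed sets, which
  form a generator of the Borel sets stable under intersection.\<close>

lemma eigenmeasure_local:
  assumes \<rho>: "\<rho> > 0" and op: "open (g ` ball v0 (2 * \<rho>))" and hc: "continuous_on (g ` ball v0 (2 * \<rho>)) h"
    and hg: "\<And>v. v \<in> ball v0 (2 * \<rho>) \<Longrightarrow> h (g v) = v"
    and A: "A \<in> sets borel" "A \<subseteq> cball v0 \<rho>"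
  shows "emeasure \<mu> (g ` A) = (\<integral>\<^sup>+v. ennreal (r * norm (of_int l - v) powr t) * indicator A v \<partial>\<mu>)"
proof -
  interpret prob_space \<mu> by (rule prob_mu)
  let ?B = "cball v0 \<rho>" and ?w = "\<lambda>v. ennreal (r * norm (of_int l - v) powr t)"
  have sp: "space \<mu> = UNIV" using sets_eq_imp_space_eq[OF sets_mu] by simp
  have mb: "borel_measurable \<mu> = borel_measurable borel" using measurable_cong_sets[OF sets_mu refl] .
  have wm: "?w \<in> borel_measurable \<mu>" unfolding mb by (rule density_measurable)
  define M1 where "M1 = distr (restrict_space \<mu> (g ` ?B)) borel h"
  define M2 where "M2 = density \<mu> (\<lambda>v. ?w v * indicator ?B v)"
  have BO: "?B \<subseteq> ball v0 (2 * \<rho>)" using \<rho> by auto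
  have gB: "g ` ?B \<in> sets borel"
    by (rule g_image_borel_local(2)[OF \<rho> hc hg]) auto
  have hm: "h \<in> borel_measurable (restrict_space \<mu> (g ` ?B))"
  proof -
    have "h \<in> borel_measurable (restrict_space borel (g ` ?B))"
      by (rule borel_measurable_continuous_on_restrict, rule continuous_on_subset[OF hc]) (use BO in blast)
    moreover have "sets (restrict_space \<mu> (g ` ?B)) = sets (restrict_space borel (g ` ?B))"
      by (intro sets_restrict_space_cong sets_mu)
    ultimately show ?thesis using measurable_cong_sets by blast
  qed
  have e1: "emeasure M1 C = emeasure \<mu> (g ` (?B \<inter> C))" if C: "C \<in> sets borel" for C
  proof -
    have "emeasure M1 C = emeasure (restrict_space \<mu> (g ` ?B)) (h -` C \<inter> (g ` ?B))"
      unfolding M1_def emeasure_distr[OF hm C] space_restrict_space sp by simp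
    also have "\<dots> = emeasure \<mu> (h -` C \<inter> (g ` ?B))"
    proof (rule emeasure_restrict_space)
      show "g ` ?B \<inter> space \<mu> \<in> sets \<mu>" unfolding sp sets_mu using gB by simp
    qed blast
    also have "h -` C \<inter> (g ` ?B) = g ` (?B \<inter> C)"
    proof -
      have "h (g v) = v" if "v \<in> ?B" for v using hg BO that by blast
      then show ?thesis by force
    qed
    finally show ?thesis .
  qed
  have e2: "emeasure M2 C = (\<integral>\<^sup>+v. ?w v * indicator (?B \<inter> C) v \<partial>\<mu>)" if C: "C \<in> sets borel" for C
  proof -
    have "(\<lambda>v. ?w v * indicator ?B v) \<in> borel_measurable \<mu>"
      by (intro borel_measurable_times_ennreal wm borel_measurable_indicator) (simp add: sets_mu)
    then have "emeasure M2 C = (\<integral>\<^sup>+v. ?w v * indicator ?B v * indicator C v \<partial>\<mu>)"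
      unfolding M2_def using C sets_mu by (simp add: emeasure_density)
    also have "\<dots> = (\<integral>\<^sup>+v. ?w v * indicator (?B \<inter> C) v \<partial>\<mu>)"
      by (intro nn_integral_cong) (simp split: split_indicator)
    finally show ?thesis .
  qed
  have eq: "emeasure M1 C = emeasure M2 C" if C: "closed C" for C
    unfolding e1[OF borel_closed[OF C]] e2[OF borel_closed[OF C]]
    by (rule eigenmeasure_compact[OF \<rho> op hc hg]) (use C in \<open>auto simp: compact_Int_closed\<close>)
  have "M1 = M2"
  proof (rule measure_eqI_generator_eq[where \<Omega> = UNIV and E = "Collect closed" and A = "\<lambda>_. UNIV"])
    show "Int_stable (Collect closed :: complex set set)" by (auto simp: Int_stable_def)
    show "sets M1 = sigma_sets UNIV (Collect closed)"
      unfolding M1_def by (simp add: borel_eq_closed)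
    show "sets M2 = sigma_sets UNIV (Collect closed)"
      unfolding M2_def by (simp add: sets_mu borel_eq_closed)
    show "emeasure M1 UNIV \<noteq> \<infinity>" for i :: nat
      using e1[of UNIV] emeasure_finite by simp
  qed (use eq in auto)
  moreover have "?B \<inter> A = A" using A(2) by blast
  ultimately show ?thesis using e1[OF A(1)] e2[OF A(1)] by simp
qed

text \<open>\<open>A\<close> is cut into countably many disjoint pieces, each in a ball with an
  inverse branch; injectivity on all of \<open>A\<close> keeps their images disjoint.\<close>

lemma eigenmeasure_conformal:
  assumes A: "A \<in> sets borel" "A \<subseteq> X" and inj: "inj_on g A"
  shows "emeasure \<mu> (g ` A) = (\<integral>\<^sup>+v. ennreal (r * norm (of_int l - v) powr t) * indicator A v \<partial>\<mu>)"
proof -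
  let ?w = "\<lambda>v. ennreal (r * norm (of_int l - v) powr t)"
  have mb: "borel_measurable \<mu> = borel_measurable borel" using measurable_cong_sets[OF sets_mu refl] .
  have "\<exists>\<rho>>0. \<forall>A\<in>sets borel. A \<subseteq> cball v \<rho> \<longrightarrow> emeasure \<mu> (g ` A) = (\<integral>\<^sup>+v. ?w v * indicator A v \<partial>\<mu>)"
    if v: "v \<in> X" for v
  proof -
    have "v \<noteq> 0" "v \<noteq> of_int l" using X_nz[OF v] critical_point_notin_X v by auto
    then obtain \<rho> h where h: "\<rho> > 0" "open (g ` ball v (2 * \<rho>))" "continuous_on (g ` ball v (2 * \<rho>)) h"
      "\<And>u. u \<in> ball v (2 * \<rho>) \<Longrightarrow> h (g u) = u" using g_local_homeomorphism[of v] by metis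
    show ?thesis by (intro exI[of _ \<rho>] conjI h(1) ballI impI eigenmeasure_local[OF h])
  qed
  then obtain \<rho> where \<rho>: "\<And>v. v \<in> X \<Longrightarrow> \<rho> v > 0"
    "\<And>v A. v \<in> X \<Longrightarrow> A \<in> sets borel \<Longrightarrow> A \<subseteq> cball v (\<rho> v) \<Longrightarrow> emeasure \<mu> (g ` A) = (\<integral>\<^sup>+v. ?w v * indicator A v \<partial>\<mu>)"
    by metis
  obtain C where C: "countable C" "C \<subseteq> X" "X \<subseteq> (\<Union>v\<in>C. ball v (\<rho> v))"
    by (rule countable_ball_cover[OF \<rho>(1)])
  have Cne: "C \<noteq> {}"
  proof
    assume "C = {}"
    then have "X \<subseteq> {}" using C(3) by simp
    then show False using X_nonempty by simp
  qed
  define b where "b = from_nat_into C"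
  have b: "range b = C" unfolding b_def by (rule range_from_nat_into[OF Cne C(1)])
  define D where "D = disjointed (\<lambda>i. A \<inter> ball (b i) (\<rho> (b i)))"
  have bX: "b i \<in> X" for i using b C(2) by blast
  have UD: "(\<Union>i. D i) = A"
  proof -
    have "(\<Union>i. D i) = (\<Union>i. A \<inter> ball (b i) (\<rho> (b i)))" unfolding D_def by (rule UN_disjointed_eq)
    also have "\<dots> = A \<inter> (\<Union>v\<in>C. ball v (\<rho> v))" unfolding b[symmetric] Int_UN_distrib image_image by simp
    also have "\<dots> = A" by (rule Int_absorb2[OF order_trans[OF A(2) C(3)]])
    finally show ?thesis .
  qed
  have disj: "disjoint_family D" unfolding D_def by (rule disjoint_family_disjointed)
  have Dsub: "D i \<subseteq> A \<inter> ball (b i) (\<rho> (b i))" for i unfolding D_def by (rule disjointed_subset)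
  have Dm: "D i \<in> sets borel" for i
  proof -
    have "range (\<lambda>i. A \<inter> ball (b i) (\<rho> (b i))) \<subseteq> sets borel" using A(1) by auto
    then have "range D \<subseteq> sets borel" unfolding D_def by (rule sets.range_disjointed_sets)
    then show ?thesis by blast
  qed
  have gD: "emeasure \<mu> (g ` D i) = (\<integral>\<^sup>+v. ?w v * indicator (D i) v \<partial>\<mu>)" for i
  proof (rule \<rho>(2)[OF bX[of i] Dm])
    show "D i \<subseteq> cball (b i) (\<rho> (b i))" using Dsub[of i] ball_subset_cball by blast
  qed
  have gDm: "g ` D i \<in> sets \<mu>" for i
    unfolding sets_mu by (rule g_image_borel[OF Dm]) (use Dsub[of i] A(2) X_nz in auto)
  have gdisj: "disjoint_family (\<lambda>i. g ` D i)"
    unfolding disjoint_family_on_def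
  proof (intro ballI impI)
    fix i j :: nat assume "i \<noteq> j"
    then have "D i \<inter> D j = {}" using disj by (simp add: disjoint_family_on_def)
    then show "g ` D i \<inter> g ` D j = {}"
      using inj_on_image_Int[OF inj, of "D i" "D j"] Dsub[of i] Dsub[of j] by auto
  qed
  have "g ` A = (\<Union>i. g ` D i)" unfolding UD[symmetric] by blast
  then have "emeasure \<mu> (g ` A) = (\<Sum>i. emeasure \<mu> (g ` D i))"
    using suminf_emeasure[OF _ gdisj] gDm by (simp add: image_subset_iff)
  also have "\<dots> = (\<Sum>i. \<integral>\<^sup>+v. ?w v * indicator (D i) v \<partial>\<mu>)" unfolding gD ..
  also have "\<dots> = (\<integral>\<^sup>+v. (\<Sum>i. ?w v * indicator (D i) v) \<partial>\<mu>)"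
  proof (rule nn_integral_suminf[symmetric])
    show "(\<lambda>v. ?w v * indicator (D i) v) \<in> borel_measurable \<mu>" for i
      unfolding mb using density_measurable Dm by (intro borel_measurable_times_ennreal) auto
  qed
  also have "\<dots> = (\<integral>\<^sup>+v. ?w v * indicator A v \<partial>\<mu>)"
    unfolding ennreal_suminf_cmult suminf_indicator[OF disj] UD ..
  finally show ?thesis .
qed

end

section \<open>The cylinder as the punctured plane\<close>

lift_definition cyl_exp :: "cyl \<Rightarrow> complex" is exp
  unfolding cyl_rel_def by (auto simp: exp_cyl_shift)

lemma cyl_exp_proj [simp]: "cyl_exp (cyl_proj z) = exp z"
  by transfer simp

lemma cyl_proj_eq_iff: "cyl_proj z = cyl_proj w \<longleftrightarrow> exp z = exp w"
proof
  assume "cyl_proj z = cyl_proj w"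
  then show "exp z = exp w" by (metis cyl_exp_proj)
next
  assume "exp z = exp w"
  then obtain k :: int where k: "w = z + (of_int (2 * k) * pi) * \<i>" by (metis exp_eq)
  then have "cyl_rel z w" unfolding cyl_rel_def by (intro exI[of _ k]) simp
  then show "cyl_proj z = cyl_proj w" by transfer
qed

lemma cyl_proj_surj: "\<exists>z. x = cyl_proj z"
  by transfer (auto intro: equivp_reflp[OF equivp_cyl_rel])

definition cyl_log :: "complex \<Rightarrow> cyl" where "cyl_log w = cyl_proj (Ln w)"

lemma cyl_exp_nz: "cyl_exp x \<noteq> 0"
  using cyl_proj_surj[of x] by auto

lemma cyl_log_exp: "cyl_log (cyl_exp x) = x"
proof -
  obtain z where "x = cyl_proj z" using cyl_proj_surj by blast
  then show ?thesis unfolding cyl_log_def by (simp add: cyl_proj_eq_iff)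
qed

lemma cyl_exp_log: "w \<noteq> 0 \<Longrightarrow> cyl_exp (cyl_log w) = w"
  unfolding cyl_log_def by simp

lemma cyl_exp_inj: "cyl_exp x = cyl_exp y \<longleftrightarrow> x = y"
  by (metis cyl_log_exp)

lemma cyl_exp_measurable: "cyl_exp \<in> borel_measurable borel"
proof (rule borel_measurableI)
  fix U :: "complex set" assume "open U"
  then have "open (exp -` U :: complex set)" by (intro open_vimage continuous_intros)
  moreover have "cyl_proj -` (cyl_exp -` U) = exp -` U" by auto
  ultimately have "open (cyl_exp -` U)" unfolding open_cyl_def by simp
  then show "cyl_exp -` U \<inter> space borel \<in> sets borel" by simp
qed

text \<open>The jump of \<open>Ln\<close> across its cut is a period, so \<open>cyl_log\<close> is
  continuous off 0, which shows in the openness of \<open>exp\<close>. At 0 the value of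
  \<open>Ln\<close> is a mere convention, and the preimage gains at most the Borel set
  \<open>{0}\<close>.\<close>

lemma cyl_log_measurable: "cyl_log \<in> borel_measurable borel"
proof (rule borel_measurableI)
  fix U :: "cyl set" assume "open U"
  then have "open (exp ` (cyl_proj -` U))" unfolding open_cyl_def by (rule open_exp_image)
  moreover have "cyl_log -` U - {0} = exp ` (cyl_proj -` U)"
  proof
    show "cyl_log -` U - {0} \<subseteq> exp ` (cyl_proj -` U)"
    proof
      fix w assume "w \<in> cyl_log -` U - {0}"
      then show "w \<in> exp ` (cyl_proj -` U)"
        unfolding cyl_log_def by (intro image_eqI[of _ _ "Ln w"]) auto
    qed
    show "exp ` (cyl_proj -` U) \<subseteq> cyl_log -` U - {0}"
    proof
      fix w assume "w \<in> exp ` (cyl_proj -` U)"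
      then obtain z where z: "cyl_proj z \<in> U" "w = exp z" by blast
      have "cyl_log w = cyl_proj z" unfolding z(2) using cyl_log_exp[of "cyl_proj z"] by simp
      then show "w \<in> cyl_log -` U - {0}" using z by simp
    qed
  qed
  moreover have "cyl_log -` U = (cyl_log -` U - {0}) \<union> (cyl_log -` U \<inter> {0})" by blast
  moreover have "cyl_log -` U \<inter> {0} \<in> sets borel" by (rule borel_closed) (simp add: finite_imp_closed)
  ultimately show "cyl_log -` U \<inter> space borel \<in> sets borel" by (metis borel_open sets.Un inf_top_right space_borel)
qed

context cyl_map
begin

lemma cyl_exp_F: "cyl_exp (F_map l c x) = g (cyl_exp x)"
proof -
  obtain z where z: "x = cyl_proj z" using cyl_proj_surj by blast
  have "F_map l c (cyl_proj z) = cyl_proj (f z)" using F_map_proj[of l c] by (metis comp_apply)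
  then show ?thesis unfolding z by (simp add: exp_f)
qed

lemma F_deriv_abs_eq: "F_deriv_abs l c x = norm (of_int l - cyl_exp x)"
proof -
  obtain z where z: "x = cyl_proj z" using cyl_proj_surj by blast
  show ?thesis unfolding z by (simp add: F_deriv_abs_proj)
qed

text \<open>The closed Julia set is a countable union of compact sets, and so is its image.\<close>

lemma exp_julia_borel: "exp ` julia_set f \<in> sets borel"
proof -
  have "exp ` julia_set f = (\<Union>n::nat. exp ` (julia_set f \<inter> cball 0 (real n)))"
  proof -
    have "julia_set f = (\<Union>n::nat. julia_set f \<inter> cball 0 (real n))"
      using real_arch_simple by (auto simp: set_eq_iff)
    then show ?thesis by (metis image_UN)
  qed
  moreover have "compact (exp ` (julia_set f \<inter> cball 0 (real n)))" for n :: nat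
    by (intro compact_continuous_image continuous_intros closed_Int_compact julia_set_closed compact_cball)
  then have "exp ` (julia_set f \<inter> cball 0 (real n)) \<in> sets borel" for n :: nat
    by (intro borel_closed compact_imp_closed)
  ultimately show ?thesis by (auto intro!: sets.countable_UN)
qed

lemma julia_cyl_borel: "julia_cyl l c \<in> sets borel"
proof -
  have "julia_cyl l c = cyl_exp -` (exp ` julia_set f) \<inter> space borel"
  proof -
    have "x \<in> julia_cyl l c \<longleftrightarrow> cyl_exp x \<in> exp ` julia_set f" for x
    proof
      assume "cyl_exp x \<in> exp ` julia_set f"
      then obtain z where z: "z \<in> julia_set f" "cyl_exp x = cyl_exp (cyl_proj z)" by auto
      then show "x \<in> julia_cyl l c" unfolding julia_cyl_def cyl_exp_inj by blast
    qed (auto simp: julia_cyl_def)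
    then show ?thesis by auto
  qed
  then show ?thesis using measurable_sets[OF cyl_exp_measurable exp_julia_borel] by simp
qed

lemma F_julia_cyl: "x \<in> julia_cyl l c \<Longrightarrow> F_map l c x \<in> julia_cyl l c"
  unfolding julia_cyl_def using f_julia F_map_proj[of l c] by (metis (no_types, lifting) comp_apply image_iff)

lemma cyl_log_X: "w \<in> X \<Longrightarrow> cyl_log w \<in> julia_cyl l c"
  unfolding julia_cyl_def cyl_log_def using X_lift_in_julia[of "Ln w"] X_nz[of w] by simp

lemma F_image_borel:
  assumes A: "A \<in> sets borel" shows "F_map l c ` A \<in> sets borel"
proof -
  have "cyl_exp ` A = (cyl_log -` A \<inter> space borel) - {0}"
    using cyl_exp_nz cyl_log_exp cyl_exp_log by (auto simp: image_iff) (metis cyl_exp_log)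
  then have "cyl_exp ` A \<in> sets borel"
    using measurable_sets[OF cyl_log_measurable A] by (metis borel_singleton sets.Diff sets.empty_sets)
  moreover have "0 \<notin> cyl_exp ` A" using cyl_exp_nz by (metis image_iff)
  ultimately have "g ` cyl_exp ` A \<in> sets borel" by (rule g_image_borel)
  moreover have "F_map l c ` A = cyl_exp -` (g ` cyl_exp ` A) \<inter> space borel"
    by (auto simp: image_iff) (metis cyl_exp_F, metis cyl_exp_F cyl_exp_inj)
  ultimately show ?thesis using measurable_sets[OF cyl_exp_measurable] by metis
qed

end

section \<open>Transport of the eigenmeasure to the cylinder\<close>

context cyl_eigenmeasure
begin

definition cyl_measure :: "cyl measure" where
  "cyl_measure = distr (restrict_space \<mu> X) (restrict_space borel (julia_cyl l c)) cyl_log"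

lemma space_restrict_mu: "space (restrict_space \<mu> X) = X"
  using sets_eq_imp_space_eq[OF sets_mu] by (simp add: space_restrict_space)

lemma cyl_log_measurable_X: "cyl_log \<in> measurable (restrict_space \<mu> X) (restrict_space borel (julia_cyl l c))"
proof (rule measurable_restrict_space2)
  show "cyl_log \<in> space (restrict_space \<mu> X) \<rightarrow> julia_cyl l c"
    unfolding space_restrict_mu using cyl_log_X by blast
  have "cyl_log \<in> borel_measurable \<mu>" using cyl_log_measurable measurable_cong_sets[OF sets_mu refl] by blast
  then show "cyl_log \<in> borel_measurable (restrict_space \<mu> X)" by (rule measurable_restrict_space1)
qed

lemma emeasure_cyl_measure:
  assumes "A \<in> sets (restrict_space borel (julia_cyl l c))"
  shows "emeasure cyl_measure A = emeasure \<mu> (cyl_log -` A \<inter> X)"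
proof -
  have "emeasure cyl_measure A = emeasure (restrict_space \<mu> X) (cyl_log -` A \<inter> X)"
    unfolding cyl_measure_def using assms by (simp add: emeasure_distr[OF cyl_log_measurable_X] space_restrict_mu)
  also have "\<dots> = emeasure \<mu> (cyl_log -` A \<inter> X)"
    by (rule emeasure_restrict_space) (use X_borel sets_mu sets_eq_imp_space_eq[OF sets_mu] in auto)
  finally show ?thesis .
qed

lemma emeasure_cyl_measure_total: "emeasure cyl_measure (julia_cyl l c) = 1"
proof -
  interpret prob_space \<mu> by (rule prob_mu)
  have sp: "space \<mu> = UNIV" using sets_eq_imp_space_eq[OF sets_mu] by simp
  have "julia_cyl l c \<in> sets (restrict_space borel (julia_cyl l c))"
    using sets.top[of "restrict_space borel (julia_cyl l c)"] by (simp add: space_restrict_space)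
  then have "emeasure cyl_measure (julia_cyl l c) = emeasure \<mu> (cyl_log -` julia_cyl l c \<inter> X)"
    by (rule emeasure_cyl_measure)
  also have "cyl_log -` julia_cyl l c \<inter> X = X" using cyl_log_X by auto
  also have "emeasure \<mu> X = emeasure \<mu> X + emeasure \<mu> (- X)" using null_mu by simp
  also have "\<dots> = emeasure \<mu> (X \<union> - X)" using X_borel sets_mu by (intro plus_emeasure) auto
  also have "\<dots> = 1" using emeasure_space_1 sp by simp
  finally show ?thesis .
qed

lemma conformal_cyl_measure: "conformal_measure l c t r cyl_measure"
  unfolding conformal_measure_def
proof (intro conjI ballI impI)
  show "space cyl_measure = julia_cyl l c" unfolding cyl_measure_def by (simp add: space_restrict_space)
  show sets_m: "sets cyl_measure = sets (restrict_space borel (julia_cyl l c))" unfolding cyl_measure_def by simp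
  fix A assume A: "A \<in> sets cyl_measure" and inj: "inj_on (F_map l c) A"
  have AJ: "A \<subseteq> julia_cyl l c" "A \<in> sets borel"
    using A julia_cyl_borel unfolding sets_m by (auto simp: sets_restrict_space_iff)
  define A' where "A' = cyl_log -` A \<inter> X"
  have A'm: "A' \<in> sets borel"
  proof -
    have "cyl_log -` A \<in> sets borel" using measurable_sets[OF cyl_log_measurable AJ(2)] by simp
    then show ?thesis unfolding A'_def using X_borel by blast
  qed
  have nz: "w \<noteq> 0" if "w \<in> A'" for w using that X_nz unfolding A'_def by blast
  have injg: "inj_on g A'"
  proof (rule inj_onI)
    fix v w assume vw: "v \<in> A'" "w \<in> A'" "g v = g w"
    then have "cyl_exp (F_map l c (cyl_log v)) = cyl_exp (F_map l c (cyl_log w))"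
      using nz by (simp add: cyl_exp_F cyl_exp_log)
    then have "cyl_log v = cyl_log w" using inj vw unfolding A'_def cyl_exp_inj by (auto dest: inj_onD)
    then show "v = w" using cyl_exp_log nz vw by metis
  qed
  have FA: "F_map l c ` A \<in> sets (restrict_space borel (julia_cyl l c))"
  proof -
    have "F_map l c ` A \<subseteq> julia_cyl l c" using AJ(1) F_julia_cyl by blast
    then show ?thesis using F_image_borel[OF AJ(2)] julia_cyl_borel by (simp add: sets_restrict_space_iff)
  qed
  have img: "cyl_log -` (F_map l c ` A) \<inter> X = g ` A'"
  proof
    show "cyl_log -` (F_map l c ` A) \<inter> X \<subseteq> g ` A'"
    proof
      fix w assume w: "w \<in> cyl_log -` (F_map l c ` A) \<inter> X"
      then obtain x where x: "x \<in> A" "cyl_log w = F_map l c x" by auto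
      have "w = g (cyl_exp x)" using x(2) w X_nz cyl_exp_log cyl_exp_F by (metis IntD2)
      moreover have "cyl_exp x \<in> A'" using x(1) w calculation g_X_iff unfolding A'_def by (simp add: cyl_log_exp)
      ultimately show "w \<in> g ` A'" by blast
    qed
    show "g ` A' \<subseteq> cyl_log -` (F_map l c ` A) \<inter> X"
    proof
      fix w assume "w \<in> g ` A'"
      then obtain v where v: "v \<in> A'" "w = g v" by blast
      have "cyl_log w = F_map l c (cyl_log v)"
        using v nz by (metis cyl_exp_F cyl_exp_log cyl_log_exp)
      moreover have "w \<in> X" using v g_X_iff unfolding A'_def by blast
      ultimately show "w \<in> cyl_log -` (F_map l c ` A) \<inter> X" using v unfolding A'_def by auto
    qed
  qed
  have "emeasure cyl_measure (F_map l c ` A) = emeasure \<mu> (g ` A')"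
    unfolding emeasure_cyl_measure[OF FA] img ..
  also have "\<dots> = (\<integral>\<^sup>+v. ennreal (r * norm (of_int l - v) powr t) * indicator A' v \<partial>\<mu>)"
    by (rule eigenmeasure_conformal[OF A'm _ injg]) (simp add: A'_def)
  also have "\<dots> = (\<integral>\<^sup>+v. (ennreal (r * norm (of_int l - v) powr t) * indicator A (cyl_log v)) * indicator X v \<partial>\<mu>)"
    by (intro nn_integral_cong) (simp add: A'_def split: split_indicator)
  also have "\<dots> = (\<integral>\<^sup>+v. ennreal (r * norm (of_int l - v) powr t) * indicator A (cyl_log v) \<partial>restrict_space \<mu> X)"
    by (rule nn_integral_restrict_space[symmetric]) (use X_borel sets_mu sets_eq_imp_space_eq[OF sets_mu] in auto)
  also have "\<dots> = (\<integral>\<^sup>+v. ennreal (r * F_deriv_abs l c (cyl_log v) powr t) * indicator A (cyl_log v) \<partial>restrict_space \<mu> X)"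
    by (intro nn_integral_cong) (simp add: space_restrict_mu F_deriv_abs_eq cyl_exp_log X_nz)
  also have "\<dots> = (\<integral>\<^sup>+x. ennreal (r * F_deriv_abs l c x powr t) * indicator A x \<partial>cyl_measure)"
    unfolding cyl_measure_def
  proof (rule nn_integral_distr[OF cyl_log_measurable_X, symmetric])
    have "(\<lambda>x. ennreal (r * F_deriv_abs l c x powr t)) \<in> borel_measurable borel"
      unfolding F_deriv_abs_eq by (rule measurable_compose[OF cyl_exp_measurable density_measurable])
    then have "(\<lambda>x. ennreal (r * F_deriv_abs l c x powr t) * indicator A x) \<in> borel_measurable borel"
      using AJ(2) by (intro borel_measurable_times_ennreal) auto
    then have "(\<lambda>x. ennreal (r * F_deriv_abs l c x powr t) * indicator A x) \<in> borel_measurable (restrict_space borel (julia_cyl l c))"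
      by (rule measurable_restrict_space1)
    then show "(\<lambda>x. ennreal (r * F_deriv_abs l c x powr t) * indicator A x)
        \<in> borel_measurable (distr (restrict_space \<mu> X) (restrict_space borel (julia_cyl l c)) cyl_log)" by simp
  qed
  finally show "emeasure cyl_measure (F_map l c ` A) = (\<integral>\<^sup>+x\<in>A. ennreal (r * F_deriv_abs l c x powr t) \<partial>cyl_measure)" .
qed

end

theorem theorem3:
  fixes l :: int and c :: complex and t :: real
  assumes "l \<ge> 2" and "c \<in> ball (of_int l) 1" and "t > 1"
  shows "\<exists>\<alpha>>0. \<exists>m. conformal_measure l c t \<alpha> m \<and> emeasure m (julia_cyl l c) = 1"
proof -
  interpret cyl_map l c using assms by unfold_locales
  obtain r \<mu> where "cyl_eigenmeasure l c t r \<mu>" using transfer_eigenmeasure[OF assms(3)] by blast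
  then interpret cyl_eigenmeasure l c t r \<mu> .
  show ?thesis using r_pos conformal_cyl_measure emeasure_cyl_measure_total by blast
qed

end
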